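(* Let $\mathcal A$ be a deterministic extended 1-clock PTA and $v$ a parameter valuation. The set of parameter valuations $v'$ such that $\mathcal L(v'(\mathcal A))=\mathcal L(v(\mathcal A))$ is computable in time proportional to $|L|\times 2^{|LT|(|LT|+1)}$, where $|L|$ is the number of locations and $|LT|$ the number of distinct parametric linear terms in the guards and invariants of $\mathcal A$.
   Context: An extended 1-clock PTA is a PTA $(\Sigma,L,\ell_0,\{x\},P,I,E)$ with a single real-valued clock $x$, finitely many parameters $P$ (nonnegative rationals), and whose guards and invariants are conjunctions of constraints $x\sim\sum_i\alpha_ip_i+c$ ($p_i\in P$, $\alpha_i,c\in\mathbb Z$); edges $(\ell,g,a,R,\ell')$. It is deterministic if for every location $\ell$ and action $a$ there is at most one edge with source $\ell$ labelled $a$. For a parameter valuation $v$, $v(\mathcal A)$ is the timed automaton obtained by substituting parameter values, with steps for delay $d\ge0$ when $w+d$ satisfies the guard and $w'=(w+d)[R\mapsto0]$ (configurations satisfy invariants). A run is a maximal step sequence from $(\ell_0,0)$ (finite only if it ends in a configuration with no outgoing step); $\mathcal L(v(\mathcal A))$ is the set of action sequences of runs.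
   Formalization: The constant of proportionality may depend on the number of actions and the number of parameters (a universal constant is impossible, as all edges and coefficients must be read); time is counted in unit-cost operations on integers. *)

theory Defs
  imports Complex_Main "HOL-Library.FuncSet"
begin

section \<open>One-clock timed automata\<close>

datatype cmp = Lt | Le | Eq | Ge | Gt

fun holds :: "cmp \<Rightarrow> 'n::linorder \<Rightarrow> 'n \<Rightarrow> bool" where
  "holds Lt x b = (x < b)"
| "holds Le x b = (x \<le> b)"
| "holds Eq x b = (x = b)"
| "holds Ge x b = (x \<ge> b)"
| "holds Gt x b = (x > b)"

text \<open>
  A guard is a finite conjunction of constraints \<open>x \<sim> t\<close> on the unique clock \<open>x\<close>, given
  as the set of its conjuncts \<open>(\<sim>, t)\<close>; the empty set is the guard true.  An edge is
  \<open>(l, g, a, r, l')\<close>, where \<open>r\<close> says whether its reset set is \<open>{x}\<close> or empty.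
  Bounds are of type \<open>'t\<close>: linear terms for parametric automata, rationals for timed automata.
\<close>

type_synonym 't guard = "(cmp \<times> 't) set"

type_synonym ('l, 'a, 't) edge = "'l \<times> 't guard \<times> 'a \<times> bool \<times> 'l"

record ('l, 'a, 't) automaton =
  locs :: "'l set"
  acts :: "'a set"
  start :: "'l"
  invar :: "'l \<Rightarrow> 't guard"
  edges :: "('l, 'a, 't) edge set"

definition sat :: "rat guard \<Rightarrow> real \<Rightarrow> bool" where
  "sat g w \<longleftrightarrow> (\<forall>(c, b) \<in> g. holds c w (of_rat b))"

type_synonym 'l config = "'l \<times> real"

definition configs :: "('l, 'a, rat) automaton \<Rightarrow> 'l config set" where
  "configs B = {(l, w). l \<in> locs B \<and> 0 \<le> w \<and> sat (invar B l) w}"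

text \<open>The invariant of the source location has to hold throughout the delay.\<close>

definition step :: "('l, 'a, rat) automaton \<Rightarrow> 'l config \<Rightarrow> 'a \<Rightarrow> 'l config \<Rightarrow> bool" where
  "step B = (\<lambda>(l, w) a (l', w').
     \<exists>d \<ge> 0. \<exists>g r. (l, g, a, r, l') \<in> edges B
       \<and> (\<forall>d' \<in> {0..d}. (l, w + d') \<in> configs B)
       \<and> sat g (w + d)
       \<and> w' = (if r then 0 else w + d)
       \<and> (l', w') \<in> configs B)"

datatype 'a word = Fin "'a list" | Inf "nat \<Rightarrow> 'a"

text \<open>
  Runs are the infinite step sequences from the initial configuration and the finite ones that
  cannot be prolonged.  If clock value 0 violates the invariant of the initial location, there
  is no initial configuration and the language is empty.
\<close>

definition lang :: "('l, 'a, rat) automaton \<Rightarrow> 'a word set" where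
  "lang B =
     {Fin as | as. \<exists>cs. length cs = Suc (length as)
        \<and> cs ! 0 = (start B, 0) \<and> cs ! 0 \<in> configs B
        \<and> (\<forall>i < length as. step B (cs ! i) (as ! i) (cs ! Suc i))
        \<and> \<not> (\<exists>a c. step B (last cs) a c)}
   \<union> {Inf f | f. \<exists>cs :: nat \<Rightarrow> 'l config.
        cs 0 = (start B, 0) \<and> cs 0 \<in> configs B
        \<and> (\<forall>i. step B (cs i) (f i) (cs (Suc i)))}"


section \<open>Parametric automata\<close>

text \<open>The term \<open>(\<alpha>, c)\<close> stands for \<open>(\<Sum>p\<in>P. \<alpha> p * p) + c\<close>.\<close>

type_synonym 'p lterm = "('p \<Rightarrow> int) \<times> int"

definition eval_lterm :: "'p set \<Rightarrow> ('p \<Rightarrow> rat) \<Rightarrow> 'p lterm \<Rightarrow> rat" where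
  "eval_lterm P v = (\<lambda>(\<alpha>, c). (\<Sum>p\<in>P. of_int (\<alpha> p) * v p) + of_int c)"

record ('l, 'a, 'p) pta = "('l, 'a, 'p lterm) automaton" +
  params :: "'p set"

definition LT :: "('l, 'a, 'p) pta \<Rightarrow> 'p lterm set" where
  "LT A = (\<Union>l \<in> locs A. snd ` invar A l) \<union> (\<Union>(l, g, a, r, l') \<in> edges A. snd ` g)"

text \<open>
  Coefficients outside the parameter set are required to vanish so that distinct terms are
  distinct as pairs.
\<close>

definition extended_1c_pta :: "('l, 'a, 'p) pta \<Rightarrow> bool" where
  "extended_1c_pta A \<longleftrightarrow>
     finite (locs A) \<and> finite (acts A) \<and> finite (params A) \<and> finite (edges A)
   \<and> start A \<in> locs A
   \<and> (\<forall>l \<in> locs A. finite (invar A l))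
   \<and> (\<forall>(l, g, a, r, l') \<in> edges A. l \<in> locs A \<and> finite g \<and> a \<in> acts A \<and> l' \<in> locs A)
   \<and> (\<forall>(\<alpha>, c) \<in> LT A. \<forall>p. p \<notin> params A \<longrightarrow> \<alpha> p = 0)"

definition deterministic :: "('l, 'a, 'p) pta \<Rightarrow> bool" where
  "deterministic A \<longleftrightarrow>
     (\<forall>l a g r l' g' r' l''. (l, g, a, r, l') \<in> edges A \<and> (l, g', a, r', l'') \<in> edges A
        \<longrightarrow> (g, r, l') = (g', r', l''))"

definition valuations :: "('l, 'a, 'p) pta \<Rightarrow> ('p \<Rightarrow> rat) set" where
  "valuations A = params A \<rightarrow>\<^sub>E {0..}"

definition inst_guard :: "'p set \<Rightarrow> ('p \<Rightarrow> rat) \<Rightarrow> 'p lterm guard \<Rightarrow> rat guard" where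
  "inst_guard P v g = (\<lambda>(c, t). (c, eval_lterm P v t)) ` g"

definition inst :: "('p \<Rightarrow> rat) \<Rightarrow> ('l, 'a, 'p) pta \<Rightarrow> ('l, 'a, rat) automaton" where
  "inst v A =
     \<lparr>locs = locs A, acts = acts A, start = start A,
      invar = (\<lambda>l. inst_guard (params A) v (invar A l)),
      edges = (\<lambda>(l, g, a, r, l'). (l, inst_guard (params A) v g, a, r, l')) ` edges A\<rparr>"


section \<open>Random access machine\<close>

text \<open>
  Time is measured on a uniform-cost random access machine over the integers, presented as a
  structured programming language.  The memory consists of named, indirectly addressable
  arrays; a scalar is cell 0 of an array.  A fixed program mentions only finitely many arrays,
  so they could be interleaved in a single one.  Each executed assignment and each evaluated
  test costs one time unit: the expressions of a fixed program have bounded size, so that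
  charging every arithmetic operation and memory access separately changes the running time
  by a constant factor only.
\<close>

datatype exp = Const int | Get string exp | Add exp exp | Sub exp exp | Mul exp exp

datatype test = Less exp exp | Neg test | Conj test test

datatype prog =
    Skip
  | Put string exp exp   \<comment> \<open>\<open>Put x i e\<close> is the assignment \<open>x[i] := e\<close>\<close>
  | Seq prog prog
  | Cond test prog prog
  | While test prog

type_synonym memory = "string \<Rightarrow> int \<Rightarrow> int"

fun exp_val :: "exp \<Rightarrow> memory \<Rightarrow> int" where
  "exp_val (Const k) s = k"
| "exp_val (Get x i) s = s x (exp_val i s)"
| "exp_val (Add e f) s = exp_val e s + exp_val f s"
| "exp_val (Sub e f) s = exp_val e s - exp_val f s"
| "exp_val (Mul e f) s = exp_val e s * exp_val f s"

fun test_val :: "test \<Rightarrow> memory \<Rightarrow> bool" where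
  "test_val (Less e f) s \<longleftrightarrow> exp_val e s < exp_val f s"
| "test_val (Neg b) s \<longleftrightarrow> \<not> test_val b s"
| "test_val (Conj b c) s \<longleftrightarrow> test_val b s \<and> test_val c s"

text \<open>\<open>exec p s t s'\<close>: started in \<open>s\<close>, the program \<open>p\<close> halts after \<open>t\<close> time units in \<open>s'\<close>.\<close>

inductive exec :: "prog \<Rightarrow> memory \<Rightarrow> nat \<Rightarrow> memory \<Rightarrow> bool" where
  Skip: "exec Skip s 1 s"
| Put: "exec (Put x i e) s 1 (s(x := (s x)(exp_val i s := exp_val e s)))"
| Seq: "exec p s t s' \<Longrightarrow> exec q s' u s'' \<Longrightarrow> exec (Seq p q) s (t + u) s''"
| CondT: "test_val b s \<Longrightarrow> exec p s t s' \<Longrightarrow> exec (Cond b p q) s (1 + t) s'"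
| CondF: "\<not> test_val b s \<Longrightarrow> exec q s t s' \<Longrightarrow> exec (Cond b p q) s (1 + t) s'"
| WhileF: "\<not> test_val b s \<Longrightarrow> exec (While b p) s 1 s"
| WhileT: "test_val b s \<Longrightarrow> exec p s t s' \<Longrightarrow> exec (While b p) s' u s''
    \<Longrightarrow> exec (While b p) s (1 + t + u) s''"

inductive_cases SkipE: "exec Skip s t s'"
inductive_cases PutE: "exec (Put x i e) s t s'"
inductive_cases SeqE: "exec (Seq p q) s t s'"
inductive_cases CondE: "exec (Cond b p q) s t s'"
inductive_cases WhileE: "exec (While b p) s t s'"

lemma exec_deterministic:
  "exec p s t s' \<Longrightarrow> exec p s u s'' \<Longrightarrow> u = t \<and> s'' = s'"
proof (induction arbitrary: u s'' rule: exec.induct)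
  case (Skip s)
  then show ?case by (auto elim: SkipE)
next
  case (Put x i e s)
  then show ?case by (auto elim: PutE)
next
  case (Seq p s t s1 q t' s2)
  from Seq.prems obtain v v' r where "u = v + v'" "exec p s v r" "exec q r v' s''"
    by (rule SeqE)
  with Seq.IH show ?case by blast
next
  case (CondT b s p t s1 q)
  from CondT.prems CondT.hyps(1) obtain v where "u = 1 + v" "exec p s v s''"
    by (auto elim: CondE)
  with CondT.IH show ?case by blast
next
  case (CondF b s q t s1 p)
  from CondF.prems CondF.hyps(1) obtain v where "u = 1 + v" "exec q s v s''"
    by (auto elim: CondE)
  with CondF.IH show ?case by blast
next
  case (WhileF b s p)
  then show ?case by (auto elim: WhileE)
next
  case (WhileT b s p t s1 t' s2)
  from WhileT.prems WhileT.hyps(1) obtain v v' r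
    where "u = 1 + v + v'" "exec p s v r" "exec (While b p) r v' s''"
    by (auto elim: WhileE)
  with WhileT.IH show ?case by blast
qed

definition load :: "int list \<Rightarrow> memory" where
  "load ws = (\<lambda>x i. if x = ''in'' \<and> 0 \<le> i \<and> i < int (length ws) then ws ! nat i else 0)"

definition outputs :: "memory \<Rightarrow> int list \<Rightarrow> bool" where
  "outputs s ws \<longleftrightarrow> (\<forall>i < length ws. s ''out'' (int i) = ws ! i)"


section \<open>Coding of the input and of the output\<close>

text \<open>
  Locations, actions and parameters are represented by their positions in arbitrary
  enumerations \<open>ls\<close>, \<open>as\<close>, \<open>ps\<close>; finite sets are listed in arbitrary order, preceded by
  their cardinality.  For a fixed number of parameters all codes are self-delimiting.
\<close>

definition enumerates :: "'b list \<Rightarrow> 'b set \<Rightarrow> bool" where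
  "enumerates xs S \<longleftrightarrow> distinct xs \<and> set xs = S"

definition position :: "'b list \<Rightarrow> 'b \<Rightarrow> int" where
  "position xs x = int (LEAST i. i < length xs \<and> xs ! i = x)"

definition code_set :: "('b \<Rightarrow> int list \<Rightarrow> bool) \<Rightarrow> 'b set \<Rightarrow> int list \<Rightarrow> bool" where
  "code_set code S ws \<longleftrightarrow>
     (\<exists>xs us. enumerates xs S \<and> list_all2 code xs us \<and> ws = int (length xs) # concat us)"

fun cmp_code :: "cmp \<Rightarrow> int" where
  "cmp_code Lt = 0"
| "cmp_code Le = 1"
| "cmp_code Eq = 2"
| "cmp_code Ge = 3"
| "cmp_code Gt = 4"

definition constraint_code :: "'p list \<Rightarrow> cmp \<times> 'p lterm \<Rightarrow> int list" where
  "constraint_code ps = (\<lambda>(c, \<alpha>, k). cmp_code c # map \<alpha> ps @ [k])"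

definition code_guard :: "'p list \<Rightarrow> 'p lterm guard \<Rightarrow> int list \<Rightarrow> bool" where
  "code_guard ps = code_set (\<lambda>c ws. ws = constraint_code ps c)"

definition code_edge ::
    "'l list \<Rightarrow> 'a list \<Rightarrow> 'p list \<Rightarrow> ('l, 'a, 'p lterm) edge \<Rightarrow> int list \<Rightarrow> bool" where
  "code_edge ls as ps = (\<lambda>(l, g, a, r, l') ws.
     \<exists>us. code_guard ps g us
        \<and> ws = [position ls l] @ us @ [position as a, of_bool r, position ls l'])"

definition valuation_code :: "'p list \<Rightarrow> ('p \<Rightarrow> rat) \<Rightarrow> int list" where
  "valuation_code ps v = concat (map (\<lambda>p. [fst (quotient_of (v p)), snd (quotient_of (v p))]) ps)"

text \<open>\<open>code_input ps A v ws\<close>: the word \<open>ws\<close> is a code of the pair of \<open>A\<close> and \<open>v\<close>.\<close>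

definition code_input ::
    "'p list \<Rightarrow> ('l, 'a, 'p) pta \<Rightarrow> ('p \<Rightarrow> rat) \<Rightarrow> int list \<Rightarrow> bool" where
  "code_input ps A v ws \<longleftrightarrow>
     (\<exists>ls as invs es.
        enumerates ls (locs A) \<and> enumerates as (acts A) \<and> enumerates ps (params A)
      \<and> list_all2 (\<lambda>l. code_guard ps (invar A l)) ls invs
      \<and> code_set (code_edge ls as ps) (edges A) es
      \<and> ws = [int (length ls), int (length as), int (length ps), position ls (start A)]
             @ concat invs @ es @ valuation_code ps v)"

text \<open>
  Sets of valuations are output symbolically, as finite unions of convex polyhedra: a finite
  disjunction of finite conjunctions of constraints \<open>t \<sim> 0\<close> with linear terms \<open>t\<close>.
\<close>

type_synonym 'p dnf = "(cmp \<times> 'p lterm) list list"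

definition sat_dnf :: "'p set \<Rightarrow> ('p \<Rightarrow> rat) \<Rightarrow> 'p dnf \<Rightarrow> bool" where
  "sat_dnf P v D \<longleftrightarrow> (\<exists>K \<in> set D. \<forall>(c, t) \<in> set K. holds c (eval_lterm P v t) 0)"

definition list_code :: "('b \<Rightarrow> int list) \<Rightarrow> 'b list \<Rightarrow> int list" where
  "list_code f xs = int (length xs) # concat (map f xs)"

definition dnf_code :: "'p list \<Rightarrow> 'p dnf \<Rightarrow> int list" where
  "dnf_code ps = list_code (list_code (constraint_code ps))"

end

theory Submission
  imports Defs
begin

text \<open>
  Only the order of the values of the linear terms and of 0 matters: clock values lying in the same
  region (equal to a given term, or strictly between two consecutive ones) are time-abstract
  bisimilar.  After a word, the location is determined and the reachable regions form an interval
  \<open>{lo..hi}\<close>.  A step is possible from some reachable value iff it is possible from the lower end, and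
  a run may stop iff it may stop at the upper end.  This determinises \<open>v(A)\<close>, so that two valuations
  have the same language iff no reachable state of the synchronous product disagrees on the enabled
  actions or on stopping.  Determinism synchronises the locations as well, whence the product has only
  \<open>|L|\<close> times polynomially many states.  The program runs this test for every assignment of ranks
  below \<open>n + 1\<close> to the at most \<open>n + 1\<close> terms, where \<open>n = |LT|\<close>, and outputs the order of the terms
  for the successful ones; ranks that no valuation realises do no harm.  As \<open>(n + 1) ^ (n + 1)\<close> times
  a polynomial is \<open>O(2 ^ (n * (n + 1)))\<close>, this is fast enough.
\<close>

section \<open>Languages of transition systems and of deterministic automata\<close>

text \<open>Delays only raise the clock and guards are convex; this is why the reachable codes form
  an interval, why its lower end can do everything that any member can, and why its upper end can do
  least. Language equality becomes a local check because a state in which no run may stop always has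
  a move: every readable word then extends to a run, so readability is visible in the language. The
  term 0 is ranked together with \<open>LT\<close>, since the clock starts at 0 and is reset to 0;
  hence \<open>X = n + 1\<close>. Ranks may have gaps. A code in a gap stands for a region that
  other codes represent too, so the relation between values and codes is many-to-many, and all rank
  functions are treated alike. The test of a candidate mentions ranks only, never a valuation, and a
  candidate that no valuation realises yields an unsatisfiable clause, so realisability is never
  decided. The cost is \<open>X ^ X\<close> candidates, times at most \<open>|L|\<close> times
  \<open>(2 X) ^ 4\<close> product nodes (a location and four interval ends), times
  \<open>O(X ^ 2)\<close> per node for fixed numbers of actions and parameters. The resulting
  \<open>X ^ (X + 6)\<close> is absorbed by \<open>(n + 1) ^ 2 \<le> 2 ^ n\<close>, valid from
  \<open>n = 6\<close> on.\<close>

fun path :: "('c \<Rightarrow> 'a \<Rightarrow> 'c \<Rightarrow> bool) \<Rightarrow> 'c \<Rightarrow> 'a list \<Rightarrow> 'c \<Rightarrow> bool" where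
  "path st c [] c' \<longleftrightarrow> c' = c"
| "path st c (a # u) c' \<longleftrightarrow> (\<exists>d. st c a d \<and> path st d u c')"

text \<open>\<open>lang\<close> speaks of lists of configurations; the recursive form admits
  induction on the word.\<close>

lemma path_iff_list:
  "path st c u c' \<longleftrightarrow>
     (\<exists>cs. length cs = Suc (length u) \<and> cs ! 0 = c \<and> last cs = c'
        \<and> (\<forall>i < length u. st (cs ! i) (u ! i) (cs ! Suc i)))"
proof (induction u arbitrary: c)
  case Nil
  show ?case
    by (rule iffI, rule exI[of _ "[c]"]) (auto simp: length_Suc_conv)
next
  case (Cons a u)
  show ?case (is "?L \<longleftrightarrow> ?R")
  proof
    assume ?L
    then obtain d where d: "st c a d" "path st d u c'" by auto
    with Cons obtain cs where cs: "length cs = Suc (length u)" "cs ! 0 = d" "last cs = c'"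
      "\<forall>i < length u. st (cs ! i) (u ! i) (cs ! Suc i)" by blast
    have "\<forall>i < length (a # u). st ((c # cs) ! i) ((a # u) ! i) ((c # cs) ! Suc i)"
      using cs d by (auto simp: nth_Cons split: nat.splits)
    with cs show ?R
      by (intro exI[of _ "c # cs"]) auto
  next
    assume ?R
    then obtain cs where cs: "length cs = Suc (length (a # u))" "cs ! 0 = c" "last cs = c'"
      "\<forall>i < length (a # u). st (cs ! i) ((a # u) ! i) (cs ! Suc i)" by blast
    then obtain ds where ds: "cs = c # ds" "length ds = Suc (length u)"
      by (cases cs) auto
    have "st (ds ! i) (u ! i) (ds ! Suc i)" if "i < length u" for i
      using cs(4)[rule_format, of "Suc i"] that ds by auto
    moreover have "st c a (ds ! 0)" using cs(4)[rule_format, of 0] ds by auto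
    moreover have "last ds = c'" using cs ds by (auto split: if_splits)
    ultimately show ?L using Cons[of "ds ! 0"] ds by auto
  qed
qed

lemma lang_alt:
  "lang B = (if (start B, 0) \<in> configs B then
     {Fin u | u. \<exists>c. path (step B) (start B, 0) u c \<and> \<not> (\<exists>a c'. step B c a c')}
   \<union> {Inf f | f. \<exists>cs. cs 0 = (start B, 0) \<and> (\<forall>i. step B (cs i) (f i) (cs (Suc i)))} else {})"
proof -
  have "(\<exists>cs. length cs = Suc (length u) \<and> cs ! 0 = (start B, 0) \<and> cs ! 0 \<in> configs B
        \<and> (\<forall>i < length u. step B (cs ! i) (u ! i) (cs ! Suc i))
        \<and> \<not> (\<exists>a c. step B (last cs) a c))
    \<longleftrightarrow> (start B, 0) \<in> configs B
      \<and> (\<exists>c. path (step B) (start B, 0) u c \<and> \<not> (\<exists>a c'. step B c a c'))" for u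
    unfolding path_iff_list by metis
  moreover have "(\<exists>cs. cs 0 = (start B, 0) \<and> cs 0 \<in> configs B
        \<and> (\<forall>i. step B (cs i) (f i) (cs (Suc i))))
    \<longleftrightarrow> (start B, 0) \<in> configs B
      \<and> (\<exists>cs. cs 0 = (start B, 0) \<and> (\<forall>i. step B (cs i) (f i) (cs (Suc i))))" for f
    by metis
  ultimately show ?thesis unfolding lang_def by (simp only:) auto
qed

fun trace :: "('q \<Rightarrow> 'a \<Rightarrow> 'q option) \<Rightarrow> 'q \<Rightarrow> 'a list \<Rightarrow> 'q option" where
  "trace d q [] = Some q"
| "trace d q (a # u) = (case d q a of None \<Rightarrow> None | Some q' \<Rightarrow> trace d q' u)"

lemma trace_append:
  "trace d q (u @ w) = (case trace d q u of None \<Rightarrow> None | Some q' \<Rightarrow> trace d q' w)"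
  by (induction u arbitrary: q) (auto split: option.splits)

definition dlang :: "('q \<Rightarrow> 'a \<Rightarrow> 'q option) \<Rightarrow> ('q \<Rightarrow> bool) \<Rightarrow> 'q \<Rightarrow> 'a word set" where
  "dlang d D q = {Fin u | u. \<exists>q'. trace d q u = Some q' \<and> D q'}
     \<union> {Inf f | f. \<forall>n. trace d q (map f [0..<n]) \<noteq> None}"

text \<open>
  \<open>D\<close> marks the states in which a run may stop.  A state that is not marked can be left, so a word is
  readable iff it is a prefix of a member of the language.
\<close>

lemma readable_iff:
  assumes live: "\<And>w p. trace d q w = Some p \<Longrightarrow> \<not> D p \<Longrightarrow> \<exists>a. d p a \<noteq> None"
  shows "trace d q u \<noteq> None \<longleftrightarrow>
    (\<exists>w. Fin (u @ w) \<in> dlang d D q) \<or> (\<exists>f. map f [0..<length u] = u \<and> Inf f \<in> dlang d D q)"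
proof
  assume "trace d q u \<noteq> None"
  then obtain q0 where q0: "trace d q u = Some q0" by auto
  show "(\<exists>w. Fin (u @ w) \<in> dlang d D q) \<or> (\<exists>f. map f [0..<length u] = u \<and> Inf f \<in> dlang d D q)"
  proof (cases "\<exists>w q'. trace d q0 w = Some q' \<and> D q'")
    case True
    then show ?thesis using q0 by (auto simp: dlang_def trace_append)
  next
    case False
    \<comment> \<open>No stopping state is reachable from \<open>q0\<close>, so \<open>live\<close>
      gives every state reachable from \<open>q0\<close> a move. Taking the chosen moves forever
      prolongs \<open>u\<close> to the infinite word \<open>f\<close>.\<close>
    have "\<exists>a q'. (\<exists>w. trace d q0 w = Some p) \<longrightarrow> d p a = Some q'" for p
      using False live[of "u @ _" p] q0 by (simp add: trace_append) blast
    then obtain act nxt where an: "\<And>p. (\<exists>w. trace d q0 w = Some p) \<Longrightarrow> d p (act p) = Some (nxt p)"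
      by metis
    define f where "f i = (if i < length u then u ! i else act ((nxt ^^ (i - length u)) q0))" for i
    have fu: "map f [0..<length u] = u" by (auto simp: f_def intro: nth_equalityI)
    have *: "trace d q0 (map f [length u..<length u + n]) = Some ((nxt ^^ n) q0)" for n
    proof (induction n)
      case (Suc n)
      then have "d ((nxt ^^ n) q0) (act ((nxt ^^ n) q0)) = Some (nxt ((nxt ^^ n) q0))"
        using an by blast
      then show ?case using Suc by (simp add: trace_append f_def)
    qed auto
    have "trace d q (map f [0..<n]) \<noteq> None" for n
    proof (cases "n \<le> length u")
      case True
      then have "u = map f [0..<n] @ map f [n..<length u]"
        using fu by (metis map_append upt_add_eq_append le_add_diff_inverse zero_le)
      with q0 trace_append[of d q "map f [0..<n]" "map f [n..<length u]"] show ?thesis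
        by (auto split: option.splits)
    next
      case False
      then obtain j where j: "n = length u + j" by (metis le_add_diff_inverse nat_le_linear)
      then have "map f [0..<n] = u @ map f [length u..<length u + j]"
        using fu by (metis map_append upt_add_eq_append zero_le)
      then show ?thesis using q0 *[of j] by (simp add: trace_append)
    qed
    with fu show ?thesis by (auto simp: dlang_def)
  qed
next
  assume "(\<exists>w. Fin (u @ w) \<in> dlang d D q) \<or> (\<exists>f. map f [0..<length u] = u \<and> Inf f \<in> dlang d D q)"
  then show "trace d q u \<noteq> None"
    by (auto simp: dlang_def trace_append split: option.splits) (metis not_None_eq)
qed

text \<open>By \<open>readable_iff\<close> the language determines the readable words, so states
  reached by the same word must enable the same actions. Conversely, agreement on the enabled
  actions yields the same readable words by induction, hence the same infinite words, and agreement
  of \<open>D1\<close> and \<open>D2\<close> settles the finite ones.\<close>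

lemma dlang_eq_iff:
  assumes live1: "\<And>w p. trace d1 q1 w = Some p \<Longrightarrow> \<not> D1 p \<Longrightarrow> \<exists>a. d1 p a \<noteq> None"
    and live2: "\<And>w p. trace d2 q2 w = Some p \<Longrightarrow> \<not> D2 p \<Longrightarrow> \<exists>a. d2 p a \<noteq> None"
  shows "dlang d1 D1 q1 = dlang d2 D2 q2 \<longleftrightarrow>
    (\<forall>u x y. trace d1 q1 u = Some x \<longrightarrow> trace d2 q2 u = Some y \<longrightarrow>
       (D1 x \<longleftrightarrow> D2 y) \<and> (\<forall>a. d1 x a = None \<longleftrightarrow> d2 y a = None))" (is "?L \<longleftrightarrow> ?R")
proof
  assume L: ?L
  have T: "trace d1 q1 u = None \<longleftrightarrow> trace d2 q2 u = None" for u
  proof -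
    note readable_iff[of d1 q1 D1 u] readable_iff[of d2 q2 D2 u]
    with live1 live2 L show ?thesis by metis
  qed
  show ?R
  proof (intro allI impI conjI)
    fix u x y assume xy: "trace d1 q1 u = Some x" "trace d2 q2 u = Some y"
    have "Fin u \<in> dlang d1 D1 q1 \<longleftrightarrow> D1 x" "Fin u \<in> dlang d2 D2 q2 \<longleftrightarrow> D2 y"
      using xy by (auto simp: dlang_def)
    with L show "D1 x \<longleftrightarrow> D2 y" by simp
    show "d1 x a = None \<longleftrightarrow> d2 y a = None" for a
      using T[of "u @ [a]"] xy by (auto simp: trace_append split: option.splits)
  qed
next
  assume R: ?R
  have T: "trace d1 q1 u = None \<longleftrightarrow> trace d2 q2 u = None" for u
  proof (induction u rule: rev_induct)
    case (snoc a u)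
    show ?case
    proof (cases "trace d1 q1 u")
      case None
      then show ?thesis using snoc by (simp add: trace_append)
    next
      case (Some x)
      then obtain y where y: "trace d2 q2 u = Some y" using snoc by fastforce
      have "d1 x a = None \<longleftrightarrow> d2 y a = None" using R Some y by blast
      then show ?thesis using Some y by (auto simp: trace_append split: option.splits)
    qed
  qed auto
  have "(\<exists>x. trace d1 q1 u = Some x \<and> D1 x) \<longleftrightarrow> (\<exists>y. trace d2 q2 u = Some y \<and> D2 y)" for u
    using R T[of u] by (metis not_None_eq)
  with T show ?L unfolding dlang_def by simp
qed

section \<open>Clock codes\<close>

text \<open>
  Given ranks \<open>R\<close> of the terms, the clock value equal to the term \<open>t\<close> has the code \<open>2 * R t\<close>, and odd
  codes stand for the values strictly between two terms of consecutive ranks.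
\<close>

definition zterm :: "'p lterm" where "zterm = (\<lambda>_. 0, 0)"

text \<open>The clock starts at 0 and is reset to 0, so the position of 0 among the terms must be
  known even if 0 does not occur in a constraint.\<close>

definition terms :: "('l, 'a, 'p) pta \<Rightarrow> 'p lterm set" where
  "terms A = insert zterm (LT A)"

definition codes :: "('p lterm \<Rightarrow> int) \<Rightarrow> 'p lterm guard \<Rightarrow> int set" where
  "codes R g = {i. \<forall>(c, t) \<in> g. holds c i (2 * R t)}"

text \<open>Only the lower end \<open>lo\<close> enters: what a larger code reaches by delay,
  \<open>lo\<close> reaches as well. The source invariant is tested at the code of departure only;
  as guards are convex and \<open>lo\<close> satisfies the invariant in every valid state, the codes
  in between satisfy it too. \<open>M\<close> is meant to exceed the codes of all terms, so that it
  stands for all larger clock values and capping delays there loses nothing.\<close>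

definition succs :: "('l, 'a, 'p) pta \<Rightarrow> ('p lterm \<Rightarrow> int) \<Rightarrow> int \<Rightarrow> 'l \<Rightarrow> int
    \<Rightarrow> 'p lterm guard \<Rightarrow> bool \<Rightarrow> 'l \<Rightarrow> int set" where
  "succs A R M l lo g r l' =
     (let K = {lo..M} \<inter> codes R (invar A l) \<inter> codes R g in
      (if r then (if K = {} then {} else {2 * R zterm}) else K) \<inter> codes R (invar A l'))"

definition edge_opt :: "('l, 'a, 'p) pta \<Rightarrow> 'l \<Rightarrow> 'a \<Rightarrow> ('p lterm guard \<times> bool \<times> 'l) option" where
  "edge_opt A l a = (if \<exists>g r l'. (l, g, a, r, l') \<in> edges A
     then Some (SOME e. (l, fst e, a, snd e) \<in> edges A) else None)"

type_synonym 'l dstate = "'l \<times> int \<times> int"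

text \<open>The state \<open>(l, lo, hi)\<close> records that exactly the clock codes from \<open>lo\<close> to \<open>hi\<close> are reachable.\<close>

fun delta :: "('l, 'a, 'p) pta \<Rightarrow> ('p lterm \<Rightarrow> int) \<Rightarrow> int \<Rightarrow> 'l dstate \<Rightarrow> 'a \<Rightarrow> 'l dstate option" where
  "delta A R M (l, lo, hi) a = (case edge_opt A l a of None \<Rightarrow> None
     | Some (g, r, l') \<Rightarrow> (let K = succs A R M l lo g r l' in
         if K = {} then None else Some (l', Min K, Max K)))"

text \<open>Large clock values have the fewest successors, so a run can stop iff it can stop at \<open>hi\<close>.\<close>

fun dead :: "('l, 'a, 'p) pta \<Rightarrow> ('p lterm \<Rightarrow> int) \<Rightarrow> int \<Rightarrow> 'l dstate \<Rightarrow> bool" where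
  "dead A R M (l, lo, hi) \<longleftrightarrow> (\<forall>a. delta A R M (l, hi, hi) a = None)"

text \<open>Only the order of the ranks counts. Gaps are permitted, so that arbitrary assignments of
  numbers can be tested as candidates.\<close>

definition ranks :: "('l, 'a, 'p) pta \<Rightarrow> ('p \<Rightarrow> rat) \<Rightarrow> ('p lterm \<Rightarrow> int) \<Rightarrow> bool" where
  "ranks A v R \<longleftrightarrow> (\<forall>t \<in> terms A. \<forall>u \<in> terms A.
     eval_lterm (params A) v t < eval_lterm (params A) v u \<longleftrightarrow> R t < R u)"

section \<open>Convexity and monotonicity of successor sets\<close>

lemma edge_opt_iff:
  assumes "deterministic A"
  shows "edge_opt A l a = Some (g, r, l') \<longleftrightarrow> (l, g, a, r, l') \<in> edges A"
proof
  assume "edge_opt A l a = Some (g, r, l')"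
  then have "\<exists>e. (l, fst e, a, snd e) \<in> edges A"
    and x: "(g, r, l') = (SOME e. (l, fst e, a, snd e) \<in> edges A)"
    by (auto simp: edge_opt_def split: if_splits)
  from someI_ex[OF this(1)] x[symmetric] show "(l, g, a, r, l') \<in> edges A" by simp
next
  assume e: "(l, g, a, r, l') \<in> edges A"
  then have "(SOME e. (l, fst e, a, snd e) \<in> edges A) = (g, r, l')"
    by (intro some_equality) (use assms in \<open>unfold deterministic_def, fastforce+\<close>)
  with e show "edge_opt A l a = Some (g, r, l')" by (auto simp: edge_opt_def)
qed

lemma edge_opt_None:
  "edge_opt A l a = None \<longleftrightarrow> \<not> (\<exists>g r l'. (l, g, a, r, l') \<in> edges A)"
  by (auto simp: edge_opt_def)

lemma eval_zterm [simp]: "eval_lterm P v zterm = 0"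
  by (simp add: eval_lterm_def zterm_def)

lemma holds_convex:
  assumes "holds c x b" "holds c z b" "x \<le> y" "y \<le> z"
  shows "holds c y b"
  using assms by (cases c) auto

lemma codes_convex:
  assumes "x \<in> codes R g" "z \<in> codes R g" "x \<le> y" "y \<le> z"
  shows "y \<in> codes R g"
  using assms holds_convex unfolding codes_def by (fastforce split: prod.splits)

text \<open>This makes the pair of minimum and maximum stored by \<open>delta\<close> a lossless
  record of the successor codes.\<close>

lemma succs_convex:
  assumes "x \<in> succs A R M l lo g r l'" "z \<in> succs A R M l lo g r l'" "x \<le> y" "y \<le> z"
  shows "y \<in> succs A R M l lo g r l'"
  using assms codes_convex[of x R "invar A l" z y] codes_convex[of x R g z y]
    codes_convex[of x R "invar A l'" z y]
  by (auto simp: succs_def Let_def split: if_splits)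

lemma finite_succs: "finite (succs A R M l lo g r l')"
  by (auto simp: succs_def Let_def)

text \<open>The source of both endpoint rules: a code without successors stays so when raised to
  \<open>hi\<close>, and a successor found from \<open>hi\<close> is also found from
  \<open>lo\<close>.\<close>

lemma succs_antimono:
  assumes "lo \<le> hi"
  shows "succs A R M l hi g r l' \<subseteq> succs A R M l lo g r l'"
proof -
  have "{hi..M} \<inter> codes R (invar A l) \<inter> codes R g \<subseteq> {lo..M} \<inter> codes R (invar A l) \<inter> codes R g"
    using assms by auto
  then show ?thesis unfolding succs_def Let_def by (auto split: if_splits)
qed

lemma finite_LT: "extended_1c_pta A \<Longrightarrow> finite (LT A)"
  by (auto simp: extended_1c_pta_def LT_def)

lemma finite_terms: "extended_1c_pta A \<Longrightarrow> finite (terms A)"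
  by (simp add: terms_def finite_LT)

lemma delta_SomeD:
  assumes det: "deterministic A" and "delta A R M (l, lo, hi) a = Some (l', lo', hi')"
  obtains g r where "(l, g, a, r, l') \<in> edges A" "{lo'..hi'} = succs A R M l lo g r l'" "lo' \<le> hi'"
proof -
  from assms(2) obtain e where e0: "edge_opt A l a = Some e" by (cases "edge_opt A l a") auto
  obtain g r k where e1: "e = (g, r, k)" by (metis prod_cases3)
  define K where "K = succs A R M l lo g r k"
  have *: "(if K = {} then None else Some (k, Min K, Max K)) = Some (l', lo', hi')"
    unfolding K_def using assms(2) by (simp add: e0 e1 Let_def split del: if_split)
  then have ne: "K \<noteq> {}" by (metis option.distinct(1))
  with * have "(k, Min K, Max K) = (l', lo', hi')" by (simp only: if_False option.inject)
  then have kl: "k = l'" and m: "Min K = lo'" "Max K = hi'" by (simp_all only: prod.inject)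
  have e: "edge_opt A l a = Some (g, r, l')" by (simp only: e0 e1 kl)
  have K: "succs A R M l lo g r l' \<noteq> {}" "lo' = Min (succs A R M l lo g r l')" "hi' = Max (succs A R M l lo g r l')"
    using ne m by (simp_all only: K_def kl simp_thms)
  have i: "lo' \<in> succs A R M l lo g r l'" "hi' \<in> succs A R M l lo g r l'"
    unfolding K(2,3) by (rule Min_in[OF finite_succs K(1)], rule Max_in[OF finite_succs K(1)])
  have b: "lo' \<le> x \<and> x \<le> hi'" if "x \<in> succs A R M l lo g r l'" for x
    unfolding K(2,3) using Min_le[OF finite_succs that] Max_ge[OF finite_succs that] by (rule conjI)
  have "{lo'..hi'} = succs A R M l lo g r l'"
  proof (intro equalityI subsetI)
    show "x \<in> succs A R M l lo g r l'" if "x \<in> {lo'..hi'}" for x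
      using succs_convex[OF i, of x] that unfolding atLeastAtMost_iff by blast
    show "x \<in> {lo'..hi'}" if "x \<in> succs A R M l lo g r l'" for x
      unfolding atLeastAtMost_iff using b[OF that] .
  qed
  moreover have "lo' \<le> hi'" using b[OF i(1)] by blast
  moreover have "(l, g, a, r, l') \<in> edges A" using e edge_opt_iff[OF det] by blast
  ultimately show ?thesis using that by blast
qed

lemma delta_None:
  assumes det: "deterministic A" and "delta A R M (l, lo, hi) a = None" "(l, g, a, r, l') \<in> edges A"
  shows "succs A R M l lo g r l' = {}"
  using assms(2,3) edge_opt_iff[OF det, of l a g r l'] by (auto simp: Let_def split: if_splits)

section \<open>Time-abstract bisimulation between clock values and clock codes\<close>

locale ranked =
  fixes A :: "('l, 'a, 'p) pta" and v :: "'p \<Rightarrow> rat" and R :: "'p lterm \<Rightarrow> int" and M :: int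
  assumes pta: "extended_1c_pta A" and det: "deterministic A"
    and ranks: "ranks A v R"
    and top: "\<And>t. t \<in> terms A \<Longrightarrow> 2 * R t < M"
begin

abbreviation "ev t \<equiv> real_of_rat (eval_lterm (params A) v t)"
abbreviation "z \<equiv> 2 * R zterm"

text \<open>The bisimulation: \<open>x\<close> and \<open>i\<close> compare alike with every term.
  It is a relation rather than a function because ranks with gaps give several codes to one open
  region.\<close>

definition rel :: "real \<Rightarrow> int \<Rightarrow> bool" where
  "rel x i \<longleftrightarrow> (\<forall>t \<in> terms A. (x < ev t \<longleftrightarrow> i < 2 * R t) \<and> (ev t < x \<longleftrightarrow> 2 * R t < i))"

lemma ev_less: "t \<in> terms A \<Longrightarrow> u \<in> terms A \<Longrightarrow> ev t < ev u \<longleftrightarrow> R t < R u"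
  using ranks by (auto simp: ranks_def of_rat_less)

lemma zterm_in: "zterm \<in> terms A"
  by (simp add: terms_def)

lemma rel_zero: "rel 0 z"
  unfolding rel_def using ev_less[OF zterm_in] ev_less[OF _ zterm_in] by simp

lemma rel_nonneg: "rel x i \<Longrightarrow> z \<le> i \<Longrightarrow> 0 \<le> x"
  using zterm_in by (force simp: rel_def)

lemma rel_holds:
  assumes "rel x i" "t \<in> terms A"
  shows "holds c x (ev t) \<longleftrightarrow> holds c i (2 * R t)"
  using assms by (cases c) (force simp: rel_def)+

text \<open>A value equal to a term takes the even code of that term. Any other value takes the odd
  code just above \<open>t0\<close>, the highest ranked term below it; such a term exists because 0
  is one. Since \<open>2 * R t0 < M\<close>, the odd code is still at most \<open>M\<close>.\<close>

lemma ex_code: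
  assumes "0 \<le> x"
  shows "\<exists>i. z \<le> i \<and> i \<le> M \<and> rel x i"
proof (cases "\<exists>t \<in> terms A. ev t = x")
  case True
  then obtain t where t: "t \<in> terms A" "ev t = x" by blast
  have "rel x (2 * R t)" unfolding rel_def using t(2) ev_less[OF t(1)] ev_less[OF _ t(1)] by simp
  moreover have "R zterm \<le> R t"
    using ev_less[OF t(1) zterm_in] assms t(2) by auto
  ultimately show ?thesis using top[OF t(1)] by (intro exI[of _ "2 * R t"]) auto
next
  case False
  define L where "L = {t \<in> terms A. ev t < x}"
  have fin: "finite (R ` L)" using finite_terms[OF pta] by (auto simp: L_def)
  have zL: "zterm \<in> L" using False assms zterm_in by (force simp: L_def)
  then have "Max (R ` L) \<in> R ` L" using fin by (intro Max_in) auto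
  then obtain t0 where t0: "t0 \<in> L" "R t0 = Max (R ` L)" by auto
  have le: "R t \<le> R t0" if "t \<in> L" for t using that fin t0 by auto
  have gt: "R t0 < R t" if "t \<in> terms A" "t \<notin> L" for t
  proof -
    have "x < ev t" using that False by (force simp: L_def)
    then have "ev t0 < ev t" using t0 by (auto simp: L_def)
    then show ?thesis using ev_less t0 that by (auto simp: L_def)
  qed
  have "rel x (2 * R t0 + 1)"
    unfolding rel_def
  proof (intro ballI)
    fix t assume t: "t \<in> terms A"
    show "(x < ev t \<longleftrightarrow> 2 * R t0 + 1 < 2 * R t) \<and> (ev t < x \<longleftrightarrow> 2 * R t < 2 * R t0 + 1)"
    proof (cases "t \<in> L")
      case True
      then show ?thesis using le[OF True] by (auto simp: L_def)
    next
      case F: False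
      then have "x < ev t" using t False by (force simp: L_def)
      then show ?thesis using gt[OF t F] by auto
    qed
  qed
  moreover have "2 * R t0 < M" using t0(1) top[of t0] by (simp add: L_def)
  ultimately show ?thesis using le[OF zL] by (intro exI[of _ "2 * R t0 + 1"]) auto
qed

text \<open>If the code belongs to no term, density of the reals gives a value between the greatest
  term below and the least term above; if there is no term above, any larger value serves. The bound
  \<open>z \<le> i\<close> ensures that some term, namely 0, lies below.\<close>

lemma ex_value:
  assumes "z \<le> i"
  shows "\<exists>x. rel x i"
proof (cases "\<exists>t \<in> terms A. 2 * R t = i")
  case True
  then obtain t where t: "t \<in> terms A" "2 * R t = i" by blast
  have "rel (ev t) i" unfolding rel_def using ev_less[OF t(1)] ev_less[OF _ t(1)] t(2)[symmetric] by simp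
  then show ?thesis by blast
next
  case False
  define L where "L = {t \<in> terms A. 2 * R t < i}"
  define U where "U = {t \<in> terms A. i < 2 * R t}"
  have LU: "t \<in> L \<or> t \<in> U" if "t \<in> terms A" for t
    using that False by (force simp: L_def U_def)
  have fin: "finite (ev ` L)" "finite (ev ` U)" using finite_terms[OF pta] by (auto simp: L_def U_def)
  have zL: "zterm \<in> L" using False assms zterm_in by (force simp: L_def)
  then have "Max (ev ` L) \<in> ev ` L" using fin by (intro Max_in) auto
  then obtain t0 where t0: "t0 \<in> L" "Max (ev ` L) = ev t0" by auto
  have "\<exists>x. ev t0 < x \<and> (\<forall>u \<in> U. x < ev u)"
  proof (cases "U = {}")
    case True
    then show ?thesis by (auto intro: exI[of _ "ev t0 + 1"])
  next
    case F: False
    then have "Min (ev ` U) \<in> ev ` U" using fin by (intro Min_in) auto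
    then obtain u0 where u0: "u0 \<in> U" "Min (ev ` U) = ev u0" by auto
    have "R t0 < R u0" using t0 u0 by (auto simp: L_def U_def)
    then have "ev t0 < ev u0" using ev_less t0 u0 by (auto simp: L_def U_def)
    then obtain x where x: "ev t0 < x" "x < ev u0" using dense by blast
    have "x < ev u" if "u \<in> U" for u
    proof -
      have "Min (ev ` U) \<le> ev u" using fin that by auto
      with u0 x show ?thesis by simp
    qed
    with x show ?thesis by blast
  qed
  then obtain x where x: "ev t0 < x" "\<forall>u \<in> U. x < ev u" by blast
  have y: "ev t < x" if "t \<in> L" for t
  proof -
    have "ev t \<le> Max (ev ` L)" using fin that by auto
    with t0 x show ?thesis by simp
  qed
  have "rel x i"
    unfolding rel_def
  proof (intro ballI)
    fix t assume t: "t \<in> terms A"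
    from LU[OF t] show "(x < ev t \<longleftrightarrow> i < 2 * R t) \<and> (ev t < x \<longleftrightarrow> 2 * R t < i)"
    proof
      assume "t \<in> L"
      then show ?thesis using y[of t] by (auto simp: L_def)
    next
      assume u: "t \<in> U"
      then have "x < ev t" using x(2) by blast
      with u show ?thesis by (auto simp: U_def)
    qed
  qed
  then show ?thesis by blast
qed

lemma code_delay:
  assumes "rel x i" "i \<le> M" "x \<le> y" "z \<le> i"
  shows "\<exists>j \<ge> i. j \<le> M \<and> rel y j"
proof (cases "rel y i")
  case True
  with assms show ?thesis by blast
next
  case False
  from assms rel_nonneg have "0 \<le> y" by force
  then obtain j where j: "j \<le> M" "rel y j" using ex_code by blast
  \<comment> \<open>The term \<open>t\<close> compares differently with \<open>x\<close> and with
    \<open>y\<close>, so it lies between them; hence \<open>2 * R t\<close> lies between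
    \<open>i\<close> and any code of \<open>y\<close>.\<close>
  from False obtain t where t: "t \<in> terms A" "\<not> ((y < ev t \<longleftrightarrow> i < 2 * R t) \<and> (ev t < y \<longleftrightarrow> 2 * R t < i))"
    by (auto simp: rel_def)
  have "i \<le> j" using t j assms by (auto simp: rel_def) (smt (verit))+
  with j show ?thesis by blast
qed

lemma value_delay:
  assumes "rel x i" "i \<le> j" "z \<le> i"
  shows "\<exists>y \<ge> x. rel y j"
proof (cases "rel x j")
  case True
  then show ?thesis by blast
next
  case False
  obtain y where y: "rel y j" using ex_value assms by force
  from False obtain t where t: "t \<in> terms A" "\<not> ((x < ev t \<longleftrightarrow> j < 2 * R t) \<and> (ev t < x \<longleftrightarrow> 2 * R t < j))"
    by (auto simp: rel_def)
  have "x \<le> y" using t y assms by (auto simp: rel_def) (smt (verit))+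
  with y show ?thesis by blast
qed

abbreviation "gsat g w \<equiv> sat (inst_guard (params A) v g) w"
abbreviation "st \<equiv> step (inst v A)"

lemma gsat_codes:
  assumes "rel w i" "snd ` g \<subseteq> terms A"
  shows "gsat g w \<longleftrightarrow> i \<in> codes R g"
proof -
  have "gsat g w \<longleftrightarrow> (\<forall>(c, t) \<in> g. holds c w (ev t))"
    by (auto simp: sat_def inst_guard_def split: prod.splits)
  also have "\<dots> \<longleftrightarrow> (\<forall>(c, t) \<in> g. holds c i (2 * R t))"
    using rel_holds[OF assms(1)] assms(2) by force
  finally show ?thesis by (simp add: codes_def)
qed

lemma edge_props:
  assumes "(l, g, a, r, l') \<in> edges A"
  shows "l \<in> locs A" "l' \<in> locs A" "a \<in> acts A" "snd ` g \<subseteq> terms A"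
proof -
  have "\<forall>(l, g, a, r, l') \<in> edges A. l \<in> locs A \<and> finite g \<and> a \<in> acts A \<and> l' \<in> locs A"
    using pta unfolding extended_1c_pta_def by blast
  from bspec[OF this assms] show "l \<in> locs A" "l' \<in> locs A" "a \<in> acts A" by simp_all
  have "snd ` g \<subseteq> LT A" unfolding LT_def
    by (rule subsetI, rule UnI2, rule UN_I[OF assms]) simp
  then show "snd ` g \<subseteq> terms A" by (auto simp: terms_def)
qed

lemma invar_terms: "l \<in> locs A \<Longrightarrow> snd ` invar A l \<subseteq> terms A"
  by (auto simp: terms_def LT_def)

lemma gsat_convex: "gsat g x \<Longrightarrow> gsat g y \<Longrightarrow> x \<le> w \<Longrightarrow> w \<le> y \<Longrightarrow> gsat g w"
  unfolding sat_def using holds_convex by (fastforce split: prod.splits)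

lemma configs_inst: "(l, w) \<in> configs (inst v A) \<longleftrightarrow> l \<in> locs A \<and> 0 \<le> w \<and> gsat (invar A l) w"
  by (simp add: configs_def inst_def)

lemma edges_inst:
  "(l, G, a, r, l') \<in> edges (inst v A) \<longleftrightarrow> (\<exists>g. G = inst_guard (params A) v g \<and> (l, g, a, r, l') \<in> edges A)"
  by (force simp: inst_def)

text \<open>The invariant is demanded throughout the delay, but by convexity it suffices to have it
  at both ends of the delay.\<close>

lemma step_inst:
  "st (l, w) a (l', w') \<longleftrightarrow> (\<exists>g r. (l, g, a, r, l') \<in> edges A \<and> 0 \<le> w \<and> gsat (invar A l) w
     \<and> (\<exists>y \<ge> w. gsat (invar A l) y \<and> gsat g y \<and> w' = (if r then 0 else y) \<and> gsat (invar A l') w'))"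
  (is "?L \<longleftrightarrow> ?R")
proof
  assume ?L
  then obtain d g r where d: "0 \<le> d" and e: "(l, g, a, r, l') \<in> edges A"
    and c: "\<forall>d' \<in> {0..d}. (l, w + d') \<in> configs (inst v A)" "gsat g (w + d)"
      "w' = (if r then 0 else w + d)" "(l', w') \<in> configs (inst v A)"
    by (auto simp: step_def edges_inst)
  have "(l, w + 0) \<in> configs (inst v A)" "(l, w + d) \<in> configs (inst v A)" using c(1) d by force+
  then show ?R using c e d by (intro exI[of _ g] exI[of _ r]) (auto simp: configs_inst intro!: exI[of _ "w + d"])
next
  assume ?R
  then obtain g r y where e: "(l, g, a, r, l') \<in> edges A" and w: "0 \<le> w" "gsat (invar A l) w"
    and y: "w \<le> y" "gsat (invar A l) y" "gsat g y" "w' = (if r then 0 else y)" "gsat (invar A l') w'"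
    by blast
  have "\<forall>d' \<in> {0..y - w}. (l, w + d') \<in> configs (inst v A)"
    using w y edge_props[OF e] gsat_convex[of "invar A l" w y] by (auto simp: configs_inst)
  moreover have "(l', w') \<in> configs (inst v A)"
    using w y edge_props[OF e] by (auto simp: configs_inst)
  moreover have "(l, inst_guard (params A) v g, a, r, l') \<in> edges (inst v A)"
    using e by (auto simp: edges_inst)
  ultimately show ?L using w y unfolding step_def
    by (auto intro!: exI[of _ "y - w"] exI[of _ "inst_guard (params A) v g"] exI[of _ r])
qed

section \<open>Determinisation by intervals of codes\<close>

fun valid :: "'l dstate \<Rightarrow> bool" where
  "valid (l, lo, hi) \<longleftrightarrow> l \<in> locs A \<and> z \<le> lo \<and> lo \<le> hi \<and> hi \<le> M \<and> {lo..hi} \<subseteq> codes R (invar A l)"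

abbreviation "dl \<equiv> delta A R M"

lemma valid_delta:
  assumes "valid q" "dl q a = Some q'"
  shows "valid q'"
proof -
  obtain l lo hi l' lo' hi' where q: "q = (l, lo, hi)" "q' = (l', lo', hi')" by (metis prod_cases3)
  from assms(2) obtain g r where e: "(l, g, a, r, l') \<in> edges A" and K: "{lo'..hi'} = succs A R M l lo g r l'" and le: "lo' \<le> hi'"
    unfolding q by (rule delta_SomeD[OF det])
  have "succs A R M l lo g r l' \<subseteq> codes R (invar A l') \<inter> {z..M}"
    using assms q top[OF zterm_in] by (auto simp: succs_def Let_def split: if_splits)
  then have "{lo'..hi'} \<subseteq> codes R (invar A l') \<inter> {z..M}" using K by simp
  moreover from this le have "lo' \<in> {z..M}" "hi' \<in> {z..M}" by auto
  ultimately show ?thesis using le q edge_props[OF e] by auto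
qed

text \<open>Forward simulation, for a value anywhere in the interval: its delay is matched by
  \<open>code_delay\<close>, and a code that is reachable from \<open>i\<close> is reachable from
  \<open>lo\<close>. Determinism identifies the edge of the step with the edge used by
  \<open>delta\<close>, hence also the target location.\<close>

lemma step_delta:
  assumes "valid (l, lo, hi)" "rel w i" "lo \<le> i" "i \<le> hi" "st (l, w) a (l', w')"
  obtains lo' hi' i' where "dl (l, lo, hi) a = Some (l', lo', hi')" "rel w' i'" "lo' \<le> i'" "i' \<le> hi'"
proof -
  from assms(5) obtain g r y where e: "(l, g, a, r, l') \<in> edges A"
    and y: "w \<le> y" "gsat (invar A l) y" "gsat g y" "w' = (if r then 0 else y)" "gsat (invar A l') w'"
    by (auto simp: step_inst)
  obtain j where j: "i \<le> j" "j \<le> M" "rel y j" using code_delay[of w i y] assms y by auto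
  define i' where "i' = (if r then z else j)"
  have i': "rel w' i'" using y j rel_zero by (auto simp: i'_def)
  have "j \<in> {lo..M} \<inter> codes R (invar A l) \<inter> codes R g"
    using j assms y gsat_codes[OF j(3)] edge_props[OF e] invar_terms by auto
  moreover have "i' \<in> codes R (invar A l')"
    using y gsat_codes[OF i'] invar_terms edge_props[OF e] by auto
  ultimately have m: "i' \<in> succs A R M l lo g r l'" by (auto simp: succs_def Let_def i'_def)
  with delta_None[OF det] e obtain q' where "dl (l, lo, hi) a = Some q'" by fastforce
  moreover from this obtain l2 lo' hi' where q': "q' = (l2, lo', hi')" by (metis prod_cases3)
  ultimately have d: "dl (l, lo, hi) a = Some (l2, lo', hi')" by simp
  then obtain g2 r2 where "(l, g2, a, r2, l2) \<in> edges A" "{lo'..hi'} = succs A R M l lo g2 r2 l2"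
    by (rule delta_SomeD[OF det])
  then have "l2 = l'" "{lo'..hi'} = succs A R M l lo g r l'"
    using e det unfolding deterministic_def by blast+
  with d m i' that show ?thesis by (metis atLeastAtMost_iff)
qed

text \<open>Backward simulation, for values at the lower end only. The target code \<open>k\<close>
  is arbitrary within the new interval, so a path can be built towards a prescribed last
  code.\<close>

lemma delta_step:
  assumes "valid (l, lo, hi)" "rel w lo" "dl (l, lo, hi) a = Some (l', lo', hi')" "lo' \<le> k" "k \<le> hi'"
  obtains w' where "st (l, w) a (l', w')" "rel w' k"
proof -
  from assms(3) obtain g r where e: "(l, g, a, r, l') \<in> edges A" and K: "{lo'..hi'} = succs A R M l lo g r l'"
    by (rule delta_SomeD[OF det])
  have k: "k \<in> succs A R M l lo g r l'" using K assms by auto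
  then obtain j where j: "lo \<le> j" "j \<in> codes R (invar A l)" "j \<in> codes R g" "k = (if r then z else j)"
    "k \<in> codes R (invar A l')"
    by (auto simp: succs_def Let_def split: if_splits)
  obtain y where y: "w \<le> y" "rel y j" using value_delay[of w lo j] assms j by auto
  define w' where "w' = (if r then 0 else y)"
  have w': "rel w' k" using y j rel_zero by (auto simp: w'_def)
  have "st (l, w) a (l', w')"
    unfolding step_inst
    using e y j w' gsat_codes[OF y(2)] gsat_codes[OF w'] gsat_codes[OF assms(2)] edge_props[OF e] invar_terms
      rel_nonneg[OF assms(2)] assms(1)
    by (intro exI[of _ g] exI[of _ r]) (auto simp: w'_def)
  with w' that show ?thesis by blast
qed

lemma path_trace:
  assumes "path st (l, w) u (l2, w2)" "valid (l, lo, hi)" "rel w i" "lo \<le> i" "i \<le> hi"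
  shows "\<exists>lo2 hi2 i2. trace dl (l, lo, hi) u = Some (l2, lo2, hi2) \<and> rel w2 i2 \<and> lo2 \<le> i2 \<and> i2 \<le> hi2"
  using assms
proof (induction u arbitrary: l w lo hi i)
  case (Cons a u)
  from Cons.prems(1) obtain l' w' where s: "st (l, w) a (l', w')" and p: "path st (l', w') u (l2, w2)"
    by auto
  from step_delta[OF Cons.prems(2-5) s] obtain lo' hi' i' where d: "dl (l, lo, hi) a = Some (l', lo', hi')"
    "rel w' i'" "lo' \<le> i'" "i' \<le> hi'" .
  with Cons.IH[OF p valid_delta[OF Cons.prems(2) d(1)] d(2-4)] show ?case by (simp del: delta.simps)
qed auto

text \<open>Every code in the last interval is attained. For a nonempty word the starting code is
  always \<open>lo\<close>, for the empty word it is \<open>k\<close>. Quantifying over all values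
  \<open>w\<close> with this code lets the induction continue from whichever value the preceding
  step delivers.\<close>

lemma trace_path:
  assumes "trace dl (l, lo, hi) u = Some (l2, lo2, hi2)" "valid (l, lo, hi)" "lo2 \<le> k" "k \<le> hi2"
  shows "\<exists>i. lo \<le> i \<and> i \<le> hi \<and> (\<forall>w. rel w i \<longrightarrow> (\<exists>w2. path st (l, w) u (l2, w2) \<and> rel w2 k))"
  using assms
proof (induction u arbitrary: l lo hi)
  case (Cons a u)
  then obtain l' lo' hi' where d: "dl (l, lo, hi) a = Some (l', lo', hi')" and t: "trace dl (l', lo', hi') u = Some (l2, lo2, hi2)"
    by (auto simp del: delta.simps split: option.splits)
  from Cons.IH[OF t valid_delta[OF Cons.prems(2) d] Cons.prems(3,4)] obtain i' where
    i': "lo' \<le> i'" "i' \<le> hi'" "\<And>w. rel w i' \<Longrightarrow> \<exists>w2. path st (l', w) u (l2, w2) \<and> rel w2 k" by blast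
  have "\<exists>w2. path st (l, w) (a # u) (l2, w2) \<and> rel w2 k" if wlo: "rel w lo" for w
  proof -
    obtain w' where w': "st (l, w) a (l', w')" "rel w' i'"
      using delta_step[OF Cons.prems(2) wlo d i'(1,2)] .
    from i'(3)[OF w'(2)] obtain w2 where "path st (l', w') u (l2, w2)" "rel w2 k" by blast
    with w'(1) show ?thesis unfolding path.simps by blast
  qed
  with Cons.prems(2) show ?case by (intro exI[of _ lo]) auto
qed auto

text \<open>Any value at \<open>hi\<close> witnesses deadness, by \<open>step_delta\<close>.
  Conversely, if some value with code \<open>i\<close> is stuck, then \<open>delta\<close> is
  undefined from \<open>i\<close>, and by \<open>succs_antimono\<close> also from the larger code
  \<open>hi\<close>.\<close>

lemma dead_iff:
  assumes "valid (l, lo, hi)"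
  shows "dead A R M (l, lo, hi) \<longleftrightarrow> (\<exists>w i. rel w i \<and> lo \<le> i \<and> i \<le> hi \<and> \<not> (\<exists>a c. st (l, w) a c))"
proof
  assume D: "dead A R M (l, lo, hi)"
  have v: "valid (l, hi, hi)" using assms by auto
  obtain w where w: "rel w hi" using ex_value assms by force
  have "\<not> st (l, w) a (l', w')" for a l' w'
    using step_delta[OF v w] D by (metis dead.simps option.simps(3) order_refl)
  with w assms show "\<exists>w i. rel w i \<and> lo \<le> i \<and> i \<le> hi \<and> \<not> (\<exists>a c. st (l, w) a c)" by force
next
  assume "\<exists>w i. rel w i \<and> lo \<le> i \<and> i \<le> hi \<and> \<not> (\<exists>a c. st (l, w) a c)"
  then obtain w i where w: "rel w i" "lo \<le> i" "i \<le> hi" "\<And>a c. \<not> st (l, w) a c" by blast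
  have v: "valid (l, i, i)" using assms w by auto
  have n: "dl (l, i, i) a = None" for a
  proof (rule ccontr)
    assume "dl (l, i, i) a \<noteq> None"
    then obtain l' lo' hi' where d: "dl (l, i, i) a = Some (l', lo', hi')" by auto
    then have "lo' \<le> hi'" by (rule delta_SomeD[OF det])
    then show False using delta_step[OF v w(1) d, of lo'] w(4) by blast
  qed
  show "dead A R M (l, lo, hi)"
    unfolding dead.simps
  proof (intro allI)
    fix a
    show "dl (l, hi, hi) a = None"
    proof (cases "edge_opt A l a")
      case (Some e)
      then obtain g r l' where e: "(l, g, a, r, l') \<in> edges A" using edge_opt_iff[OF det] by (metis prod_cases3)
      have "succs A R M l hi g r l' = {}"
        using succs_antimono[OF w(3), of A R M l g r l'] delta_None[OF det n e] by blast
      then show ?thesis using e edge_opt_iff[OF det, of l a g r l'] by simp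
    qed auto
  qed
qed

text \<open>If the upper end can move, so can the lower end. This supplies the liveness premises of
  \<open>dlang_eq_iff\<close>.\<close>

lemma live:
  assumes "valid q" "\<not> dead A R M q"
  shows "\<exists>a. dl q a \<noteq> None"
proof -
  obtain l lo hi where q: "q = (l, lo, hi)" by (metis prod_cases3)
  with assms obtain a l' lo' hi' where d: "dl (l, hi, hi) a = Some (l', lo', hi')" by fastforce
  then obtain g r where e: "(l, g, a, r, l') \<in> edges A" and K: "{lo'..hi'} = succs A R M l hi g r l'" "lo' \<le> hi'"
    by (rule delta_SomeD[OF det])
  have "dl q a \<noteq> None"
  proof
    assume "dl q a = None"
    with q delta_None[OF det _ e] have "succs A R M l lo g r l' = {}" by blast
    with K succs_antimono[of lo hi A R M l g r l'] assms q show False by auto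
  qed
  then show ?thesis by blast
qed

lemma valid_trace: "valid q \<Longrightarrow> trace dl q u = Some q' \<Longrightarrow> valid q'"
  by (induction u arbitrary: q) (auto simp del: delta.simps split: option.splits dest: valid_delta)

abbreviation "init \<equiv> (start A, z, z)"

lemma init_configs: "(start A, 0) \<in> configs (inst v A) \<longleftrightarrow> z \<in> codes R (invar A (start A))"
proof -
  have "start A \<in> locs A" using pta by (simp add: extended_1c_pta_def)
  with gsat_codes[OF rel_zero invar_terms] show ?thesis by (simp add: configs_inst)
qed

lemma valid_init: "z \<in> codes R (invar A (start A)) \<Longrightarrow> valid init"
  using pta top[OF zterm_in] by (auto simp: extended_1c_pta_def)

text \<open>For the converse, the run is kept at the lower ends: \<open>delta_step\<close> leads
  from any value at one lower end to a value at the next, so dependent choice builds the infinite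
  run step by step. The predicate \<open>P\<close> records this position.\<close>

lemma Inf_iff:
  assumes V: "valid init"
  shows "(\<exists>cs. cs 0 = (start A, 0) \<and> (\<forall>i. st (cs i) (f i) (cs (Suc i)))) \<longleftrightarrow> (\<forall>n. trace dl init (map f [0..<n]) \<noteq> None)"
proof
  assume "\<exists>cs. cs 0 = (start A, 0) \<and> (\<forall>i. st (cs i) (f i) (cs (Suc i)))"
  then obtain cs where cs: "cs 0 = (start A, 0)" "\<And>i. st (cs i) (f i) (cs (Suc i))" by blast
  have P: "path st (cs j) (map f [j..<j + n]) (cs (j + n))" for n j
  proof (induction n arbitrary: j)
    case (Suc n)
    have "map f [j..<j + Suc n] = f j # map f [Suc j..<Suc j + n]"
      by (simp add: upt_rec)
    with cs(2)[of j] Suc[of "Suc j"] show ?case by (metis add_Suc add_Suc_right path.simps(2))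
  qed simp
  show "\<forall>n. trace dl init (map f [0..<n]) \<noteq> None"
  proof
    fix n
    obtain l2 w2 where "cs n = (l2, w2)" by (metis prod.exhaust)
    then have "path st (start A, 0) (map f [0..<n]) (l2, w2)" using P[of 0 n] cs by simp
    from path_trace[OF this V rel_zero] show "trace dl init (map f [0..<n]) \<noteq> None" by auto
  qed
next
  assume T: "\<forall>n. trace dl init (map f [0..<n]) \<noteq> None"
  define q where "q n = the (trace dl init (map f [0..<n]))" for n
  have q: "trace dl init (map f [0..<n]) = Some (q n)" for n using T by (auto simp: q_def)
  have q0: "q 0 = init" using q[of 0] by simp
  have vq: "valid (q n)" for n using valid_trace[OF V q] .
  have dq: "dl (q n) (f n) = Some (q (Suc n))" for n
    using q[of "Suc n"] q[of n] by (auto simp: trace_append simp del: delta.simps split: option.splits)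
  define P where "P n c \<longleftrightarrow> fst c = fst (q n) \<and> rel (snd c) (fst (snd (q n)))" for n c
  have "\<exists>cs. \<forall>n. P n (cs n) \<and> (n = 0 \<longrightarrow> cs n = (start A, 0)) \<and> st (cs n) (f n) (cs (Suc n))"
  proof -
    have "\<exists>cs. \<forall>n. (P n (cs n) \<and> (n = 0 \<longrightarrow> cs n = (start A, 0))) \<and> st (cs n) (f n) (cs (Suc n))"
    proof (rule dependent_nat_choice)
      show "\<exists>c. P 0 c \<and> (0 = (0::nat) \<longrightarrow> c = (start A, 0))"
        using q0 rel_zero by (auto simp: P_def)
      fix c n assume c: "P n c \<and> (n = 0 \<longrightarrow> c = (start A, 0))"
      obtain l lo hi l' lo' hi' where qn: "q n = (l, lo, hi)" "q (Suc n) = (l', lo', hi')" by (metis prod_cases3)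
      obtain w where cw: "c = (l, w)" "rel w lo" using c qn by (cases c) (auto simp: P_def)
      have d: "dl (l, lo, hi) (f n) = Some (l', lo', hi')" using dq[of n] qn by simp
      have "lo' \<le> hi'" using vq[of "Suc n"] qn by simp
      then obtain w' where "st (l, w) (f n) (l', w')" "rel w' lo'"
        using delta_step[OF _ cw(2) d, of lo'] vq[of n] qn by auto
      then show "\<exists>c'. (P (Suc n) c' \<and> (Suc n = 0 \<longrightarrow> c' = (start A, 0))) \<and> st c (f n) c'"
        using qn cw by (intro exI[of _ "(l', w')"]) (auto simp: P_def)
    qed
    then show ?thesis by blast
  qed
  then show "\<exists>cs. cs 0 = (start A, 0) \<and> (\<forall>i. st (cs i) (f i) (cs (Suc i)))" by metis
qed

lemma lang_inst:
  "lang (inst v A) = (if z \<in> codes R (invar A (start A)) then dlang dl (dead A R M) init else {})"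
proof (cases "z \<in> codes R (invar A (start A))")
  case True
  note V = valid_init[OF True]
  have F: "(\<exists>c. path st (start A, 0) u c \<and> \<not> (\<exists>a c'. st c a c')) \<longleftrightarrow> (\<exists>q. trace dl init u = Some q \<and> dead A R M q)" for u
  proof
    assume "\<exists>c. path st (start A, 0) u c \<and> \<not> (\<exists>a c'. st c a c')"
    then obtain l w where c: "path st (start A, 0) u (l, w)" "\<not> (\<exists>a c'. st (l, w) a c')" by auto
    from path_trace[OF c(1) V rel_zero] obtain lo hi i where
      t: "trace dl init u = Some (l, lo, hi)" "rel w i" "lo \<le> i" "i \<le> hi" by auto
    with c dead_iff[OF valid_trace[OF V t(1)]] show "\<exists>q. trace dl init u = Some q \<and> dead A R M q" by blast
  next
    assume "\<exists>q. trace dl init u = Some q \<and> dead A R M q"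
    then obtain l lo hi where t: "trace dl init u = Some (l, lo, hi)" "dead A R M (l, lo, hi)" by auto
    with dead_iff[OF valid_trace[OF V t(1)]] obtain w i where w: "rel w i" "lo \<le> i" "i \<le> hi" "\<not> (\<exists>a c. st (l, w) a c)" by blast
    from trace_path[OF t(1) V w(2,3)] obtain w2 where w2: "path st (start A, 0) u (l, w2)" "rel w2 i"
      using rel_zero by (metis order_antisym)
    \<comment> \<open>The stuck value \<open>w\<close> need not be the value \<open>w2\<close> that
      the path reaches, but both have code \<open>i\<close>, and values with a common code permit
      the same actions.\<close>
    have "\<not> (\<exists>a c. st (l, w2) a c)"
    proof
      assume "\<exists>a c. st (l, w2) a c"
      then obtain a l' w' where s: "st (l, w2) a (l', w')" by auto
      have v: "valid (l, i, i)" using valid_trace[OF V t(1)] w by auto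
      from step_delta[OF v w2(2) order_refl order_refl s] obtain lo' hi' i'
        where d: "dl (l, i, i) a = Some (l', lo', hi')" .
      then have "lo' \<le> hi'" by (rule delta_SomeD[OF det])
      then show False using delta_step[OF v w(1) d, of lo'] w(4) by blast
    qed
    with w2 show "\<exists>c. path st (start A, 0) u c \<and> \<not> (\<exists>a c'. st c a c')" by blast
  qed
  have s: "start (inst v A) = start A" by (simp add: inst_def)
  show ?thesis using True init_configs unfolding lang_alt dlang_def s F Inf_iff[OF V] by simp
next
  case False
  then show ?thesis using init_configs by (simp add: lang_alt) (simp add: inst_def)
qed

text \<open>Settles the case in which exactly one of two automata has an initial configuration: the
  language of the other one is empty.\<close>

lemma dlang_nonempty:
  assumes "z \<in> codes R (invar A (start A))"
  shows "dlang dl (dead A R M) init \<noteq> {}"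
proof -
  have "trace dl init [] \<noteq> None" by simp
  with readable_iff[of dl init "dead A R M" "[]"] live valid_trace[OF valid_init[OF assms]]
  show ?thesis by blast
qed

end

section \<open>Comparing two rank functions in the synchronous product\<close>

abbreviation starts :: "('l, 'a, 'p) pta \<Rightarrow> ('p lterm \<Rightarrow> int) \<Rightarrow> bool" where
  "starts A R \<equiv> 2 * R zterm \<in> codes R (invar A (start A))"

abbreviation start_state :: "('l, 'a, 'p) pta \<Rightarrow> ('p lterm \<Rightarrow> int) \<Rightarrow> 'l dstate" where
  "start_state A R \<equiv> (start A, 2 * R zterm, 2 * R zterm)"

inductive joint :: "('l, 'a, 'p) pta \<Rightarrow> int \<Rightarrow> ('p lterm \<Rightarrow> int) \<Rightarrow> ('p lterm \<Rightarrow> int)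
    \<Rightarrow> 'l \<Rightarrow> int \<times> int \<times> int \<times> int \<Rightarrow> bool" for A M R S where
  init: "starts A R \<Longrightarrow> starts A S
    \<Longrightarrow> joint A M R S (start A) (2 * R zterm, 2 * R zterm, 2 * S zterm, 2 * S zterm)"
| step: "joint A M R S l (lo, hi, lo', hi') \<Longrightarrow> delta A R M (l, lo, hi) a = Some (k, p, q)
    \<Longrightarrow> delta A S M (l, lo', hi') a = Some (k, p', q') \<Longrightarrow> joint A M R S k (p, q, p', q')"

fun agree :: "('l, 'a, 'p) pta \<Rightarrow> int \<Rightarrow> ('p lterm \<Rightarrow> int) \<Rightarrow> ('p lterm \<Rightarrow> int)
    \<Rightarrow> 'l \<Rightarrow> int \<times> int \<times> int \<times> int \<Rightarrow> bool" where
  "agree A M R S l (lo, hi, lo', hi') \<longleftrightarrow>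
     (dead A R M (l, lo, hi) \<longleftrightarrow> dead A S M (l, lo', hi'))
   \<and> (\<forall>a. delta A R M (l, lo, hi) a = None \<longleftrightarrow> delta A S M (l, lo', hi') a = None)"

text \<open>No valuation occurs here, so the condition can be tested for arbitrary rank functions,
  realisable or not.\<close>

definition same_lang :: "('l, 'a, 'p) pta \<Rightarrow> int \<Rightarrow> ('p lterm \<Rightarrow> int) \<Rightarrow> ('p lterm \<Rightarrow> int) \<Rightarrow> bool" where
  "same_lang A M R S \<longleftrightarrow>
     (starts A R \<longleftrightarrow> starts A S)
   \<and> (\<forall>l x. joint A M R S l x \<longrightarrow> agree A M R S l x)"

lemma delta_loc:
  assumes "delta A R M x a = Some p" "delta A S M y a = Some q" "fst x = fst y"
  shows "fst p = fst q"
proof -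
  obtain l lo hi lo' hi' where "x = (l, lo, hi)" "y = (l, lo', hi')"
    using assms(3) by (metis prod.exhaust_sel)
  then show ?thesis using assms by (auto simp: Let_def split: option.splits if_splits)
qed

lemma trace_loc:
  assumes "trace (delta A R M) x u = Some p" "trace (delta A S M) y u = Some q" "fst x = fst y"
  shows "fst p = fst q"
  using assms
proof (induction u arbitrary: x y)
  case (Cons b u)
  then obtain x' y' where d: "delta A R M x b = Some x'" "delta A S M y b = Some y'"
    and t: "trace (delta A R M) x' u = Some p" "trace (delta A S M) y' u = Some q"
    by (auto simp del: delta.simps split: option.splits)
  from Cons.IH[OF t delta_loc[OF d Cons.prems(3)]] show ?case .
qed auto

lemma joint_iff:
  assumes "starts A R" "starts A S"
  shows "joint A M R S l (lo, hi, lo', hi') \<longleftrightarrow>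
    (\<exists>u. trace (delta A R M) (start_state A R) u = Some (l, lo, hi)
       \<and> trace (delta A S M) (start_state A S) u = Some (l, lo', hi'))"
proof
  assume "joint A M R S l (lo, hi, lo', hi')"
  then show "\<exists>u. trace (delta A R M) (start_state A R) u = Some (l, lo, hi)
       \<and> trace (delta A S M) (start_state A S) u = Some (l, lo', hi')"
  proof (induction l "(lo, hi, lo', hi')" arbitrary: lo hi lo' hi' rule: joint.induct)
    case init
    show ?case by (intro exI[of _ "[]"]) auto
  next
    case (step l lo hi lo' hi' a k p q p' q')
    then obtain u where "trace (delta A R M) (start_state A R) u = Some (l, lo, hi)"
       "trace (delta A S M) (start_state A S) u = Some (l, lo', hi')" by blast
    with step show ?case by (intro exI[of _ "u @ [a]"]) (simp add: trace_append del: delta.simps)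
  qed
next
  assume "\<exists>u. trace (delta A R M) (start_state A R) u = Some (l, lo, hi)
       \<and> trace (delta A S M) (start_state A S) u = Some (l, lo', hi')"
  then obtain u where "trace (delta A R M) (start_state A R) u = Some (l, lo, hi)"
       "trace (delta A S M) (start_state A S) u = Some (l, lo', hi')" by blast
  then show "joint A M R S l (lo, hi, lo', hi')"
  proof (induction u arbitrary: l lo hi lo' hi' rule: rev_induct)
    case Nil
    then show ?case using joint.init[OF assms] by auto
  next
    case (snoc a u)
    then obtain l1 lo1 hi1 l2 lo2 hi2 where
      t: "trace (delta A R M) (start_state A R) u = Some (l1, lo1, hi1)"
         "trace (delta A S M) (start_state A S) u = Some (l2, lo2, hi2)"
         "delta A R M (l1, lo1, hi1) a = Some (l, lo, hi)" "delta A S M (l2, lo2, hi2) a = Some (l, lo', hi')"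
      by (auto simp: trace_append simp del: delta.simps split: option.splits)
    have "l1 = l2" using trace_loc[OF t(1,2)] by simp
    then have "joint A M R S l2 (lo1, hi1, lo2, hi2)" using t(1,2) by (intro snoc.IH) simp_all
    from joint.step[OF this _ t(4)] t(3) \<open>l1 = l2\<close> show ?case by blast
  qed
qed

text \<open>\<open>lang_inst\<close> replaces both languages by those of interval automata, and
  \<open>dlang_eq_iff\<close> compares states reached by a common word; these pairs are the joint
  states. If one automaton has no initial configuration, there are no joint states, and
  \<open>dlang_nonempty\<close> decides.\<close>

lemma same_lang_iff:
  assumes "ranked A v R M" "ranked A v' S M"
  shows "lang (inst v A) = lang (inst v' A) \<longleftrightarrow> same_lang A M R S"
proof -
  interpret r: ranked A v R M by fact
  interpret s: ranked A v' S M by fact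
  show ?thesis
  proof (cases "starts A R \<and> starts A S")
    case True
    note V = r.valid_init[OF conjunct1[OF True]] s.valid_init[OF conjunct2[OF True]]
    have T: "fst p = fst q" if "trace (delta A R M) r.init u = Some p" "trace (delta A S M) s.init u = Some q" for u p q
      using trace_loc[OF that] by simp
    have "lang (inst v A) = lang (inst v' A) \<longleftrightarrow>
        dlang (delta A R M) (dead A R M) r.init = dlang (delta A S M) (dead A S M) s.init"
      using True by (simp add: r.lang_inst s.lang_inst)
    also have "\<dots> \<longleftrightarrow> (\<forall>u x y. trace (delta A R M) r.init u = Some x \<longrightarrow> trace (delta A S M) s.init u = Some y \<longrightarrow>
       (dead A R M x \<longleftrightarrow> dead A S M y) \<and> (\<forall>a. delta A R M x a = None \<longleftrightarrow> delta A S M y a = None))"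
    proof (rule dlang_eq_iff)
      show "\<exists>a. delta A R M p a \<noteq> None" if "trace (delta A R M) r.init w = Some p" "\<not> dead A R M p" for w p
        using r.live[OF r.valid_trace[OF V(1) that(1)] that(2)] .
      show "\<exists>a. delta A S M p a \<noteq> None" if "trace (delta A S M) s.init w = Some p" "\<not> dead A S M p" for w p
        using s.live[OF s.valid_trace[OF V(2) that(1)] that(2)] .
    qed
    also have "\<dots> \<longleftrightarrow> (\<forall>l x. joint A M R S l x \<longrightarrow> agree A M R S l x)"
      (is "?P \<longleftrightarrow> ?Q")
    proof
      assume P: ?P
      show ?Q
      proof (intro allI impI)
        fix l x assume j: "joint A M R S l x"
        obtain lo hi lo' hi' where x: "x = (lo, hi, lo', hi')" by (metis prod_cases4)
        from j[unfolded x joint_iff[OF conjunct1[OF True] conjunct2[OF True]]] obtain u where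
          "trace (delta A R M) r.init u = Some (l, lo, hi)" "trace (delta A S M) s.init u = Some (l, lo', hi')"
          by blast
        with P show "agree A M R S l x" unfolding x agree.simps by blast
      qed
    next
      assume Q: ?Q
      show ?P
      proof (intro allI impI)
        fix u x y assume t: "trace (delta A R M) r.init u = Some x" "trace (delta A S M) s.init u = Some y"
        obtain l lo hi l2 lo' hi' where xy: "x = (l, lo, hi)" "y = (l2, lo', hi')" by (metis prod_cases3)
        have l2: "l2 = l" using T[OF t] xy by simp
        have "joint A M R S l (lo, hi, lo', hi')"
          unfolding joint_iff[OF conjunct1[OF True] conjunct2[OF True]] using t xy l2 by blast
        with Q have "agree A M R S l (lo, hi, lo', hi')" by blast
        then show "(dead A R M x \<longleftrightarrow> dead A S M y) \<and> (\<forall>a. delta A R M x a = None \<longleftrightarrow> delta A S M y a = None)"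
          unfolding xy l2 agree.simps .
      qed
    qed
    finally show ?thesis using True by (simp add: same_lang_def)
  next
    case False
    have "\<not> joint A M R S l x" for l x
    proof
      assume "joint A M R S l x"
      then show False using False by induction auto
    qed
    with False show ?thesis using r.dlang_nonempty s.dlang_nonempty
      by (auto simp: same_lang_def r.lang_inst s.lang_inst)
  qed
qed

section \<open>Reasoning about programs\<close>

text \<open>A weakest precondition for total correctness, with the running time handed to the
  postcondition. The simplification rules below execute straight-line code symbolically.\<close>

definition runs :: "prog \<Rightarrow> memory \<Rightarrow> (nat \<Rightarrow> memory \<Rightarrow> bool) \<Rightarrow> bool" where
  "runs p s Q \<longleftrightarrow> (\<exists>t s'. exec p s t s' \<and> Q t s')"

text \<open>Keeps the simplifier from executing the continuation before the state it starts from is known.\<close>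

lemma runs_weak_cong [cong]: "p = p' \<Longrightarrow> s = s' \<Longrightarrow> runs p s Q = runs p' s' Q"
  by simp

lemma runs_Skip [simp]: "runs Skip s Q \<longleftrightarrow> Q 1 s"
  unfolding runs_def by (metis exec.Skip SkipE)

lemma runs_Put [simp]: "runs (Put x i e) s Q \<longleftrightarrow> Q 1 (s(x := (s x)(exp_val i s := exp_val e s)))"
  unfolding runs_def by (metis exec.Put PutE)

lemma runs_Seq [simp]:
  "runs (Seq p q) s Q \<longleftrightarrow> runs p s (\<lambda>t s'. runs q s' (\<lambda>u. Q (t + u)))"
  unfolding runs_def by (blast intro: exec.Seq elim: SeqE)

lemma runs_Cond [simp]:
  "runs (Cond b p q) s Q \<longleftrightarrow>
     (if test_val b s then runs p s (\<lambda>t. Q (1 + t)) else runs q s (\<lambda>t. Q (1 + t)))"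
proof
  assume "runs (Cond b p q) s Q"
  then show "if test_val b s then runs p s (\<lambda>t. Q (1 + t)) else runs q s (\<lambda>t. Q (1 + t))"
    unfolding runs_def by (auto elim!: CondE)
next
  assume "if test_val b s then runs p s (\<lambda>t. Q (1 + t)) else runs q s (\<lambda>t. Q (1 + t))"
  then show "runs (Cond b p q) s Q"
    unfolding runs_def by (metis exec.CondT exec.CondF)
qed

fun writes :: "prog \<Rightarrow> string set" where
  "writes Skip = {}"
| "writes (Put x i e) = {x}"
| "writes (Seq p q) = writes p \<union> writes q"
| "writes (Cond b p q) = writes p \<union> writes q"
| "writes (While b p) = writes p"

lemma exec_frame: "exec p s t s' \<Longrightarrow> y \<notin> writes p \<Longrightarrow> s' y = s y"
  by (induction rule: exec.induct) auto

text \<open>The rule for applying the specification of a subprogram: arrays that it does not assign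
  are known to be unchanged without being mentioned in the specification.\<close>

lemma runs_call:
  assumes "runs p s P"
    and "\<And>t s'. P t s' \<Longrightarrow> \<forall>y. y \<notin> writes p \<longrightarrow> s' y = s y \<Longrightarrow> Q t s'"
  shows "runs p s Q"
  using assms exec_frame unfolding runs_def by blast

text \<open>The index of \<open>I\<close> is a variant, so at most \<open>k\<close> rounds take
  place. Each round costs its body and one test; the final 1 is the failing test.\<close>

lemma runs_While:
  assumes I: "I k s"
    and body: "\<And>k s'. I k s' \<Longrightarrow> test_val b s' \<Longrightarrow> \<forall>y. y \<notin> writes p \<longrightarrow> s' y = s y
      \<Longrightarrow> runs p s' (\<lambda>t s''. t \<le> c \<and> (\<exists>j < k. I j s''))"
    and fin: "\<And>k' s' t. I k' s' \<Longrightarrow> \<not> test_val b s' \<Longrightarrow> \<forall>y. y \<notin> writes p \<longrightarrow> s' y = s y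
      \<Longrightarrow> t \<le> k * (c + 1) + 1 \<Longrightarrow> Q t s'"
  shows "runs (While b p) s Q"
proof -
  have "\<exists>t s2 k'. exec (While b p) s1 t s2 \<and> I k' s2 \<and> \<not> test_val b s2 \<and> t \<le> k * (c + 1) + 1"
    if "I k s1" "\<forall>y. y \<notin> writes p \<longrightarrow> s1 y = s y" for k s1
    using that
  proof (induction k arbitrary: s1 rule: less_induct)
    case (less k)
    show ?case
    proof (cases "test_val b s1")
      case True
      from body[OF less.prems(1) True less.prems(2)] obtain t s2 j where
        e: "exec p s1 t s2" "t \<le> c" and j: "j < k" "I j s2" by (auto simp: runs_def)
      have "\<forall>y. y \<notin> writes p \<longrightarrow> s2 y = s y" using exec_frame[OF e(1)] less.prems by simp
      from less.IH[OF j this] obtain u s3 k' where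
        u: "exec (While b p) s2 u s3" "I k' s3" "\<not> test_val b s3" "u \<le> j * (c + 1) + 1" by blast
      have "(j + 1) * (c + 1) \<le> k * (c + 1)" using j by (intro mult_right_mono) auto
      with u e have "1 + t + u \<le> k * (c + 1) + 1" by simp
      with u exec.WhileT[OF True e(1) u(1)] show ?thesis by blast
    next
      case False
      with less.prems exec.WhileF[OF False] show ?thesis by (intro exI conjI) auto
    qed
  qed
  from this[OF I] obtain t s2 k' where
    *: "exec (While b p) s t s2" "I k' s2" "\<not> test_val b s2" "t \<le> k * (c + 1) + 1" by blast
  have "\<forall>y. y \<notin> writes p \<longrightarrow> s2 y = s y" using exec_frame[OF *(1)] by simp
  with fin * show ?thesis unfolding runs_def by blast
qed

abbreviation V :: "string \<Rightarrow> exp" where "V x \<equiv> Get x (Const 0)"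

abbreviation Assign :: "string \<Rightarrow> exp \<Rightarrow> prog" (infix "::=" 60) where
  "x ::= e \<equiv> Put x (Const 0) e"

abbreviation Then :: "prog \<Rightarrow> prog \<Rightarrow> prog" (infixr ";;" 55) where
  "p ;; q \<equiv> Seq p q"

abbreviation Same :: "exp \<Rightarrow> exp \<Rightarrow> test" where
  "Same e f \<equiv> Conj (Neg (Less e f)) (Neg (Less f e))"

definition For :: "string \<Rightarrow> string \<Rightarrow> prog \<Rightarrow> prog" where
  "For x y p = (x ::= Const 0 ;; While (Less (V x) (V y)) (p ;; x ::= Add (V x) (Const 1)))"

lemma writes_For [simp]: "writes (For x y p) = insert x (writes p)"
  by (auto simp: For_def)

text \<open>Each round pays for the body, the test and the increment, whence \<open>c + 2\<close>;
  the final 2 is the initialisation and the failing test. The postcondition of the body speaks of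
  the state after the increment.\<close>

lemma runs_For:
  assumes n: "s y 0 = int n" and xy: "x \<noteq> y" "x \<notin> writes p" "y \<notin> writes p"
    and init: "I 0 (s(x := (s x)(0 := 0)))"
    and body: "\<And>i s'. i < n \<Longrightarrow> I i s' \<Longrightarrow> s' x 0 = int i
      \<Longrightarrow> \<forall>z. z \<notin> insert x (writes p) \<longrightarrow> s' z = s z
      \<Longrightarrow> runs p s' (\<lambda>t s''. t \<le> c \<and> I (Suc i) (s''(x := (s'' x)(0 := 1 + int i))))"
    and fin: "\<And>s' t. I n s' \<Longrightarrow> \<forall>z. z \<notin> insert x (writes p) \<longrightarrow> s' z = s z
      \<Longrightarrow> t \<le> n * (c + 2) + 2 \<Longrightarrow> Q t s'"
  shows "runs (For x y p) s Q"
proof -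
  define s0 where "s0 = s(x := (s x)(0 := 0))"
  define J where "J k s' \<longleftrightarrow> (\<exists>i. i + k = n \<and> I i s' \<and> s' x 0 = int i)" for k s'
  have fr: "\<forall>z. z \<notin> insert x (writes p) \<longrightarrow> s' z = s z"
    if "\<forall>z. z \<notin> writes (p ;; x ::= Add (V x) (Const 1)) \<longrightarrow> s' z = s0 z" for s'
    using that by (auto simp: s0_def)
  have "runs (While (Less (V x) (V y)) (p ;; x ::= Add (V x) (Const 1))) s0 (\<lambda>t. Q (1 + t))"
  proof (rule runs_While[where I = J and k = n and c = "c + 1"])
    show "J n s0" using init by (auto simp: J_def s0_def)
  next
    fix k s' assume J: "J k s'" and t: "test_val (Less (V x) (V y)) s'"
      and f: "\<forall>z. z \<notin> writes (p ;; x ::= Add (V x) (Const 1)) \<longrightarrow> s' z = s0 z"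
    from J obtain i where i: "i + k = n" "I i s'" "s' x 0 = int i" by (auto simp: J_def)
    have y: "s' y 0 = int n" using fr[OF f] xy n by simp
    have lt: "i < n" using t i y by simp
    have "runs p s' (\<lambda>t s''. t + 1 \<le> c + 1
        \<and> (\<exists>j < k. J j (s''(x := (s'' x)(0 := s'' x 0 + 1)))))"
    proof (rule runs_call[OF body[OF lt i(2,3) fr[OF f]]])
      fix t s'' assume a: "t \<le> c \<and> I (Suc i) (s''(x := (s'' x)(0 := 1 + int i)))"
        and g: "\<forall>y. y \<notin> writes p \<longrightarrow> s'' y = s' y"
      have "s'' x 0 = int i" using g xy i by simp
      with a i lt show "t + 1 \<le> c + 1 \<and> (\<exists>j < k. J j (s''(x := (s'' x)(0 := s'' x 0 + 1))))"
        unfolding J_def by (intro conjI exI[of _ "k - 1"] exI[of _ "Suc i"]) (auto simp: add.commute)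
    qed
    then show "runs (p ;; x ::= Add (V x) (Const 1)) s' (\<lambda>t s''. t \<le> c + 1 \<and> (\<exists>j < k. J j s''))"
      by (simp cong del: runs_weak_cong)
  next
    fix k' s' t assume J: "J k' s'" and nt: "\<not> test_val (Less (V x) (V y)) s'"
      and f: "\<forall>z. z \<notin> writes (p ;; x ::= Add (V x) (Const 1)) \<longrightarrow> s' z = s0 z"
      and t: "t \<le> n * (c + 1 + 1) + 1"
    have y: "s' y 0 = int n" using fr[OF f] xy n by simp
    have "I n s'" using J nt y by (auto simp: J_def)
    then show "Q (1 + t) s'" using fr[OF f] t by (intro fin) auto
  qed
  then show ?thesis by (simp add: For_def s0_def)
qed

lemma loop_bound:
  fixes \<tau> :: nat
  assumes "\<tau> \<le> n * (c + 2) + 2" "n \<le> n'" "c + 2 = d"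
  shows "\<tau> \<le> n' * d + 2"
proof -
  have "n * d \<le> n' * d" using assms(2) by (rule mult_right_mono) simp
  with assms(1) show ?thesis unfolding assms(3) by linarith
qed

section \<open>Evaluating guards and edges\<close>

text \<open>Linear search for the term whose code starts at address \<open>ad\<close>. The result
  \<open>id = nt\<close> signals that it is absent, so the same search serves both for building the
  table and for using it.\<close>

definition lookup :: prog where
  "lookup = (
     ''id'' ::= V ''nt'' ;;
     For ''i'' ''nt'' (
       ''eq'' ::= Const 1 ;;
       For ''q'' ''w1''
         (Cond (Same (Get ''in'' (Add (Get ''adr'' (V ''i'')) (V ''q''))) (Get ''in'' (Add (V ''ad'') (V ''q''))))
            Skip (''eq'' ::= Const 0)) ;;
       Cond (Less (Const 0) (V ''eq'')) (''id'' ::= V ''i'') Skip))"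

text \<open>
  The array \<open>rk\<close> holds the ranks given by the input valuation from position 0 and the candidate ranks
  from position \<open>nt\<close>; \<open>b\<close> is the offset of the ranks in use.
\<close>

definition scan :: prog where
  "scan = (
     ''c'' ::= Get ''in'' (V ''g'') ;;
     ''h'' ::= Add (V ''g'') (Const 1) ;;
     For ''j'' ''c'' (
       ''ad'' ::= Add (V ''h'') (Const 1) ;;
       lookup ;;
       ''x'' ::= Mul (Const 2) (Get ''rk'' (Add (V ''b'') (V ''id''))) ;;
       ''o'' ::= Get ''in'' (V ''h'') ;;
       Cond (Less (Const 1) (V ''o''))
         (''y'' ::= V ''x'' ;;
          Cond (Less (Const 3) (V ''o'')) (''y'' ::= Add (V ''x'') (Const 1)) Skip ;;
          Cond (Less (V ''lb'') (V ''y'')) (''lb'' ::= V ''y'') Skip)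
         Skip ;;
       Cond (Less (V ''o'') (Const 3))
         (''y'' ::= V ''x'' ;;
          Cond (Less (V ''o'') (Const 1)) (''y'' ::= Sub (V ''x'') (Const 1)) Skip ;;
          Cond (Less (V ''y'') (V ''ub'')) (''ub'' ::= V ''y'') Skip)
         Skip ;;
       ''h'' ::= Add (V ''h'') (V ''w'')))"

text \<open>The program for \<open>delta\<close>, started from the lower end \<open>lo\<close>.
  \<open>edge\<close> holds the address of the guard of the edge; such addresses are positive, so an
  untouched cell 0 means that there is no edge.\<close>

definition enab :: prog where
  "enab = (
     ''e'' ::= Add (Mul (V ''l'') (V ''na'')) (V ''a'') ;;
     ''en'' ::= Const 0 ;;
     Cond (Less (Const 0) (Get ''edge'' (V ''e'')))
       (''lb'' ::= V ''lo'' ;;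
        ''ub'' ::= V ''top'' ;;
        ''g'' ::= Get ''inv'' (V ''l'') ;; scan ;;
        ''g'' ::= Get ''edge'' (V ''e'') ;; scan ;;
        Cond (Less (V ''ub'') (V ''lb'')) Skip
          (Cond (Less (Const 0) (Get ''rst'' (V ''e'')))
             (''lb'' ::= Mul (Const 2) (Get ''rk'' (V ''b'')) ;; ''ub'' ::= V ''lb'') Skip ;;
           ''g'' ::= Get ''inv'' (Get ''tgt'' (V ''e'')) ;; scan ;;
           Cond (Less (V ''ub'') (V ''lb'')) Skip (''en'' ::= Const 1)))
       Skip)"

lemma writes_lookup [simp]: "writes lookup = {''id'', ''i'', ''eq'', ''q''}"
  by (auto simp: lookup_def)

lemma writes_scan [simp]:
  "writes scan = {''c'', ''h'', ''j'', ''ad'', ''id'', ''i'', ''eq'', ''q'', ''x'', ''o'', ''y'', ''lb'', ''ub''}"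
  by (auto simp: scan_def)

lemma writes_enab [simp]:
  "writes enab = {''e'', ''en'', ''g'', ''c'', ''h'', ''j'', ''ad'', ''id'', ''i'', ''eq'', ''q'', ''x'', ''o'', ''y'', ''lb'', ''ub''}"
  by (auto simp: enab_def)

section \<open>Codes of terms and guards as memory segments\<close>

definition seg :: "(int \<Rightarrow> int) \<Rightarrow> int \<Rightarrow> int list \<Rightarrow> bool" where
  "seg f p us \<longleftrightarrow> (\<forall>i < length us. f (p + int i) = us ! i)"

lemma seg_Nil [simp]: "seg f p []"
  by (simp add: seg_def)

lemma seg_Cons: "seg f p (u # us) \<longleftrightarrow> f p = u \<and> seg f (p + 1) us"
  by (fastforce simp: seg_def nth_Cons all_conj_distrib less_Suc_eq_0_disj ac_simps split: nat.splits)

lemma seg_append: "seg f p (us @ vs) \<longleftrightarrow> seg f p us \<and> seg f (p + int (length us)) vs"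
  by (induction us arbitrary: p) (auto simp: seg_Cons ac_simps)

lemma seg_concat_nth:
  assumes "seg f p (concat uss)" "j < length uss" "\<And>us. us \<in> set uss \<Longrightarrow> length us = w"
  shows "seg f (p + int j * int w) (uss ! j)"
  using assms
proof (induction uss arbitrary: p j)
  case (Cons us uss)
  then show ?case using Cons.IH[of "p + int w" "j - 1"]
    by (cases j) (auto simp: seg_append algebra_simps)
qed auto

definition tcode :: "'p list \<Rightarrow> 'p lterm \<Rightarrow> int list" where
  "tcode ps t = map (fst t) ps @ [snd t]"

lemma constraint_code_tcode: "constraint_code ps (c, t) = cmp_code c # tcode ps t"
  by (simp add: constraint_code_def tcode_def split: prod.splits)

lemma length_tcode [simp]: "length (tcode ps t) = length ps + 1"
  by (simp add: tcode_def)

definition guardat :: "'p list \<Rightarrow> (int \<Rightarrow> int) \<Rightarrow> int \<Rightarrow> 'p lterm guard \<Rightarrow> bool" where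
  "guardat ps f p g \<longleftrightarrow> (\<exists>us. code_guard ps g us \<and> seg f p us)"

lemma code_guardE:
  assumes "code_guard ps g us"
  obtains cs where "distinct cs" "set cs = g" "us = int (length cs) # concat (map (constraint_code ps) cs)"
proof -
  from assms obtain cs uss where *: "distinct cs" "set cs = g" "list_all2 (\<lambda>c ws. ws = constraint_code ps c) cs uss"
    "us = int (length cs) # concat uss"
    by (auto simp: code_guard_def code_set_def enumerates_def)
  have "uss = map (constraint_code ps) cs"
    using *(3) by (auto simp: list_all2_conv_all_nth intro: nth_equalityI)
  with * that show ?thesis by blast
qed

lemma guardatE:
  assumes "guardat ps f p g"
  obtains cs where "distinct cs" "set cs = g" "f p = int (length cs)"
    "\<forall>j < length cs. seg f (p + 1 + int j * (int (length ps) + 2)) (constraint_code ps (cs ! j))"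
proof -
  from assms obtain us where us: "code_guard ps g us" "seg f p us" by (auto simp: guardat_def)
  from us(1) obtain cs where cs: "distinct cs" "set cs = g" "us = int (length cs) # concat (map (constraint_code ps) cs)"
    by (rule code_guardE)
  have "seg f (p + 1 + int j * int (length ps + 2)) (map (constraint_code ps) cs ! j)" if "j < length cs" for j
    using us(2) cs(3) that
    by (intro seg_concat_nth) (auto simp: seg_Cons constraint_code_tcode split: prod.splits)
  then have "\<forall>j < length cs. seg f (p + 1 + int j * (int (length ps) + 2)) (constraint_code ps (cs ! j))"
    by (simp add: algebra_simps)
  moreover have "f p = int (length cs)" using us(2) cs(3) by (simp add: seg_Cons)
  ultimately show ?thesis using that cs by blast
qed

locale coded =
  fixes A :: "('l, 'a, 'p) pta" and ps :: "'p list" and ls :: "'l list" and acs :: "'a list"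
    and inp :: "int \<Rightarrow> int"
  assumes pta: "extended_1c_pta A" and det: "deterministic A"
    and ls: "distinct ls" "set ls = locs A" and acs: "distinct acs" "set acs = acts A"
    and ps: "distinct ps" "set ps = params A"
begin

abbreviation "m \<equiv> length ps"
text \<open>\<open>X\<close> bounds the number of terms including 0. The constants starting with
  \<open>T\<close> bound running times: \<open>TL\<close> of \<open>lookup\<close>,
  \<open>TS\<close> of \<open>scan\<close>, \<open>TE\<close> of \<open>enab\<close>,
  \<open>TV\<close> of \<open>visit\<close>, \<open>TP\<close> of \<open>process\<close>,
  \<open>TX\<close> of \<open>explore\<close>, \<open>TG\<close> of \<open>read_guard\<close>,
  \<open>TQ\<close> of \<open>parse\<close>, \<open>TR\<close> of \<open>rank_terms\<close>,
  \<open>TM\<close> of \<open>emit\<close> and \<open>TT\<close> of \<open>synth\<close>.\<close>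

definition "X = card (LT A) + 1"
definition "TL = X * (4 * m + 14) + 3"
definition "TS = 5 * X * (TL + 22) + 4"

definition base :: "memory \<Rightarrow> bool" where
  "base s \<longleftrightarrow> s ''in'' = inp \<and> s ''w1'' 0 = int m + 1 \<and> s ''w'' 0 = int m + 2"

text \<open>Index 0 is reserved for the zero term, so that its rank is found at \<open>rk[b]\<close>
  without a search.\<close>

definition interned :: "memory \<Rightarrow> 'p lterm list \<Rightarrow> bool" where
  "interned s ts \<longleftrightarrow> s ''nt'' 0 = int (length ts) \<and> distinct ts \<and> ts \<noteq> [] \<and> ts ! 0 = zterm
     \<and> set ts \<subseteq> terms A \<and> (\<forall>i < length ts. seg inp (s ''adr'' (int i)) (tcode ps (ts ! i)))"

lemma card_terms: "card (terms A) \<le> X"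
  using finite_LT[OF pta] by (simp add: terms_def X_def card_insert_if)

lemma length_interned: "interned s ts \<Longrightarrow> length ts \<le> X"
  using card_mono[OF finite_terms[OF pta], of "set ts"] card_terms
  by (auto simp: interned_def distinct_card)

text \<open>Coefficients outside the parameter set vanish, so the listed ones determine the term.
  Comparing codes is therefore comparing terms, and the table never exceeds \<open>X\<close>
  entries.\<close>

lemma tcode_inject:
  assumes "t \<in> terms A" "u \<in> terms A" "tcode ps t = tcode ps u"
  shows "t = u"
proof -
  have z: "fst t p = 0" if "t \<in> terms A" "p \<notin> params A" for t p
    using that pta by (cases t) (auto simp: extended_1c_pta_def terms_def zterm_def)
  have "fst t p = fst u p" for p
  proof (cases "p \<in> set ps")
    case True
    with assms(3) show ?thesis by (auto simp: tcode_def)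
  next
    case False
    with z assms ps show ?thesis by simp
  qed
  with assms(3) show ?thesis by (auto simp: tcode_def prod_eq_iff)
qed

lemma lookup:
  assumes "base s" "interned s ts" "seg inp (s ''ad'' 0) (tcode ps t)" "t \<in> terms A"
  shows "runs lookup s (\<lambda>\<tau> s'. \<tau> \<le> TL \<and>
    ((\<exists>i < length ts. s' ''id'' 0 = int i \<and> ts ! i = t) \<or> (s' ''id'' 0 = int (length ts) \<and> t \<notin> set ts)))"
  unfolding lookup_def runs_Seq runs_Put
proof (rule runs_For[where n = "length ts" and c = "4 * m + 9" and
      I = "\<lambda>i s'. if t \<in> set (take i ts) then \<exists>j < length ts. s' ''id'' 0 = int j \<and> ts ! j = t
                  else s' ''id'' 0 = int (length ts)"], goal_cases)
  case (6 i s')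
  have adr: "s' ''adr'' (int i) = s ''adr'' (int i)" "s' ''in'' = inp" "s' ''ad'' 0 = s ''ad'' 0" "s' ''w1'' 0 = int (m + 1)"
    using 6(4) assms(1) by (simp_all add: base_def)
  have si: "seg inp (s ''adr'' (int i)) (tcode ps (ts ! i))" "ts ! i \<in> terms A"
    using assms(2) 6(1) by (auto simp: interned_def)
  have q: "inp (s ''adr'' (int i) + int q) = tcode ps (ts ! i) ! q" "inp (s ''ad'' 0 + int q) = tcode ps t ! q" if "q < m + 1" for q
    using si(1) assms(3) that by (auto simp: seg_def)
  show ?case
    unfolding runs_Seq runs_Put
  proof (rule runs_For[where n = "m + 1" and c = 2 and
        I = "\<lambda>q s''. s'' ''eq'' 0 = (if \<forall>r < q. tcode ps (ts ! i) ! r = tcode ps t ! r then 1 else 0)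
             \<and> s'' ''i'' 0 = int i \<and> s'' ''id'' 0 = s' ''id'' 0"], goal_cases)
    case (6 r s'')
    then show ?case using q[OF 6(1)] adr \<open>s' ''i'' 0 = int i\<close> by (auto simp: less_Suc_eq ac_simps)
  next
    case (7 s'' \<tau>)
    have eq: "(\<forall>r < m + 1. tcode ps (ts ! i) ! r = tcode ps t ! r) \<longleftrightarrow> ts ! i = t"
      using tcode_inject[OF si(2) assms(4)] by (metis length_tcode nth_equalityI)
    have tk: "set (take (Suc i) ts) = insert (ts ! i) (set (take i ts))"
      using \<open>i < length ts\<close> by (simp add: take_Suc_conv_app_nth)
    show ?case using 7 eq tk \<open>i < length ts\<close> \<open>if t \<in> set (take i ts) then _ else _\<close> by (auto split: if_splits)
  qed (use adr \<open>s' ''i'' 0 = int i\<close> in auto)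
next
  case (7 s' \<tau>)
  have "length ts * (4 * m + 9 + 2) \<le> X * (4 * m + 9 + 2)"
    using length_interned[OF assms(2)] by (rule mult_right_mono) simp
  with 7(3) have "1 + \<tau> \<le> TL" by (simp add: TL_def algebra_simps)
  with 7(1) show ?case by (auto split: if_splits simp: in_set_conv_nth)
qed (use assms in \<open>auto simp: interned_def\<close>)

definition ranked_at :: "memory \<Rightarrow> 'p lterm list \<Rightarrow> int \<Rightarrow> ('p lterm \<Rightarrow> int) \<Rightarrow> bool" where
  "ranked_at s ts b R \<longleftrightarrow> (\<forall>i < length ts. s ''rk'' (b + int i) = R (ts ! i))"

text \<open>A guard is a set, hence has at most five constraints per term. This bounds the length of
  the input read for a guard by a function of \<open>X\<close>.\<close>

lemma card_guard:
  fixes g :: "'p lterm guard"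
  assumes "snd ` g \<subseteq> LT A"
  shows "card g \<le> 5 * X"
proof -
  have "g \<subseteq> {Lt, Le, Eq, Ge, Gt} \<times> LT A"
  proof
    fix x assume "x \<in> g"
    with assms show "x \<in> {Lt, Le, Eq, Ge, Gt} \<times> LT A" by (cases x; cases "fst x") auto
  qed
  then have "card g \<le> card ({Lt, Le, Eq, Ge, Gt} \<times> LT A)"
    using finite_LT[OF pta] by (intro card_mono) auto
  also have "\<dots> = 5 * card (LT A)" by (simp add: card_cartesian_product)
  finally show ?thesis by (simp add: X_def)
qed

text \<open>Each constraint cuts the interval from one side, or from both for \<open>Eq\<close>,
  whose code 2 is both above 1 and below 3. Strict comparisons move the bound by one because clock
  codes are integers. So intersecting with \<open>codes R g\<close> amounts to updating
  \<open>lb\<close> and \<open>ub\<close>.\<close>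

lemma scan:
  assumes "base s" "interned s ts" "set ts = terms A" "guardat ps inp (s ''g'' 0) g" "snd ` g \<subseteq> LT A" "ranked_at s ts (s ''b'' 0) R"
  shows "runs scan s (\<lambda>\<tau> s'. \<tau> \<le> TS \<and>
    {s' ''lb'' 0..s' ''ub'' 0} = {s ''lb'' 0..s ''ub'' 0} \<inter> codes R g)"
proof -
  from assms(4) obtain cs where cs: "distinct cs" "set cs = g" "inp (s ''g'' 0) = int (length cs)"
    "\<forall>j < length cs. seg inp (s ''g'' 0 + 1 + int j * (int m + 2)) (constraint_code ps (cs ! j))"
    by (rule guardatE)
  have b: "s ''in'' = inp" "s ''w'' 0 = int m + 2" using assms(1) by (simp_all add: base_def)
  show ?thesis
    unfolding scan_def runs_Seq runs_Put
  proof (rule runs_For[where n = "length cs" and c = "TL + 20" and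
        I = "\<lambda>j s'. s' ''h'' 0 = s ''g'' 0 + 1 + int j * (int m + 2)
          \<and> (\<forall>i. s' ''lb'' 0 \<le> i \<and> i \<le> s' ''ub'' 0 \<longleftrightarrow> s ''lb'' 0 \<le> i \<and> i \<le> s ''ub'' 0 \<and> i \<in> codes R (set (take j cs)))"], goal_cases)
    case (6 j s')
    obtain c t where ct: "cs ! j = (c, t)" by (metis prod.exhaust)
    have tg: "t \<in> LT A" using ct 6(1) cs(2) assms(5) by (metis image_subset_iff nth_mem snd_conv)
    then have tt: "t \<in> terms A" by (simp add: terms_def)
    have h: "inp (s' ''h'' 0) = cmp_code c" "seg inp (s' ''h'' 0 + 1) (tcode ps t)"
      using cs(4)[rule_format, OF 6(1)] 6(2) ct by (simp_all add: constraint_code_tcode seg_Cons)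
    have tk: "i \<in> codes R (set (take (Suc j) cs)) \<longleftrightarrow> i \<in> codes R (set (take j cs)) \<and> holds c i (2 * R t)" for i
      using 6(1) ct by (auto simp: take_Suc_conv_app_nth codes_def)
    define s1 where "s1 = s'(''ad'' := (s' ''ad'')(0 := s' ''h'' 0 + 1))"
    have s1: "base s1" "interned s1 ts" "seg inp (s1 ''ad'' 0) (tcode ps t)"
      using 6(4) assms(1,2) h by (simp_all add: s1_def base_def interned_def)
    have fr: "s' ''in'' = inp" "s' ''rk'' = s ''rk''" "s' ''b'' = s ''b''" "s' ''w'' 0 = int m + 2"
      using 6(4) b by simp_all
    show ?case
      unfolding runs_Seq runs_Put exp_val.simps s1_def[symmetric]
    proof (rule runs_call[OF lookup[OF s1 tt]], goal_cases)
      case (1 \<tau> s2)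
      then obtain i where i: "i < length ts" "s2 ''id'' 0 = int i" "ts ! i = t"
        using tt assms(3) by auto
      have fr2: "s2 ''in'' = inp" "s2 ''rk'' = s ''rk''" "s2 ''b'' = s ''b''" "s2 ''w'' 0 = int m + 2"
        "s2 ''h'' 0 = s' ''h'' 0" "s2 ''lb'' 0 = s' ''lb'' 0" "s2 ''ub'' 0 = s' ''ub'' 0"
        using 1(2) fr by (simp_all add: s1_def)
      have R: "s ''rk'' (s ''b'' 0 + int i) = R t" using assms(6) i by (auto simp: ranked_at_def)
      have lt: "\<tau> \<le> TL" using 1 by simp
      have g: "s ''lb'' 0 \<le> k \<and> k \<le> s ''ub'' 0 \<and> k \<in> codes R (set (take (Suc j) cs))
          \<longleftrightarrow> s' ''lb'' 0 \<le> k \<and> k \<le> s' ''ub'' 0 \<and> holds c k (2 * R t)" for k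
        using 6(2) tk by blast
      have hh: "s' ''h'' 0 + (int m + 2) = s ''g'' 0 + 1 + int (Suc j) * (int m + 2)"
        using 6(2) by (simp add: algebra_simps)
      show ?case
      proof (cases c)
        case Lt
        then show ?thesis using lt hh h(1) by (simp add: fr2 i R g) (auto simp: algebra_simps)
      next
        case Le
        then show ?thesis using lt hh h(1) by (simp add: fr2 i R g) (auto simp: algebra_simps)
      next
        case Eq
        then show ?thesis using lt hh h(1) by (simp add: fr2 i R g) (auto simp: algebra_simps)
      next
        case Ge
        then show ?thesis using lt hh h(1) by (simp add: fr2 i R g) (auto simp: algebra_simps)
      next
        case Gt
        then show ?thesis using lt hh h(1) by (simp add: fr2 i R g) (auto simp: algebra_simps)
      qed
    qed
  next
    case (7 s' \<tau>)
    have "length cs \<le> 5 * X" using card_guard[OF assms(5)] cs by (metis distinct_card)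
    then have "\<tau> \<le> 5 * X * (TL + 22) + 2" by (rule loop_bound[OF 7(3)]) simp
    then have "1 + 1 + \<tau> \<le> TS" by (simp add: TS_def)
    moreover have "{s' ''lb'' 0..s' ''ub'' 0} = {s ''lb'' 0..s ''ub'' 0} \<inter> codes R g"
      unfolding cs(2)[symmetric] using 7(1) by (auto simp: set_eq_iff)
    ultimately show ?case by simp
  qed (use cs b in \<open>auto simp: codes_def\<close>)
qed

definition "TE = 3 * TS + 20"

definition entry :: "int \<Rightarrow> int \<Rightarrow> int \<Rightarrow> ('p lterm guard \<times> bool \<times> 'l) option \<Rightarrow> bool" where
  "entry p q k x = (case x of None \<Rightarrow> p = 0
     | Some (g, r, l') \<Rightarrow> 0 < p \<and> guardat ps inp p g \<and> q = of_bool r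
         \<and> (\<exists>i < length ls. ls ! i = l' \<and> k = int i))"

abbreviation entry_at :: "memory \<Rightarrow> nat \<Rightarrow> nat \<Rightarrow> ('p lterm guard \<times> bool \<times> 'l) option \<Rightarrow> bool" where
  "entry_at s i j \<equiv> entry (s ''edge'' (int i * int (length acs) + int j))
     (s ''rst'' (int i * int (length acs) + int j)) (s ''tgt'' (int i * int (length acs) + int j))"

text \<open>Ranks in use are below \<open>length ts\<close>, so \<open>top\<close> is an odd code
  above all terms and plays the part of \<open>M\<close>; \<open>tt\<close> counts the codes from 0
  to \<open>top\<close> and is the base of the node numbering.\<close>

definition tables :: "memory \<Rightarrow> 'p lterm list \<Rightarrow> bool" where
  "tables s ts \<longleftrightarrow> base s \<and> interned s ts \<and> set ts = terms A
     \<and> s ''nl'' 0 = int (length ls) \<and> s ''na'' 0 = int (length acs) \<and> s ''np'' 0 = int m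
     \<and> s ''top'' 0 = 2 * int (length ts) - 1 \<and> s ''tt'' 0 = 2 * int (length ts)
     \<and> (\<exists>k < length ls. ls ! k = start A \<and> s ''start'' 0 = int k)
     \<and> (\<forall>i < length ls. guardat ps inp (s ''inv'' (int i)) (invar A (ls ! i)))
     \<and> (\<forall>i < length ls. \<forall>j < length acs.
          entry_at s i j (edge_opt A (ls ! i) (acs ! j)))"

abbreviation "table_vars \<equiv> {''in'', ''w1'', ''w'', ''nt'', ''adr'', ''nl'', ''na'', ''np'', ''top'', ''tt'', ''start'',
  ''inv'', ''edge'', ''rst'', ''tgt''}"

lemma tables_cong:
  assumes "tables s ts" "\<forall>y \<in> table_vars. s' y = s y"
  shows "tables s' ts"
  using assms by (simp add: tables_def base_def interned_def)

lemma tablesD: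
  assumes "tables s ts"
  shows "base s" "interned s ts" "set ts = terms A"
  using assms by (simp_all add: tables_def)

lemma tables_entry:
  assumes "tables s ts" "i < length ls" "j < length acs"
  shows "entry_at s i j (edge_opt A (ls ! i) (acs ! j))"
  using assms by (simp add: tables_def)

lemma edge_LT:
  assumes "edge_opt A l a = Some (g, r, l')"
  shows "snd ` g \<subseteq> LT A" "l' \<in> locs A"
proof -
  have e: "(l, g, a, r, l') \<in> edges A" using assms edge_opt_iff[OF det] by blast
  show "snd ` g \<subseteq> LT A" unfolding LT_def
    by (rule subsetI, rule UnI2, rule UN_I[OF e]) simp
  have "\<forall>(l, g, a, r, l') \<in> edges A. l' \<in> locs A"
    using pta unfolding extended_1c_pta_def by blast
  from bspec[OF this e] show "l' \<in> locs A" by simp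
qed

lemma invar_LT: "l \<in> locs A \<Longrightarrow> snd ` invar A l \<subseteq> LT A"
  by (auto simp: LT_def)

lemma delta_eq:
  assumes "edge_opt A l a = Some (g, r, l')" "{p..q} = succs A R M l lo g r l'"
  shows "delta A R M (l, lo, hi) a = (if p \<le> q then Some (l', p, q) else None)"
proof (cases "p \<le> q")
  case True
  then have "Min {p..q} = p" "Max {p..q} = q" by (auto intro: Min_eqI Max_eqI)
  moreover from True have "{p..q} \<noteq> {}" by simp
  ultimately show ?thesis using True assms(1) unfolding assms(2) by simp
next
  case False
  with assms show ?thesis by (simp add: Let_def)
qed

lemma scan_call:
  assumes "tables s ts" "guardat ps inp (s ''g'' 0) g" "snd ` g \<subseteq> LT A" "ranked_at s ts (s ''b'' 0) R"
    and "\<And>\<tau> s'. \<tau> \<le> TS \<Longrightarrow> {s' ''lb'' 0..s' ''ub'' 0} = {s ''lb'' 0..s ''ub'' 0} \<inter> codes R g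
      \<Longrightarrow> \<forall>y. y \<notin> writes scan \<longrightarrow> s' y = s y \<Longrightarrow> Q \<tau> s'"
  shows "runs scan s Q"
  by (rule runs_call[OF scan[OF tablesD[OF assms(1)] assms(2-4)]]) (use assms(5) in blast)

text \<open>The upper end \<open>hi\<close> is arbitrary because \<open>delta\<close> depends on the
  lower end only. Setting \<open>lo\<close> to an upper end thus tests deadness, setting it to a
  lower end computes a move.\<close>

lemma enab:
  assumes T: "tables s ts" and R: "ranked_at s ts (s ''b'' 0) R"
    and l: "s ''l'' 0 = int i" "i < length ls" and a: "s ''a'' 0 = int j" "j < length acs"
  shows "runs enab s (\<lambda>\<tau> s'. \<tau> \<le> TE \<and>
    (case delta A R (2 * int (length ts) - 1) (ls ! i, s ''lo'' 0, hi) (acs ! j) of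
       None \<Rightarrow> s' ''en'' 0 = 0
     | Some (l', p, q) \<Rightarrow> s' ''en'' 0 = 1 \<and> s' ''lb'' 0 = p \<and> s' ''ub'' 0 = q
         \<and> (\<exists>k < length ls. ls ! k = l' \<and> s' ''tgt'' (s' ''e'' 0) = int k)))"
proof (cases "edge_opt A (ls ! i) (acs ! j)")
  case None
  have "s ''edge'' (int i * int (length acs) + int j) = 0" "s ''na'' 0 = int (length acs)"
    using T tables_entry[OF T l(2) a(2)] by (simp_all add: tables_def None entry_def)
  then show ?thesis by (simp add: enab_def l a None TE_def)
next
  case (Some e)
  obtain g r l' where e: "e = (g, r, l')" by (metis prod_cases3)
  define M where "M = 2 * int (length ts) - 1"
  define ix where "ix = int i * int (length acs) + int j"
  have "entry (s ''edge'' ix) (s ''rst'' ix) (s ''tgt'' ix) (Some (g, r, l'))"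
    using tables_entry[OF T l(2) a(2)] unfolding ix_def Some e .
  then obtain k where k: "k < length ls" "ls ! k = l'" "s ''tgt'' ix = int k"
    and tab0: "0 < s ''edge'' ix" "guardat ps inp (s ''edge'' ix) g" "s ''rst'' ix = of_bool r"
    by (auto simp: entry_def)
  have tab1: "s ''na'' 0 = int (length acs)" "s ''top'' 0 = M"
    using T by (simp_all add: tables_def M_def)
  note tab = tab0 tab1
  have inv: "guardat ps inp (s ''inv'' (int i)) (invar A (ls ! i))" "guardat ps inp (s ''inv'' (int k)) (invar A l')"
    using T l k by (auto simp: tables_def)
  have LT: "snd ` invar A (ls ! i) \<subseteq> LT A" "snd ` g \<subseteq> LT A" "snd ` invar A l' \<subseteq> LT A"
    using invar_LT[of "ls ! i"] invar_LT[of l'] nth_mem[OF l(2)] edge_LT[OF Some[unfolded e]] ls(2) by simp_all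
  have z: "s ''rk'' (s ''b'' 0) = R zterm"
    using R tablesD(2)[OF T] by (force simp: ranked_at_def interned_def)
  note cong = tables_cong[OF T] 
  note eo = Some[unfolded e]
  define K where "K = {s ''lo'' 0..M} \<inter> codes R (invar A (ls ! i)) \<inter> codes R g"
  have sc: "succs A R M (ls ! i) (s ''lo'' 0) g r l' =
      (if r then (if K = {} then {} else {2 * R zterm}) else K) \<inter> codes R (invar A l')"
    by (simp add: succs_def K_def Let_def)
  have dl: "delta A R M (ls ! i, s ''lo'' 0, hi) (acs ! j) = (if p \<le> q then Some (l', p, q) else None)"
    if "{p..q} = succs A R M (ls ! i) (s ''lo'' 0) g r l'" for p q
    using delta_eq[OF eo that] .
  show ?thesis
    unfolding enab_def M_def[symmetric]
    apply (simp add: l a tab ix_def[symmetric])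
  proof (rule scan_call[where ts = ts and R = R and g = "invar A (ls ! i)"], goal_cases)
    case (5 t1 s1)
    have t1: "t1 \<le> TS" using 5(1) .
    have K1: "{s1 ''lb'' 0..s1 ''ub'' 0} = {s ''lo'' 0..M} \<inter> codes R (invar A (ls ! i))"
      using 5(2) by (simp add: tab)
    have fr1: "\<forall>y \<in> table_vars. s1 y = s y" "s1 ''rk'' = s ''rk''" "s1 ''b'' = s ''b''" "s1 ''e'' 0 = ix" "s1 ''en'' 0 = 0"
      using 5(3) by simp_all
    have fr1': "s1 ''edge'' = s ''edge''" using fr1(1) by simp
    show ?case
      apply (simp add: fr1 fr1')
    proof (rule scan_call[where ts = ts and R = R and g = g], goal_cases)
      case (5 t2 s2)
      have tm: "t1 \<le> TS" "t2 \<le> TS" using t1 5(1) .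
      have K: "{s2 ''lb'' 0..s2 ''ub'' 0} = K" using 5(2) by (simp add: K_def K1)
      have fr2: "\<forall>y \<in> table_vars. s2 y = s y" using 5(3) fr1(1) by simp
      have fr3: "s2 ''rk'' = s ''rk''" "s2 ''b'' = s ''b''" "s2 ''e'' 0 = ix" "s2 ''en'' 0 = 0"
        using 5(3) fr1 by simp_all
      have fr: "s2 ''rst'' = s ''rst''" "s2 ''tgt'' = s ''tgt''" "s2 ''inv'' = s ''inv''"
        using fr2 by simp_all
      note fr = fr fr3
      show ?case
      proof (cases "s2 ''ub'' 0 < s2 ''lb'' 0")
        case True
        then have "K = {}" using K by auto
        \<comment> \<open>The empty set is written as an interval so that \<open>dl\<close>
          applies.\<close>
        with sc have "{1..0} = succs A R M (ls ! i) (s ''lo'' 0) g r l'" by simp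
        from dl[OF this] True show ?thesis using tm by (simp add: fr TE_def)
      next
        case False
        then have "K \<noteq> {}" using K by auto
        with sc have sc: "succs A R M (ls ! i) (s ''lo'' 0) g r l' = (if r then {2 * R zterm} else K) \<inter> codes R (invar A l')"
          by simp
        show ?thesis
        proof (cases r)
          case True
          show ?thesis
            using False True apply (simp add: fr tab k)
          proof (rule scan_call[where ts = ts and R = R and g = "invar A l'"], goal_cases)
            case (5 t3 s3)
            then have "{s3 ''lb'' 0..s3 ''ub'' 0} = succs A R M (ls ! i) (s ''lo'' 0) g r l'"
              unfolding sc using True by (simp add: z)
            note d = dl[OF this]
            have "s3 ''tgt'' = s ''tgt''" "s3 ''e'' 0 = ix" "s3 ''en'' 0 = 0"
              using 5(5) by (simp_all add: fr)
            with d tm 5(3) k show ?case by (simp add: TE_def)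
          qed (use LT inv R fr2 in \<open>simp_all add: ranked_at_def fr cong\<close>)
        next
          case r: False
          show ?thesis
            using False r apply (simp add: fr tab k)
          proof (rule scan_call[where ts = ts and R = R and g = "invar A l'"], goal_cases)
            case (5 t3 s3)
            then have "{s3 ''lb'' 0..s3 ''ub'' 0} = succs A R M (ls ! i) (s ''lo'' 0) g r l'"
              unfolding sc using r by (simp add: K)
            note d = dl[OF this]
            have "s3 ''tgt'' = s ''tgt''" "s3 ''e'' 0 = ix" "s3 ''en'' 0 = 0"
              using 5(5) by (simp_all add: fr)
            with d tm 5(3) k show ?case by (simp add: TE_def)
          qed (use LT inv R fr2 in \<open>simp_all add: ranked_at_def fr cong\<close>)
        qed
      qed
    qed (use LT tab R fr1 in \<open>simp_all add: ranked_at_def cong\<close>)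
  qed (use LT inv R in \<open>simp_all add: ranked_at_def cong\<close>)
qed

end

section \<open>Exploring the product of two deterministic automata\<close>

text \<open>Used when \<open>p\<close> is a conditional assignment: its two outcomes are merged into
  one state \<open>u\<close>, so the continuation \<open>q\<close> is verified once instead of once
  per branch.\<close>

lemma runs_then:
  assumes "runs p s (\<lambda>\<tau> s'. \<tau> \<le> c \<and> s' = u)" "runs q u (\<lambda>\<tau> s'. \<tau> \<le> d \<and> P s')"
    and "\<And>\<tau> s'. P s' \<Longrightarrow> \<tau> \<le> c + d \<Longrightarrow> Q \<tau> s'"
  shows "runs (p ;; q) s Q"
  unfolding runs_Seq
  by (rule runs_call[OF assms(1)], clarify, rule runs_call[OF assms(2)], rule assms(3)) auto

declare delta.simps [simp del] dead.simps [simp del]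

text \<open>The array \<open>vis\<close> is never cleared: a node has been visited iff its entry equals the current \<open>stamp\<close>.\<close>

definition push :: prog where
  "push = (
     ''ix'' ::= Add (Mul (Add (Mul (Add (Mul (Add (Mul (V ''k'') (V ''tt'')) (V ''lb'')) (V ''tt'')) (V ''ub''))
                  (V ''tt'')) (V ''r2'')) (V ''tt'')) (V ''s2'') ;;
     Cond (Less (Get ''vis'' (V ''ix'')) (V ''stamp''))
       (Put ''vis'' (V ''ix'') (V ''stamp'') ;;
        Put ''ql'' (V ''tail'') (V ''k'') ;;
        Put ''qa'' (V ''tail'') (V ''lb'') ;;
        Put ''qb'' (V ''tail'') (V ''ub'') ;;
        Put ''qc'' (V ''tail'') (V ''r2'') ;;
        Put ''qd'' (V ''tail'') (V ''s2'') ;;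
        ''tail'' ::= Add (V ''tail'') (Const 1))
       Skip)"

text \<open>The candidate is evaluated first, as \<open>b\<close> still points to its ranks; its
  interval is saved in \<open>r2\<close> and \<open>s2\<close>, while the interval for the given
  valuation stays in \<open>lb\<close> and \<open>ub\<close>, where \<open>push\<close> expects
  it.\<close>

abbreviation compare_moves :: prog where
  "compare_moves \<equiv> (
     ''lo'' ::= V ''p2'' ;; enab ;;
     ''f'' ::= V ''en'' ;; ''r2'' ::= V ''lb'' ;; ''s2'' ::= V ''ub'' ;;
     ''b'' ::= Const 0 ;; ''lo'' ::= V ''p1'' ;; enab ;;
     Cond (Same (V ''f'') (V ''en''))
       (Cond (Less (Const 0) (V ''en'')) (''k'' ::= Get ''tgt'' (V ''e'') ;; push) Skip)
       (''ok'' ::= Const 0))"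

text \<open>
  The current node is \<open>(l, p1, q1, p2, q2)\<close>: location, lower and upper end for the given valuation,
  lower and upper end for the candidate ranks.
\<close>

definition visit :: prog where
  "visit = (
     ''b'' ::= Const 0 ;; ''lo'' ::= V ''q1'' ;; enab ;;
     Cond (Less (Const 0) (V ''en'')) (''d1'' ::= Const 0) Skip ;;
     ''b'' ::= V ''nt'' ;; ''lo'' ::= V ''q2'' ;; enab ;;
     Cond (Less (Const 0) (V ''en'')) (''d2'' ::= Const 0) Skip ;;
     compare_moves)"

text \<open>\<open>d1\<close> and \<open>d2\<close> remain 1 exactly if no action is possible from
  the respective upper end, so after the loop they say whether the two sides are dead.\<close>

definition process :: prog where
  "process = (
     ''l'' ::= Get ''ql'' (V ''head'') ;;
     ''p1'' ::= Get ''qa'' (V ''head'') ;;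
     ''q1'' ::= Get ''qb'' (V ''head'') ;;
     ''p2'' ::= Get ''qc'' (V ''head'') ;;
     ''q2'' ::= Get ''qd'' (V ''head'') ;;
     ''d1'' ::= Const 1 ;;
     ''d2'' ::= Const 1 ;;
     For ''a'' ''na'' visit ;;
     Cond (Same (V ''d1'') (V ''d2'')) Skip (''ok'' ::= Const 0) ;;
     ''head'' ::= Add (V ''head'') (Const 1))"

lemma writes_push [simp]:
  "writes push = {''ix'', ''vis'', ''ql'', ''qa'', ''qb'', ''qc'', ''qd'', ''tail''}"
  by (auto simp: push_def)

lemma writes_visit [simp]:
  "writes visit = {''b''} \<union> {''lo''} \<union> {''d1''} \<union> {''d2''} \<union> {''f''} \<union> {''r2''} \<union> {''s2''} \<union> {''k''} \<union> {''ok''}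
     \<union> writes enab \<union> writes push"
  by (simp only: visit_def writes.simps Un_ac Un_absorb Un_left_absorb Un_empty_left Un_empty_right)

lemmas writes_process [simp] = arg_cong[OF process_def, of writes, unfolded writes.simps writes_For]

section \<open>The queue of product nodes\<close>

type_synonym node = "int \<times> int \<times> int \<times> int \<times> int"

definition node_at :: "memory \<Rightarrow> int \<Rightarrow> node" where
  "node_at s i = (s ''ql'' i, s ''qa'' i, s ''qb'' i, s ''qc'' i, s ''qd'' i)"

definition nodes :: "memory \<Rightarrow> nat \<Rightarrow> node set" where
  "nodes s n = (\<lambda>i. node_at s (int i)) ` {..<n}"

text \<open>The location followed by four digits in base \<open>T\<close>, used as address in
  \<open>vis\<close>.\<close>

fun node_index :: "int \<Rightarrow> node \<Rightarrow> int" where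
  "node_index T (l, a, b, c, d) = (((l * T + a) * T + b) * T + c) * T + d"

lemma digit_inject:
  fixes T :: int
  assumes "x * T + a = y * T + b" "0 \<le> a" "a < T" "0 \<le> b" "b < T"
  shows "x = y \<and> a = b"
proof -
  have "(x * T + a) div T = x" "(y * T + b) div T = y" using assms(2-5) by (simp_all add: div_pos_pos_trivial)
  then have "x = y" using assms(1) by metis
  with assms(1) show ?thesis by simp
qed

definition node_range :: "nat \<Rightarrow> int \<Rightarrow> node set" where
  "node_range n T = {0..<int n} \<times> {0..<T} \<times> {0..<T} \<times> {0..<T} \<times> {0..<T}"

lemma node_index_inject:
  assumes "x \<in> node_range n T" "y \<in> node_range n T" "node_index T x = node_index T y"
  shows "x = y"
proof -
  obtain l a b c d l' a' b' c' d' where xy: "x = (l, a, b, c, d)" "y = (l', a', b', c', d')" by (metis prod_cases5)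
  show ?thesis
    using assms unfolding xy node_range_def by (auto dest!: digit_inject)
qed

lemma card_node_range: "card (node_range n (int T)) = n * T ^ 4"
  by (simp add: node_range_def card_cartesian_product power_eq_if)

text \<open>No entry of \<open>vis\<close> exceeds the stamp, so raising the stamp by one empties
  the set of visited nodes at unit cost.\<close>

definition queue :: "nat \<Rightarrow> int \<Rightarrow> memory \<Rightarrow> nat \<Rightarrow> bool" where
  "queue n T s k \<longleftrightarrow> s ''tail'' 0 = int k \<and> nodes s k \<subseteq> node_range n T
     \<and> (\<forall>i. s ''vis'' i \<le> s ''stamp'' 0)
     \<and> (\<forall>x \<in> node_range n T. s ''vis'' (node_index T x) = s ''stamp'' 0 \<longleftrightarrow> x \<in> nodes s k)
     \<and> inj_on (\<lambda>i. node_at s (int i)) {..<k}"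

text \<open>No node is queued twice, so the range of possible nodes bounds the queue, and thereby
  the number of rounds of the search.\<close>

lemma queue_bound:
  assumes "queue n (int T) s k"
  shows "k \<le> n * T ^ 4"
proof -
  have "card (nodes s k) = k" using assms by (simp add: queue_def nodes_def card_image)
  moreover have "card (nodes s k) \<le> card (node_range n (int T))"
    using assms by (intro card_mono) (auto simp: queue_def node_range_def)
  ultimately show ?thesis by (simp add: card_node_range)
qed

lemma push:
  assumes Q: "queue n (s ''tt'' 0) s k" and x: "x = (s ''k'' 0, s ''lb'' 0, s ''ub'' 0, s ''r2'' 0, s ''s2'' 0)" "x \<in> node_range n (s ''tt'' 0)"
  shows "runs push s (\<lambda>\<tau> s'. \<tau> \<le> 10 \<and> (\<exists>k'. queue n (s ''tt'' 0) s' k' \<and> k \<le> k' \<and> nodes s' k' = insert x (nodes s k)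
    \<and> (\<forall>i < k. node_at s' (int i) = node_at s (int i))))"
proof -
  define T where "T = s ''tt'' 0"
  define ix where "ix = node_index T x"
  have ix: "(((s ''k'' 0 * T + s ''lb'' 0) * T + s ''ub'' 0) * T + s ''r2'' 0) * T + s ''s2'' 0 = ix"
    by (simp add: ix_def x)
  have vis: "s ''vis'' ix \<le> s ''stamp'' 0" "s ''vis'' ix = s ''stamp'' 0 \<longleftrightarrow> x \<in> nodes s k"
    using Q x(2) by (simp_all add: queue_def T_def ix_def)
  show ?thesis
  proof (cases "x \<in> nodes s k")
    case True
    then have "nodes s k = insert x (nodes s k)" by blast
    with True vis Q show ?thesis
      by (auto simp: push_def T_def[symmetric] ix queue_def nodes_def node_at_def)
  next
    case False
    define s' where "s' = s(''ix'' := (s ''ix'')(0 := ix), ''vis'' := (s ''vis'')(ix := s ''stamp'' 0),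
      ''ql'' := (s ''ql'')(int k := s ''k'' 0), ''qa'' := (s ''qa'')(int k := s ''lb'' 0), ''qb'' := (s ''qb'')(int k := s ''ub'' 0),
      ''qc'' := (s ''qc'')(int k := s ''r2'' 0), ''qd'' := (s ''qd'')(int k := s ''s2'' 0), ''tail'' := (s ''tail'')(0 := int k + 1))"
    have old: "node_at s' (int i) = node_at s (int i)" if "i < k" for i
      using that by (simp add: node_at_def s'_def)
    have new: "node_at s' (int k) = x" by (simp add: node_at_def s'_def x)
    have nodes: "nodes s' (Suc k) = insert x (nodes s k)"
      using old new by (auto simp: nodes_def lessThan_Suc image_iff)
    have "inj_on (\<lambda>i. node_at s' (int i)) {..<Suc k}"
    proof -
      have "inj_on (\<lambda>i. node_at s' (int i)) {..<k} \<longleftrightarrow> inj_on (\<lambda>i. node_at s (int i)) {..<k}"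
        using old by (intro inj_on_cong) auto
      then have "inj_on (\<lambda>i. node_at s' (int i)) {..<k}" using Q by (simp add: queue_def)
      moreover have "(\<lambda>i. node_at s' (int i)) ` ({..<k} - {k}) = nodes s k" using old by (auto simp: nodes_def image_iff)
      ultimately show ?thesis using new False by (simp add: lessThan_Suc)
    qed
    moreover have "s' ''vis'' (node_index T y) = s' ''stamp'' 0 \<longleftrightarrow> y \<in> nodes s' (Suc k)" if "y \<in> node_range n T" for y
    proof -
      have "s' ''vis'' (node_index T y) = (if y = x then s ''stamp'' 0 else s ''vis'' (node_index T y))"
        using node_index_inject[OF that, of x] x(2) by (auto simp: s'_def ix_def T_def)
      moreover have "s' ''stamp'' 0 = s ''stamp'' 0" by (simp add: s'_def)
      ultimately show ?thesis using Q that by (auto simp: nodes queue_def T_def)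
    qed
    moreover have "\<forall>i. s' ''vis'' i \<le> s' ''stamp'' 0" using Q by (auto simp: queue_def s'_def)
    moreover have "nodes s' (Suc k) \<subseteq> node_range n T" using nodes x(2) Q by (auto simp: queue_def T_def)
    moreover have "s' ''tail'' 0 = int (Suc k)" by (simp add: s'_def)
    ultimately have "queue n T s' (Suc k)" unfolding queue_def by blast
    moreover have "runs push s (\<lambda>\<tau> t. \<tau> \<le> 10 \<and> t = s')"
    proof -
      have "s ''vis'' ix < s ''stamp'' 0" "s ''tail'' 0 = int k" using vis False Q by (simp_all add: queue_def less_le)
      then show ?thesis by (simp add: push_def T_def[symmetric] ix s'_def)
    qed
    ultimately show ?thesis
      unfolding T_def[symmetric]
      using nodes old by (elim runs_call) (auto intro!: exI[of _ "Suc k"])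
  qed
qed

section \<open>Processing one product node\<close>

context coded
begin

definition "TV = 4 * TE + 40"

text \<open>Old cells of the queue keep their contents, so facts about nodes already processed
  survive later insertions.\<close>

abbreviation extends :: "memory \<Rightarrow> nat \<Rightarrow> memory \<Rightarrow> node set \<Rightarrow> bool" where
  "extends s k s' Y \<equiv> \<exists>k'. queue (length ls) (s ''tt'' 0) s' k' \<and> k \<le> k' \<and> nodes s' k' = nodes s k \<union> Y
     \<and> (\<forall>n < k. node_at s' (int n) = node_at s (int n))"

lemma enab_call:
  assumes "tables s ts" "ranked_at s ts (s ''b'' 0) R"
    and "s ''l'' 0 = int i" "i < length ls" "s ''a'' 0 = int j" "j < length acs"
    and "\<And>\<tau> s'. \<tau> \<le> TE \<Longrightarrow>
      (case delta A R (2 * int (length ts) - 1) (ls ! i, s ''lo'' 0, hi) (acs ! j) of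
         None \<Rightarrow> s' ''en'' 0 = 0
       | Some (l', p, q) \<Rightarrow> s' ''en'' 0 = 1 \<and> s' ''lb'' 0 = p \<and> s' ''ub'' 0 = q
           \<and> (\<exists>k < length ls. ls ! k = l' \<and> s' ''tgt'' (s' ''e'' 0) = int k)) \<Longrightarrow>
      \<forall>y. y \<notin> writes enab \<longrightarrow> s' y = s y \<Longrightarrow> Q \<tau> s'"
  shows "runs enab s Q"
  by (rule runs_call[OF enab[OF assms(1-6)]]) (use assms(7) in blast)

text \<open>At most one node for each action; the set form treats a missing and an existing
  successor uniformly.\<close>

definition moves :: "int \<Rightarrow> ('p lterm \<Rightarrow> int) \<Rightarrow> ('p lterm \<Rightarrow> int) \<Rightarrow> node \<Rightarrow> 'a \<Rightarrow> node set" where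
  "moves M R S = (\<lambda>(l, a, b, c, d) act. {(int k, p, q, p', q') | k p q p' q'. k < length ls
     \<and> delta A R M (ls ! nat l, a, b) act = Some (ls ! k, p, q)
     \<and> delta A S M (ls ! nat l, c, d) act = Some (ls ! k, p', q')})"

lemma delta_range:
  assumes "delta A R M (l, lo, hi) a = Some (l', p, q)" "0 \<le> lo" "0 \<le> R zterm" "2 * R zterm < M"
  shows "0 \<le> p" "p \<le> M" "0 \<le> q" "q \<le> M"
proof -
  obtain g r where K: "{p..q} = succs A R M l lo g r l'" "p \<le> q" using delta_SomeD[OF det assms(1)] .
  have "succs A R M l lo g r l' \<subseteq> {0..M}"
    using assms(2-4) by (auto simp: succs_def Let_def split: if_splits)
  then have "{p..q} \<subseteq> {0..M}" unfolding K(1) .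
  then have "p \<in> {0..M}" "q \<in> {0..M}" using K(2) by auto
  then show "0 \<le> p" "p \<le> M" "0 \<le> q" "q \<le> M" by auto
qed

lemma visit:
  assumes T: "tables s ts" and RS: "ranked_at s ts 0 R" "ranked_at s ts (int (length ts)) S"
    and z: "0 \<le> R zterm" "2 * R zterm < M" "0 \<le> S zterm" "2 * S zterm < M"
    and l: "s ''l'' 0 = int i" "i < length ls" and a: "s ''a'' 0 = int j" "j < length acs"
    and M: "M = 2 * int (length ts) - 1"
    and Q: "queue (length ls) (s ''tt'' 0) s k"
    and pos: "0 \<le> s ''p1'' 0" "0 \<le> s ''p2'' 0"
    and dR: "dR = (\<lambda>x. delta A R M (ls ! i, x) (acs ! j))" and dS: "dS = (\<lambda>x. delta A S M (ls ! i, x) (acs ! j))"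
  shows "runs visit s (\<lambda>\<tau> s'. \<tau> \<le> TV
    \<and> s' ''d1'' 0 = (if dR (s ''q1'' 0, s ''q1'' 0) = None then s ''d1'' 0 else 0)
    \<and> s' ''d2'' 0 = (if dS (s ''q2'' 0, s ''q2'' 0) = None then s ''d2'' 0 else 0)
    \<and> s' ''ok'' 0 = (if dR (s ''p1'' 0, s ''q1'' 0) = None \<longleftrightarrow> dS (s ''p2'' 0, s ''q2'' 0) = None then s ''ok'' 0 else 0)
    \<and> extends s k s' (moves M R S (int i, s ''p1'' 0, s ''q1'' 0, s ''p2'' 0, s ''q2'' 0) (acs ! j)))"
proof -
  note cong = tables_cong[OF T]
  have nt: "s ''nt'' 0 = int (length ts)" "s ''tt'' 0 = M + 1" using T M by (simp_all add: tables_def interned_def)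
  define tv where "tv = insert ''rk'' table_vars"
  have cong: "tables t ts" if "\<forall>y \<in> tv. t y = s y" for t
    using that by (intro tables_cong[OF T]) (simp add: tv_def)
  have rk: "ranked_at t ts b R' \<longleftrightarrow> ranked_at s ts b R'" if "\<forall>y \<in> tv. t y = s y" for t b R'
    using that by (simp add: ranked_at_def tv_def)
  define P where "P s' \<longleftrightarrow> s' ''d1'' 0 = (if dR (s ''q1'' 0, s ''q1'' 0) = None then s ''d1'' 0 else 0)
    \<and> s' ''d2'' 0 = (if dS (s ''q2'' 0, s ''q2'' 0) = None then s ''d2'' 0 else 0)
    \<and> s' ''ok'' 0 = (if dR (s ''p1'' 0, s ''q1'' 0) = None \<longleftrightarrow> dS (s ''p2'' 0, s ''q2'' 0) = None then s ''ok'' 0 else 0)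
    \<and> extends s k s' (moves M R S (int i, s ''p1'' 0, s ''q1'' 0, s ''p2'' 0, s ''q2'' 0) (acs ! j))" for s'
  have "runs visit s (\<lambda>\<tau> s'. \<tau> \<le> TV \<and> P s')"
    unfolding visit_def
    apply (simp add: nt)
  proof (rule enab_call[where ts = ts and R = R and i = i and j = j and hi = "s ''q1'' 0"], goal_cases)
    case (7 t1 s1)
    define D1 where "D1 = dR (s ''q1'' 0, s ''q1'' 0)"
    have e1: "0 < s1 ''en'' 0 \<longleftrightarrow> D1 \<noteq> None"
      using 7(2) by (auto simp: D1_def dR M split: option.splits)
    have tv1: "\<forall>y \<in> tv. s1 y = s y" using 7(3) by (simp add: tv_def)
    have f1: "s1 ''nt'' 0 = int (length ts)" "s1 ''l'' 0 = int i" "s1 ''a'' 0 = int j"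
      "s1 ''q2'' = s ''q2''" "s1 ''d1'' = s ''d1''"
      using 7(3) nt l a by simp_all
    have g1: "\<forall>y \<in> {''d2'', ''p1'', ''q1'', ''p2'', ''ok'', ''stamp'', ''vis'', ''ql'', ''qa'', ''qb'', ''qc'', ''qd'', ''tail''}. s1 y = s y"
      using 7(3) by simp
    have t1: "t1 \<le> TE" using 7(1) .
    \<comment> \<open>The state after the conditional assignment, covering both of its branches;
      \<open>u2\<close> below does the same for the second test.\<close>
    define u1 where "u1 = (if D1 = None then s1 else s1(''d1'' := (s1 ''d1'')(0 := 0)))"
    have tu1: "\<forall>y \<in> tv. u1 y = s y" using tv1 by (simp add: u1_def tv_def)
    have fu1: "u1 ''nt'' 0 = int (length ts)" "u1 ''l'' 0 = int i" "u1 ''a'' 0 = int j"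
      "u1 ''q2'' = s ''q2''" "u1 ''d1'' 0 = (if D1 = None then s ''d1'' 0 else 0)"
      using f1 by (simp_all add: u1_def)
    have gu1: "\<forall>y \<in> {''d2'', ''p1'', ''q1'', ''p2'', ''ok'', ''stamp'', ''vis'', ''ql'', ''qa'', ''qb'', ''qc'', ''qd'', ''tail''}. u1 y = s y"
      using g1 by (simp add: u1_def)
    have "runs (''b'' ::= V ''nt'' ;; ''lo'' ::= V ''q2'' ;; enab ;;
     Cond (Less (Const 0) (V ''en'')) (''d2'' ::= Const 0) Skip ;;
     compare_moves) u1 (\<lambda>\<tau> s'. \<tau> \<le> 3 * TE + 36 \<and> P s')" (is "runs ?p u1 _")
      apply (simp add: fu1)
    proof (rule enab_call[where ts = ts and R = S and i = i and j = j and hi = "s ''q2'' 0"], goal_cases)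
      case (7 t2 s2)
      define D2 where "D2 = dS (s ''q2'' 0, s ''q2'' 0)"
      have e2: "0 < s2 ''en'' 0 \<longleftrightarrow> D2 \<noteq> None"
        using 7(2) by (auto simp: D2_def dS M split: option.splits)
      have tv2: "\<forall>y \<in> tv. s2 y = s y" using 7(3) tu1 by (simp add: tv_def)
      have f2: "s2 ''l'' 0 = int i" "s2 ''a'' 0 = int j" "s2 ''b'' 0 = int (length ts)" "s2 ''d2'' 0 = s ''d2'' 0" "s2 ''p2'' 0 = s ''p2'' 0"
        using 7(3) fu1 gu1 by simp_all
      have g2: "s2 ''d1'' 0 = u1 ''d1'' 0" "\<forall>y \<in> {''p1'', ''q1'', ''ok'', ''stamp'', ''vis'', ''ql'', ''qa'', ''qb'', ''qc'', ''qd'', ''tail''}. s2 y = s y"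
        using 7(3) gu1 by simp_all
      have t2: "t2 \<le> TE" using 7(1) .
      define u2 where "u2 = (if D2 = None then s2 else s2(''d2'' := (s2 ''d2'')(0 := 0)))"
      have tu2: "\<forall>y \<in> tv. u2 y = s y" using tv2 by (simp add: u2_def tv_def)
      have fu2: "u2 ''l'' 0 = int i" "u2 ''a'' 0 = int j" "u2 ''b'' 0 = int (length ts)"
        "u2 ''p2'' 0 = s ''p2'' 0" "u2 ''d2'' 0 = (if D2 = None then s ''d2'' 0 else 0)"
        using f2 by (simp_all add: u2_def)
      have gu2: "u2 ''d1'' 0 = u1 ''d1'' 0" "\<forall>y \<in> {''p1'', ''q1'', ''ok'', ''stamp'', ''vis'', ''ql'', ''qa'', ''qb'', ''qc'', ''qd'', ''tail''}. u2 y = s y"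
        using g2 by (simp_all add: u2_def)
      have "runs compare_moves u2 (\<lambda>\<tau> s'. \<tau> \<le> 2 * TE + 30 \<and> P s')" (is "runs ?p u2 _")
        apply (simp add: fu2)
      proof (rule enab_call[where ts = ts and R = S and i = i and j = j and hi = "s ''q2'' 0"], goal_cases)
        case (7 t3 s3)
        define D3 where "D3 = dS (s ''p2'' 0, s ''q2'' 0)"
        have e3: "case D3 of None \<Rightarrow> s3 ''en'' 0 = 0 | Some (l', p, q) \<Rightarrow> s3 ''en'' 0 = 1 \<and> s3 ''lb'' 0 = p \<and> s3 ''ub'' 0 = q"
          using 7(2) by (auto simp: D3_def dS M split: option.splits)
        have tv3: "\<forall>y \<in> tv. s3 y = s y" using 7(3) tu2 by (simp add: tv_def)
        have f3: "s3 ''l'' 0 = int i" "s3 ''a'' 0 = int j" "s3 ''p1'' 0 = s ''p1'' 0"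
          using 7(3) fu2 gu2 by simp_all
        have g3: "s3 ''d1'' 0 = u1 ''d1'' 0" "s3 ''d2'' 0 = u2 ''d2'' 0" "\<forall>y \<in> {''q1'', ''ok'', ''stamp'', ''vis'', ''ql'', ''qa'', ''qb'', ''qc'', ''qd'', ''tail''}. s3 y = s y"
          using 7(3) gu2 by simp_all
        have t3: "t3 \<le> TE" using 7(1) .
        show ?case
          apply (simp add: f3)
        proof (rule enab_call[where ts = ts and R = R and i = i and j = j and hi = "s ''q1'' 0"], goal_cases)
          case (7 t4 s4)
          define D4 where "D4 = dR (s ''p1'' 0, s ''q1'' 0)"
          have tv4: "\<forall>y \<in> tv. s4 y = s y" using 7(3) tv3 by (simp add: tv_def)
          have tt4: "s4 ''tt'' 0 = s ''tt'' 0" "s4 ''tgt'' = s ''tgt''" using tv4 by (simp_all add: tv_def)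
          have e4: "case D4 of None \<Rightarrow> s4 ''en'' 0 = 0 | Some (l', p, q) \<Rightarrow> s4 ''en'' 0 = 1 \<and> s4 ''lb'' 0 = p \<and> s4 ''ub'' 0 = q
              \<and> (\<exists>k < length ls. ls ! k = l' \<and> s ''tgt'' (s4 ''e'' 0) = int k)"
            using 7(2) unfolding D4_def dR M tt4(2) by (simp)
          have f4: "s4 ''f'' 0 = s3 ''en'' 0" "s4 ''r2'' 0 = s3 ''lb'' 0" "s4 ''s2'' 0 = s3 ''ub'' 0"
            using 7(3) by simp_all
          have g4: "s4 ''d1'' 0 = u1 ''d1'' 0" "s4 ''d2'' 0 = u2 ''d2'' 0" "\<forall>y \<in> {''ok'', ''stamp'', ''vis'', ''ql'', ''qa'', ''qb'', ''qc'', ''qd'', ''tail''}. s4 y = s y"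
            using 7(3) g3 by simp_all
          have t4: "t4 \<le> TE" using 7(1) .
          have ok4: "s4 ''ok'' 0 = s ''ok'' 0" using g4 by simp
          have qc: "queue (length ls) (s ''tt'' 0) t k" "nodes t k = nodes s k" "\<forall>n. node_at t n = node_at s n"
            if "\<forall>y \<in> {''stamp'', ''vis'', ''ql'', ''qa'', ''qb'', ''qc'', ''qd'', ''tail''}. t y = s y" for t
            using Q that by (simp_all add: queue_def nodes_def node_at_def)
          have mv: "moves M R S (int i, s ''p1'' 0, s ''q1'' 0, s ''p2'' 0, s ''q2'' 0) (acs ! j)
              = {(int k, p, q, p', q') | k p q p' q'. k < length ls \<and> D4 = Some (ls ! k, p, q) \<and> D3 = Some (ls ! k, p', q')}"
            by (simp add: moves_def D3_def D4_def dR dS)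
          \<comment> \<open>Serves both outcomes in which nothing is pushed: disagreement on the
            action, and an action impossible on both sides.\<close>
          have Pk: "P t" if "queue (length ls) (s ''tt'' 0) t k" "nodes t k = nodes s k" "\<forall>n. node_at t n = node_at s n"
              "moves M R S (int i, s ''p1'' 0, s ''q1'' 0, s ''p2'' 0, s ''q2'' 0) (acs ! j) = {}"
              "t ''d1'' 0 = u1 ''d1'' 0" "t ''d2'' 0 = u2 ''d2'' 0"
              "t ''ok'' 0 = (if D3 = None \<longleftrightarrow> D4 = None then s ''ok'' 0 else 0)" for t
          proof -
            have "queue (length ls) (s ''tt'' 0) t k \<and> k \<le> k
              \<and> nodes t k = nodes s k \<union> moves M R S (int i, s ''p1'' 0, s ''q1'' 0, s ''p2'' 0, s ''q2'' 0) (acs ! j)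
              \<and> (\<forall>n < k. node_at t (int n) = node_at s (int n))"
              using that(1-3) unfolding that(4) by simp
            moreover have "(dR (s ''p1'' 0, s ''q1'' 0) = None \<longleftrightarrow> dS (s ''p2'' 0, s ''q2'' 0) = None) = (D3 = None \<longleftrightarrow> D4 = None)"
              unfolding D3_def D4_def by blast
            ultimately show ?thesis
              unfolding P_def that(5-7) fu1(5) fu2(5) D1_def D2_def by metis
          qed
          show ?case
          proof (cases "D3 = None \<longleftrightarrow> D4 = None")
            case False
            then have ne: "s4 ''f'' 0 < s4 ''en'' 0 \<or> s4 ''en'' 0 < s4 ''f'' 0"
              using e3 e4 f4 by (auto split: option.splits)
            have mv0: "moves M R S (int i, s ''p1'' 0, s ''q1'' 0, s ''p2'' 0, s ''q2'' 0) (acs ! j) = {}"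
              using False unfolding mv by auto
            have q0: "queue (length ls) (s ''tt'' 0) (s4(''ok'' := (s4 ''ok'')(0 := 0))) k"
              "nodes (s4(''ok'' := (s4 ''ok'')(0 := 0))) k = nodes s k"
              "\<forall>n. node_at (s4(''ok'' := (s4 ''ok'')(0 := 0))) n = node_at s n"
              by (rule qc, use g4(3) in simp)+
            have "P (s4(''ok'' := (s4 ''ok'')(0 := 0)))"
              by (rule Pk[OF q0 mv0]) (simp_all only: if_not_P[OF False], simp_all add: g4(1,2))
            with ne t3 t4 show ?thesis by auto
          next
            case same: True
            show ?thesis
            proof (cases "D3 = None")
              case True
              then have D: "D3 = None" "D4 = None" using same by auto
              then have en: "s4 ''f'' 0 = 0" "s4 ''en'' 0 = 0"
                using e3 e4 f4 by auto
              have mv0: "moves M R S (int i, s ''p1'' 0, s ''q1'' 0, s ''p2'' 0, s ''q2'' 0) (acs ! j) = {}"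
                using D unfolding mv by auto
              have q0: "queue (length ls) (s ''tt'' 0) s4 k" "nodes s4 k = nodes s k" "\<forall>n. node_at s4 n = node_at s n"
                by (rule qc, use g4(3) in simp)+
              have "P s4"
                by (rule Pk[OF q0 mv0]) (simp_all only: if_P[OF same] g4(1,2) ok4)
              with en t3 t4 show ?thesis by simp
            next
              case False
              then obtain l3 p3 q3 l4 p4 q4 where D: "D3 = Some (l3, p3, q3)" "D4 = Some (l4, p4, q4)"
                using same by (metis option.exhaust prod_cases3)
              \<comment> \<open>Both sides follow the same edge, so a single location suffices in
                the new node.\<close>
              have "l3 = l4"
                using delta_loc[of A S M "(ls ! i, s ''p2'' 0, s ''q2'' 0)" "acs ! j" "(l3, p3, q3)" R "(ls ! i, s ''p1'' 0, s ''q1'' 0)" "(l4, p4, q4)"] D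
                by (simp add: D3_def D4_def dR dS)
              obtain h where h: "h < length ls" "ls ! h = l4" "s ''tgt'' (s4 ''e'' 0) = int h"
                and e: "s4 ''en'' 0 = 1" "s4 ''lb'' 0 = p4" "s4 ''ub'' 0 = q4" "s4 ''f'' 0 = 1" "s4 ''r2'' 0 = p3" "s4 ''s2'' 0 = q3"
                using e3 e4 f4 D by auto
              define x where "x = (int h, p4, q4, p3, q3)"
              have mvx: "moves M R S (int i, s ''p1'' 0, s ''q1'' 0, s ''p2'' 0, s ''q2'' 0) (acs ! j) = {x}"
                unfolding mv x_def using D h \<open>l3 = l4\<close> ls(1) by (auto simp: nth_eq_iff_index_eq)
              have r: "0 \<le> p4" "p4 \<le> M" "0 \<le> q4" "q4 \<le> M" "0 \<le> p3" "p3 \<le> M" "0 \<le> q3" "q3 \<le> M"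
                using delta_range[of R M "ls ! i" "s ''p1'' 0" "s ''q1'' 0" "acs ! j" l4 p4 q4] D pos z
                  delta_range[of S M "ls ! i" "s ''p2'' 0" "s ''q2'' 0" "acs ! j" l3 p3 q3]
                by (simp_all add: D3_def D4_def dR dS)
              define u4 where "u4 = s4(''k'' := (s4 ''k'')(0 := int h))"
              have xr: "x \<in> node_range (length ls) (u4 ''tt'' 0)"
                using r h tt4 nt by (simp add: node_range_def x_def u4_def)
              have x4: "x = (u4 ''k'' 0, u4 ''lb'' 0, u4 ''ub'' 0, u4 ''r2'' 0, u4 ''s2'' 0)"
                by (simp add: u4_def x_def e)
              have q4: "queue (length ls) (s ''tt'' 0) u4 k" "nodes u4 k = nodes s k" "\<forall>n. node_at u4 n = node_at s n"
                by (rule qc, use g4(3) in \<open>simp add: u4_def\<close>)+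
              have q4': "queue (length ls) (u4 ''tt'' 0) u4 k" using q4(1) tt4 by (simp add: u4_def)
              have "runs push u4 (\<lambda>\<tau> s'. \<tau> \<le> 10 \<and> P s')"
              proof (rule runs_call[OF push[OF q4' x4 xr]], goal_cases)
                case (1 \<tau> s')
                have "u4 ''tt'' 0 = s ''tt'' 0" using tt4 by (simp add: u4_def)
                moreover have "s' ''d1'' = s4 ''d1''" "s' ''d2'' = s4 ''d2''" "s' ''ok'' = s4 ''ok''"
                  using 1(2) by (simp_all add: u4_def)
                ultimately show ?case using 1(1) unfolding P_def mvx
                  by (simp add: g4(1,2) ok4 fu1 fu2 D1_def[symmetric] D2_def[symmetric] D3_def[symmetric] D4_def[symmetric] D q4)
              qed
              then show ?thesis
                apply (simp add: e tt4 h u4_def[symmetric])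
                apply (erule runs_call)
                using t3 t4 by simp
            qed
          qed
        qed (use tv3 cong[of "s3(''f'' := (s3 ''f'')(0 := s3 ''en'' 0), ''r2'' := (s3 ''r2'')(0 := s3 ''lb'' 0),
              ''s2'' := (s3 ''s2'')(0 := s3 ''ub'' 0), ''b'' := (s3 ''b'')(0 := 0), ''lo'' := (s3 ''lo'')(0 := s ''p1'' 0))"]
            rk[of "s3(''f'' := (s3 ''f'')(0 := s3 ''en'' 0), ''r2'' := (s3 ''r2'')(0 := s3 ''lb'' 0),
              ''s2'' := (s3 ''s2'')(0 := s3 ''ub'' 0), ''b'' := (s3 ''b'')(0 := 0), ''lo'' := (s3 ''lo'')(0 := s ''p1'' 0))"]
            RS f3 l a in \<open>simp_all add: tv_def\<close>)
      qed (use tu2 cong[of "u2(''lo'' := (u2 ''lo'')(0 := s ''p2'' 0))"]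
            rk[of "u2(''lo'' := (u2 ''lo'')(0 := s ''p2'' 0))"]
            RS fu2 l a in \<open>simp_all add: tv_def\<close>)
      then show ?case
        by (rule runs_then[where u = u2 and c = 2, rotated]) (use t2 e2 in \<open>auto simp: u2_def\<close>)
    qed (use tu1 cong[of "u1(''b'' := (u1 ''b'')(0 := int (length ts)), ''lo'' := (u1 ''lo'')(0 := s ''q2'' 0))"]
            rk[of "u1(''b'' := (u1 ''b'')(0 := int (length ts)), ''lo'' := (u1 ''lo'')(0 := s ''q2'' 0))"]
            RS fu1 l a in \<open>simp_all add: tv_def\<close>)
    then show ?case
      by (rule runs_then[where u = u1 and c = 2, rotated]) (use t1 e1 in \<open>auto simp: u1_def TV_def\<close>)
  qed (use T RS l a in \<open>auto simp: ranked_at_def intro!: tables_cong[OF T]\<close>)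
  then show ?thesis unfolding P_def .
qed

end

section \<open>The search from the initial node\<close>

definition start_ok :: prog where
  "start_ok = (
     ''lb'' ::= Mul (Const 2) (Get ''rk'' (V ''b'')) ;; ''ub'' ::= V ''lb'' ;;
     ''g'' ::= Get ''inv'' (V ''start'') ;; scan ;;
     Cond (Less (V ''ub'') (V ''lb'')) (''en'' ::= Const 0) (''en'' ::= Const 1))"

definition seed :: prog where
  "seed =
     Cond (Same (V ''f'') (V ''en''))
       (Cond (Less (Const 0) (V ''en''))
          (''r2'' ::= V ''lb'' ;; ''s2'' ::= V ''ub'' ;;
           ''lb'' ::= Mul (Const 2) (Get ''rk'' (Const 0)) ;; ''ub'' ::= V ''lb'' ;;
           ''k'' ::= V ''start'' ;; push)
          Skip)
       (''ok'' ::= Const 0)"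

definition explore :: prog where
  "explore = (
     ''stamp'' ::= Add (V ''stamp'') (Const 1) ;;
     ''ok'' ::= Const 1 ;; ''head'' ::= Const 0 ;; ''tail'' ::= Const 0 ;;
     ''b'' ::= Const 0 ;; start_ok ;; ''f'' ::= V ''en'' ;;
     ''b'' ::= V ''nt'' ;; start_ok ;; seed ;;
     While (Less (V ''head'') (V ''tail'')) process)"

lemmas writes_start_ok [simp] = arg_cong[OF start_ok_def, of writes, unfolded writes.simps]
lemmas writes_seed [simp] = arg_cong[OF seed_def, of writes, unfolded writes.simps]
lemmas writes_explore [simp] = arg_cong[OF explore_def, of writes, unfolded writes.simps]

lemma if_nest: "(if q then (if p then x else y) else y) = (if q \<and> p then x else y)"
  by simp

context coded
begin

definition "TP = length acs * (TV + 2) + 20"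

text \<open>Reduces the quantifiers over the whole action type in \<open>dead\<close> and
  \<open>agree\<close> to the loop over the listed actions.\<close>

lemma delta_acts: "a \<notin> acts A \<Longrightarrow> delta A R M q a = None"
proof -
  assume a: "a \<notin> acts A"
  have e: "\<forall>(l, g, a, r, l') \<in> edges A. a \<in> acts A"
    using pta unfolding extended_1c_pta_def by blast
  have "edge_opt A l a = None" for l
    using a e by (fastforce simp: edge_opt_None)
  then show ?thesis by (cases q) (simp add: delta.simps)
qed

lemma all_acts: "(\<forall>a. delta A R M q a = None \<longleftrightarrow> delta A S M q' a = None)
  \<longleftrightarrow> (\<forall>j < length acs. delta A R M q (acs ! j) = None \<longleftrightarrow> delta A S M q' (acs ! j) = None)"
  using delta_acts acs by (metis in_set_conv_nth)

lemma dead_acts: "dead A R M (l, lo, hi) \<longleftrightarrow> (\<forall>j < length acs. delta A R M (l, hi, hi) (acs ! j) = None)"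
  unfolding dead.simps using delta_acts acs by (metis in_set_conv_nth)

fun agrees :: "int \<Rightarrow> ('p lterm \<Rightarrow> int) \<Rightarrow> ('p lterm \<Rightarrow> int) \<Rightarrow> node \<Rightarrow> bool" where
  "agrees M R S (l, x) = agree A M R S (ls ! nat l) x"

lemma queue_cong:
  assumes "\<forall>y \<in> {''stamp'', ''vis'', ''ql'', ''qa'', ''qb'', ''qc'', ''qd'', ''tail''}. t y = s y"
  shows "queue n T t k \<longleftrightarrow> queue n T s k" "nodes t k = nodes s k" "node_at t i = node_at s i"
  using assms by (simp_all add: queue_def nodes_def node_at_def)

lemma process:
  assumes T: "tables s ts" and RS: "ranked_at s ts 0 R" "ranked_at s ts (int (length ts)) S"
    and z: "0 \<le> R zterm" "2 * R zterm < M" "0 \<le> S zterm" "2 * S zterm < M"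
    and M: "M = 2 * int (length ts) - 1"
    and Q: "queue (length ls) (s ''tt'' 0) s k" and h: "s ''head'' 0 = int h" "h < k"
    and x: "x = node_at s (int h)"
  shows "runs process s (\<lambda>\<tau> s'. \<tau> \<le> TP \<and> s' ''head'' 0 = int (Suc h)
    \<and> s' ''ok'' 0 = (if agrees M R S x then s ''ok'' 0 else 0)
    \<and> extends s k s' (\<Union>j < length acs. moves M R S x (acs ! j)))"
proof -
  have xr: "x \<in> node_range (length ls) (s ''tt'' 0)"
    using Q h x by (auto simp: queue_def nodes_def)
  obtain i a b c d where xx: "x = (int i, a, b, c, d)" and i: "i < length ls" and pos: "0 \<le> a" "0 \<le> c"
    using xr by (auto simp: node_range_def dest: nonneg_int_cases) (metis nonneg_int_cases of_nat_less_iff)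
  have xs: "s ''ql'' (int h) = int i" "s ''qa'' (int h) = a" "s ''qb'' (int h) = b" "s ''qc'' (int h) = c" "s ''qd'' (int h) = d"
    using x xx by (simp_all add: node_at_def)
  define P where "P j s' \<longleftrightarrow>
      s' ''d1'' 0 = (if \<forall>j' < j. delta A R M (ls ! i, b, b) (acs ! j') = None then 1 else 0)
    \<and> s' ''d2'' 0 = (if \<forall>j' < j. delta A S M (ls ! i, d, d) (acs ! j') = None then 1 else 0)
    \<and> s' ''ok'' 0 = (if \<forall>j' < j. delta A R M (ls ! i, a, b) (acs ! j') = None \<longleftrightarrow> delta A S M (ls ! i, c, d) (acs ! j') = None
         then s ''ok'' 0 else 0)
    \<and> extends s k s' (\<Union>j' < j. moves M R S x (acs ! j'))" for j s'
  define s1 where "s1 = s(''l'' := (s ''l'')(0 := int i), ''p1'' := (s ''p1'')(0 := a), ''q1'' := (s ''q1'')(0 := b),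
    ''p2'' := (s ''p2'')(0 := c), ''q2'' := (s ''q2'')(0 := d), ''d1'' := (s ''d1'')(0 := 1), ''d2'' := (s ''d2'')(0 := 1))"
  have P_cong: "P j (t(''a'' := y)) \<longleftrightarrow> P j t" for j t y
    unfolding P_def using queue_cong[of "t(''a'' := y)" t] by simp
  have P0: "P 0 s1"
  proof -
    have "queue (length ls) (s ''tt'' 0) s1 k" "nodes s1 k = nodes s k" "\<forall>n. node_at s1 n = node_at s n"
      using Q queue_cong[of s1 s] by (simp_all add: s1_def)
    moreover have "s1 ''d1'' 0 = 1" "s1 ''d2'' 0 = 1" "s1 ''ok'' 0 = s ''ok'' 0" by (simp_all add: s1_def)
    ultimately show ?thesis by (auto simp: P_def)
  qed
  have na: "s1 ''na'' 0 = int (length acs)" using T by (simp add: s1_def tables_def)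
  have tv1: "\<forall>y \<in> insert ''rk'' table_vars. s1 y = s y" by (simp add: s1_def)
  have loop: "runs (For ''a'' ''na'' visit) s1 (\<lambda>\<tau> s'. \<tau> \<le> length acs * (TV + 2) + 2 \<and> P (length acs) s' \<and> s' ''head'' 0 = int h)"
  proof (rule runs_For[where n = "length acs" and c = TV and I = P], goal_cases)
    case (6 j s2)
    have tv2: "\<forall>y \<in> insert ''rk'' table_vars. s2 y = s y" using 6(4) tv1 by simp
    have tt2: "s2 ''tt'' 0 = s ''tt'' 0" using tv2 by simp
    have T2: "tables s2 ts" using tables_cong[OF T] tv2 by simp
    have R2: "ranked_at s2 ts 0 R" "ranked_at s2 ts (int (length ts)) S"
      using RS tv2 by (simp_all add: ranked_at_def)
    have f2: "s2 ''l'' 0 = int i" "s2 ''p1'' 0 = a" "s2 ''q1'' 0 = b" "s2 ''p2'' 0 = c" "s2 ''q2'' 0 = d"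
      using 6(4) by (simp_all add: s1_def)
    note c2 = conjunct1[OF 6(2)[unfolded P_def]] conjunct1[OF conjunct2[OF 6(2)[unfolded P_def]]]
      conjunct1[OF conjunct2[OF conjunct2[OF 6(2)[unfolded P_def]]]]
    from 6(2) obtain k' where k': "queue (length ls) (s2 ''tt'' 0) s2 k'" "k \<le> k'"
      "nodes s2 k' = nodes s k \<union> (\<Union>j' < j. moves M R S x (acs ! j'))"
      "\<forall>n < k. node_at s2 (int n) = node_at s (int n)"
      by (auto simp: P_def tt2)
    have pos2: "0 \<le> s2 ''p1'' 0" "0 \<le> s2 ''p2'' 0" using pos f2 by simp_all
    show ?case
    proof (rule runs_call[OF visit[OF T2 R2 z f2(1) i 6(3,1) M k'(1) pos2 refl refl]], goal_cases)
      case (1 t s3)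
      then obtain k3 where k3: "queue (length ls) (s2 ''tt'' 0) s3 k3" "k' \<le> k3"
        "nodes s3 k3 = nodes s2 k' \<union> moves M R S x (acs ! j)"
        "\<forall>n < k'. node_at s3 (int n) = node_at s2 (int n)"
        by (auto simp: f2 xx)
      note c3 = conjunct1[OF conjunct2[OF 1(1)]] conjunct1[OF conjunct2[OF conjunct2[OF 1(1)]]]
        conjunct1[OF conjunct2[OF conjunct2[OF conjunct2[OF 1(1)]]]]
      note c3 = c3[unfolded f2]
      have "\<exists>k''. queue (length ls) (s ''tt'' 0) s3 k'' \<and> k \<le> k''
        \<and> nodes s3 k'' = nodes s k \<union> (\<Union>j' < Suc j. moves M R S x (acs ! j'))
        \<and> (\<forall>n < k. node_at s3 (int n) = node_at s (int n))"
        using k3 k' by (intro exI[of _ k3]) (auto simp: tt2 lessThan_Suc)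
      moreover have "s3 ''d1'' 0 = (if \<forall>j' < Suc j. delta A R M (ls ! i, b, b) (acs ! j') = None then 1 else 0)"
        unfolding c3(1) c2(1) All_less_Suc by (rule if_nest)
      moreover have "s3 ''d2'' 0 = (if \<forall>j' < Suc j. delta A S M (ls ! i, d, d) (acs ! j') = None then 1 else 0)"
        unfolding c3(2) c2(2) All_less_Suc by (rule if_nest)
      moreover have "s3 ''ok'' 0 = (if \<forall>j' < Suc j. delta A R M (ls ! i, a, b) (acs ! j') = None
          \<longleftrightarrow> delta A S M (ls ! i, c, d) (acs ! j') = None then s ''ok'' 0 else 0)"
        unfolding c3(3) c2(3) All_less_Suc by (rule if_nest)
      ultimately have "P (Suc j) s3" unfolding P_def by blast
      then show ?case using 1(1) by (simp add: P_cong)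
    qed
  next
    case (7 s' \<tau>)
    have "s' ''head'' 0 = s1 ''head'' 0" using 7(2) by simp
    with 7 h show ?case by (simp add: s1_def)
  qed (use na P0 in \<open>simp_all add: P_cong\<close>)
  show ?thesis
    unfolding process_def
    apply (simp add: h xs s1_def[symmetric] split del: if_split)
  proof (rule runs_call[OF loop], goal_cases)
    case (1 t s2)
    have dd: "dead A R M (ls ! i, a, b) \<longleftrightarrow> s2 ''d1'' 0 = 1" "dead A S M (ls ! i, c, d) \<longleftrightarrow> s2 ''d2'' 0 = 1"
      "s2 ''d1'' 0 \<in> {0, 1}" "s2 ''d2'' 0 \<in> {0, 1}"
      using 1(1) by (simp_all add: P_def dead_acts)
    have ag: "agrees M R S x \<longleftrightarrow> s2 ''d1'' 0 = s2 ''d2'' 0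
        \<and> (\<forall>j < length acs. delta A R M (ls ! i, a, b) (acs ! j) = None \<longleftrightarrow> delta A S M (ls ! i, c, d) (acs ! j) = None)"
      unfolding xx using dd by (simp add: all_acts) force
    from 1(1) obtain k' where k': "queue (length ls) (s ''tt'' 0) s2 k'" "k \<le> k'"
      "nodes s2 k' = nodes s k \<union> (\<Union>j' < length acs. moves M R S x (acs ! j'))"
      "\<forall>n < k. node_at s2 (int n) = node_at s (int n)"
      by (auto simp: P_def)
    have ok: "s2 ''ok'' 0 = (if \<forall>j < length acs. delta A R M (ls ! i, a, b) (acs ! j) = None \<longleftrightarrow> delta A S M (ls ! i, c, d) (acs ! j) = None
         then s ''ok'' 0 else 0)"
      using 1(1) by (simp add: P_def)
    have hd: "s2 ''head'' 0 = int h" "t \<le> length acs * (TV + 2) + 2" using 1(1) by simp_all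
    define s3 where "s3 = (if s2 ''d1'' 0 = s2 ''d2'' 0 then s2 else s2(''ok'' := (s2 ''ok'')(0 := 0)))"
    define s4 where "s4 = s3(''head'' := (s3 ''head'')(0 := int h + 1))"
    have "queue (length ls) (s ''tt'' 0) s4 k'" "nodes s4 k' = nodes s2 k'" "\<forall>n. node_at s4 n = node_at s2 n"
      using k'(1) queue_cong[of s4 s2] by (simp_all add: s4_def s3_def)
    moreover have "s4 ''ok'' 0 = (if agrees M R S x then s ''ok'' 0 else 0)"
    proof -
      have "s4 ''ok'' 0 = (if s2 ''d1'' 0 = s2 ''d2'' 0 then s2 ''ok'' 0 else 0)" by (simp add: s4_def s3_def)
      then show ?thesis unfolding ag ok by (simp only: if_nest)
    qed
    moreover have "s4 ''head'' 0 = int (Suc h)" by (simp add: s4_def)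
    \<comment> \<open>The loop over the actions took \<open>t\<close>; the 18 units added to it
      leave room for the assignments and tests around the loop.\<close>
    ultimately have fin: "t + 20 - 2 \<le> TP \<and> s4 ''head'' 0 = int (Suc h)
      \<and> s4 ''ok'' 0 = (if agrees M R S x then s ''ok'' 0 else 0)
      \<and> extends s k s4 (\<Union>j < length acs. moves M R S x (acs ! j))"
      using k' hd by (simp add: TP_def) blast
    show ?case
    proof (cases "s2 ''d1'' 0 = s2 ''d2'' 0")
      case True
      then have "s4 = s2(''head'' := (s2 ''head'')(0 := int h + 1))" by (simp add: s4_def s3_def)
      with fin True show ?thesis by (simp add: hd)
    next
      case False
      then have "s4 = s2(''ok'' := (s2 ''ok'')(0 := 0), ''head'' := (s2 ''head'')(0 := int h + 1))" by (simp add: s4_def s3_def)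
      with fin False show ?thesis by (auto simp: hd)
    qed
  qed
qed

text \<open>Two scans for the initial configurations, and at most \<open>length ls\<close> times
  \<open>(2 * X) ^ 4\<close> nodes, since the four interval ends are codes below
  \<open>2 * length ts\<close>; each node costs \<open>TP\<close> and a loop test.\<close>

definition "TX = 2 * TS + 40 + length ls * (2 * X) ^ 4 * (TP + 1)"

definition joint_nodes :: "int \<Rightarrow> ('p lterm \<Rightarrow> int) \<Rightarrow> ('p lterm \<Rightarrow> int) \<Rightarrow> node set" where
  "joint_nodes M R S = {(int i, y) | i y. i < length ls \<and> joint A M R S (ls ! i) y}"

lemma moves_joint: "x \<in> joint_nodes M R S \<Longrightarrow> moves M R S x act \<subseteq> joint_nodes M R S"
  by (auto simp: joint_nodes_def moves_def intro: joint.step)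

text \<open>Completeness of the search: a set that contains the initial node and is closed under
  moves contains all joint states.\<close>

lemma joint_nodes_closed:
  assumes "joint A M R S l y" "k < length ls" "ls ! k = start A"
    and init: "starts A R \<Longrightarrow> starts A S \<Longrightarrow>
      (int k, 2 * R zterm, 2 * R zterm, 2 * S zterm, 2 * S zterm) \<in> N"
    and closed: "\<And>x j. x \<in> N \<Longrightarrow> j < length acs \<Longrightarrow> moves M R S x (acs ! j) \<subseteq> N"
  shows "\<exists>i < length ls. ls ! i = l \<and> (int i, y) \<in> N"
  using assms(1)
proof (induction rule: joint.induct)
  case init
  with assms show ?case by blast
next
  case (step l lo hi lo' hi' a k p q p' q')
  then obtain i where i: "i < length ls" "ls ! i = l" "(int i, lo, hi, lo', hi') \<in> N" by blast
  have "a \<in> acts A" using delta_acts step.hyps(2) by force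
  then obtain j where j: "j < length acs" "acs ! j = a" using acs by (metis in_set_conv_nth)
  obtain e where e: "edge_opt A l a = Some e" using step.hyps(2) by (cases "edge_opt A l a") (auto simp: delta.simps)
  obtain g r l' where "(l, g, a, r, k) \<in> edges A" using delta_SomeD[OF det step.hyps(2)] by blast
  then have "k \<in> set ls" using edge_LT(2)[of l a g r k] edge_opt_iff[OF det] ls by blast
  then obtain h where h: "h < length ls" "ls ! h = k" by (metis in_set_conv_nth)
  have "(int h, p, q, p', q') \<in> moves M R S (int i, lo, hi, lo', hi') a"
    using h i step.hyps by (auto simp: moves_def)
  with closed[OF i(3) j(1)] j h show ?case by blast
qed

text \<open>All queued nodes are joint, and the moves of the nodes before \<open>head\<close> are
  queued. When \<open>head\<close> meets \<open>tail\<close>, the queued nodes are closed under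
  moves and hence are exactly the joint ones, so \<open>ok\<close> records their agreement. The
  number \<open>B\<close> of possible nodes minus the position of \<open>head\<close> decreases in
  each round.\<close>

lemma explore_loop:
  assumes T: "tables s ts" and RS: "ranked_at s ts 0 R" "ranked_at s ts (int (length ts)) S"
    and z: "0 \<le> R zterm" "2 * R zterm < M" "0 \<le> S zterm" "2 * S zterm < M"
    and M: "M = 2 * int (length ts) - 1"
    and Q: "queue (length ls) (s ''tt'' 0) s k0" and h: "s ''head'' 0 = 0"
    and st: "k < length ls" "ls ! k = start A"
    and N: "nodes s k0 = (if starts A R \<and> starts A S
      then {(int k, 2 * R zterm, 2 * R zterm, 2 * S zterm, 2 * S zterm)} else {})"
    and ok: "s ''ok'' 0 = (if starts A R \<longleftrightarrow> starts A S then 1 else 0)"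
  shows "runs (While (Less (V ''head'') (V ''tail'')) process) s (\<lambda>\<tau> s'.
    \<tau> \<le> length ls * (2 * X) ^ 4 * (TP + 1) + 1
    \<and> s' ''ok'' 0 = (if same_lang A M R S then 1 else 0) \<and> (\<forall>i. s' ''vis'' i \<le> s' ''stamp'' 0))"
proof -
  define B where "B = length ls * (2 * length ts) ^ 4"
  define P where "P \<kappa> s' \<longleftrightarrow> (\<exists>h k. \<kappa> = B - h \<and> h \<le> k \<and> s' ''head'' 0 = int h \<and> queue (length ls) (s ''tt'' 0) s' k
    \<and> nodes s k0 \<subseteq> nodes s' k \<and> nodes s' k \<subseteq> joint_nodes M R S
    \<and> (\<forall>i < h. \<forall>j < length acs. moves M R S (node_at s' (int i)) (acs ! j) \<subseteq> nodes s' k)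
    \<and> s' ''ok'' 0 = (if \<forall>i < h. agrees M R S (node_at s' (int i)) then s ''ok'' 0 else 0))" for \<kappa> s'
  have tt: "s ''tt'' 0 = int (2 * length ts)" using T by (simp add: tables_def)
  show ?thesis
  proof (rule runs_While[where I = P and k = B and c = TP], goal_cases)
    case 1
    have "nodes s k0 \<subseteq> joint_nodes M R S"
      unfolding N using st joint.init[of R A S M] by (auto simp: joint_nodes_def)
    with Q h show ?case unfolding P_def by (intro exI[of _ 0] exI[of _ k0]) auto
  next
    case (2 \<kappa> s1)
    then obtain h k where k: "\<kappa> = B - h" "h \<le> k" "s1 ''head'' 0 = int h" "queue (length ls) (s ''tt'' 0) s1 k"
      "nodes s k0 \<subseteq> nodes s1 k" "nodes s1 k \<subseteq> joint_nodes M R S"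
      "\<forall>i < h. \<forall>j < length acs. moves M R S (node_at s1 (int i)) (acs ! j) \<subseteq> nodes s1 k"
      "s1 ''ok'' 0 = (if \<forall>i < h. agrees M R S (node_at s1 (int i)) then s ''ok'' 0 else 0)"
      unfolding P_def by blast
    have hk: "h < k" using 2(2) k(3,4) by (simp add: queue_def)
    have kB: "k \<le> B" using queue_bound[of "length ls" "2 * length ts" s1 k] k(4) by (simp only: tt B_def)
    have tv: "\<forall>y \<in> insert ''rk'' table_vars. s1 y = s y" using 2(3) by simp
    have T1: "tables s1 ts" using tables_cong[OF T] tv by simp
    have R1: "ranked_at s1 ts 0 R" "ranked_at s1 ts (int (length ts)) S"
      using RS tv by (simp_all add: ranked_at_def)
    have tt1: "s1 ''tt'' 0 = s ''tt'' 0" using tv by simp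
    have Q1: "queue (length ls) (s1 ''tt'' 0) s1 k" using k(4) tt1 by simp
    have xn: "node_at s1 (int h) \<in> nodes s1 k" using hk by (auto simp: nodes_def)
    show ?case
    proof (rule runs_call[OF process[OF T1 R1 z M Q1 k(3) hk refl]], goal_cases)
      case (1 \<tau> s2)
      then obtain k' where k': "queue (length ls) (s ''tt'' 0) s2 k'" "k \<le> k'"
        "nodes s2 k' = nodes s1 k \<union> (\<Union>j < length acs. moves M R S (node_at s1 (int h)) (acs ! j))"
        "\<forall>n < k. node_at s2 (int n) = node_at s1 (int n)" unfolding tt1 by blast
      have n: "node_at s2 (int i) = node_at s1 (int i)" if "i < Suc h" for i using k'(4) that hk by simp
      have "nodes s2 k' \<subseteq> joint_nodes M R S"
        unfolding k'(3) using k(6) xn moves_joint by blast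
      moreover have "moves M R S (node_at s2 (int i)) (acs ! j) \<subseteq> nodes s2 k'" if "i < Suc h" "j < length acs" for i j
      proof (cases "i = h")
        case True
        then show ?thesis unfolding n[OF that(1)] k'(3) using that by blast
      next
        case False
        then have "i < h" using that by simp
        with k(7) that show ?thesis unfolding n[OF that(1)] k'(3) by blast
      qed
      moreover have "s2 ''ok'' 0 = (if \<forall>i < Suc h. agrees M R S (node_at s2 (int i)) then s ''ok'' 0 else 0)"
      proof -
        have "(\<forall>i < Suc h. agrees M R S (node_at s2 (int i))) \<longleftrightarrow>
            agrees M R S (node_at s1 (int h)) \<and> (\<forall>i < h. agrees M R S (node_at s1 (int i)))"
          using n by (auto simp: All_less_Suc)
        moreover have "s2 ''ok'' 0 = (if agrees M R S (node_at s1 (int h)) then s1 ''ok'' 0 else 0)"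
          using 1(1) by blast
        ultimately show ?thesis unfolding k(8) by (simp only: if_nest)
      qed
      moreover have "s2 ''head'' 0 = int (Suc h)" using 1(1) by blast
      moreover have "nodes s k0 \<subseteq> nodes s2 k'" using k(5) k'(3) by blast
      ultimately have "P (B - Suc h) s2"
        unfolding P_def using k' hk by (intro exI[of _ "Suc h"] exI[of _ k']) auto
      moreover have "B - Suc h < \<kappa>" using k(1) hk kB by simp
      ultimately show ?case using 1(1) by blast
    qed
  next
    case (3 \<kappa> s' \<tau>)
    then obtain h k' where k: "h \<le> k'" "s' ''head'' 0 = int h" "queue (length ls) (s ''tt'' 0) s' k'"
      "nodes s k0 \<subseteq> nodes s' k'" "nodes s' k' \<subseteq> joint_nodes M R S"
      "\<forall>i < h. \<forall>j < length acs. moves M R S (node_at s' (int i)) (acs ! j) \<subseteq> nodes s' k'"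
      "s' ''ok'' 0 = (if \<forall>i < h. agrees M R S (node_at s' (int i)) then s ''ok'' 0 else 0)"
      unfolding P_def by blast
    have hk: "h = k'" using 3(2) k(1-3) by (simp add: queue_def)
    have closed: "moves M R S x (acs ! j) \<subseteq> nodes s' k'" if "x \<in> nodes s' k'" "j < length acs" for x j
      using that k(6) unfolding hk nodes_def by auto
    have ag: "(\<forall>i < h. agrees M R S (node_at s' (int i))) \<longleftrightarrow> (\<forall>x \<in> nodes s' k'. agrees M R S x)"
      unfolding hk nodes_def by auto
    have "(\<forall>x \<in> nodes s' k'. agrees M R S x) \<longleftrightarrow> (\<forall>l y. joint A M R S l y \<longrightarrow> agree A M R S l y)"
    proof (intro iffI allI impI ballI)
      fix l y assume all: "\<forall>x \<in> nodes s' k'. agrees M R S x" and j: "joint A M R S l y"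
      have "\<exists>i < length ls. ls ! i = l \<and> (int i, y) \<in> nodes s' k'"
        by (rule joint_nodes_closed[OF j st _ closed]) (use k(4) N in auto)
      then obtain i where "ls ! i = l" "(int i, y) \<in> nodes s' k'" by blast
      with all have "agrees M R S (int i, y)" by blast
      with \<open>ls ! i = l\<close> show "agree A M R S l y" by simp
    next
      fix x assume "\<forall>l y. joint A M R S l y \<longrightarrow> agree A M R S l y" "x \<in> nodes s' k'"
      with k(5) show "agrees M R S x" by (auto simp: joint_nodes_def)
    qed
    moreover have "(if P then (if P' then 1 else 0) else 0) = (if P' \<and> P then (1 :: int) else 0)" for P P' by simp
    ultimately have "s' ''ok'' 0 = (if same_lang A M R S then 1 else 0)"
      unfolding k(7) ag ok same_lang_def by presburger
    moreover have "\<forall>i. s' ''vis'' i \<le> s' ''stamp'' 0" using k(3) by (simp add: queue_def)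
    moreover have "\<tau> \<le> length ls * (2 * X) ^ 4 * (TP + 1) + 1"
    proof -
      have "B \<le> length ls * (2 * X) ^ 4"
        unfolding B_def using length_interned[OF tablesD(2)[OF T]] by (intro mult_left_mono power_mono) auto
      then have "B * (TP + 1) \<le> length ls * (2 * X) ^ 4 * (TP + 1)" by (rule mult_right_mono) simp
      with 3(4) show ?thesis by linarith
    qed
    ultimately show ?case by blast
  qed
qed

lemma start_ok:
  assumes T: "tables s ts" and R: "ranked_at s ts (s ''b'' 0) R"
  shows "runs start_ok s (\<lambda>\<tau> s'. \<tau> \<le> TS + 6
    \<and> (if starts A R then s' ''en'' 0 = 1 \<and> s' ''lb'' 0 = 2 * R zterm \<and> s' ''ub'' 0 = 2 * R zterm
       else s' ''en'' 0 = 0))"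
proof -
  obtain k where k: "k < length ls" "ls ! k = start A" "s ''start'' 0 = int k"
    using T by (auto simp: tables_def)
  have inv: "guardat ps inp (s ''inv'' (int k)) (invar A (start A))"
    using T k by (auto simp: tables_def)
  have LT: "snd ` invar A (start A) \<subseteq> LT A"
    using pta by (intro invar_LT) (simp add: extended_1c_pta_def)
  have z: "s ''rk'' (s ''b'' 0) = R zterm"
    using R tablesD(2)[OF T] by (force simp: ranked_at_def interned_def)
  show ?thesis
    unfolding start_ok_def
    apply (simp add: k z)
  proof (rule scan_call[where ts = ts and R = R and g = "invar A (start A)"], goal_cases)
    case (5 \<tau> s')
    have e: "{s' ''lb'' 0..s' ''ub'' 0} = {2 * R zterm} \<inter> codes R (invar A (start A))" using 5(2) by simp
    show ?case
    proof (cases "starts A R")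
      case True
      then have "{s' ''lb'' 0..s' ''ub'' 0} = {2 * R zterm..2 * R zterm}" using e by simp
      then have "s' ''lb'' 0 = 2 * R zterm" "s' ''ub'' 0 = 2 * R zterm" by (simp_all only: Icc_eq_Icc) auto
      with True 5(1) show ?thesis by simp
    next
      case False
      then have "s' ''ub'' 0 < s' ''lb'' 0" using e by simp
      with False 5(1) show ?thesis by simp
    qed
  qed (use LT inv R tables_cong[OF T] in \<open>simp_all add: ranked_at_def\<close>)
qed

lemma seed:
  assumes T: "tables s ts" and RS: "ranked_at s ts 0 R"
    and z: "0 \<le> R zterm" "2 * R zterm < M" "0 \<le> S zterm" "2 * S zterm < M"
    and M: "M = 2 * int (length ts) - 1"
    and Q: "queue (length ls) (s ''tt'' 0) s 0"
    and st: "k < length ls" "ls ! k = start A" "s ''start'' 0 = int k"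
    and ini: "iR = (starts A R)" "iS = (starts A S)"
    and f: "s ''f'' 0 = of_bool iR" "s ''en'' 0 = of_bool iS" "iS \<longrightarrow> s ''lb'' 0 = 2 * S zterm \<and> s ''ub'' 0 = 2 * S zterm"
    and ok: "s ''ok'' 0 = 1"
  shows "runs seed s (\<lambda>\<tau> s'. \<tau> \<le> 17
    \<and> (\<exists>k0. queue (length ls) (s ''tt'' 0) s' k0 \<and>
         nodes s' k0 = (if iR \<and> iS then {(int k, 2 * R zterm, 2 * R zterm, 2 * S zterm, 2 * S zterm)} else {}))
    \<and> s' ''ok'' 0 = (if iR \<longleftrightarrow> iS then 1 else 0))"
proof -
  have tt: "s ''tt'' 0 = M + 1" using T M by (simp add: tables_def)
  have rz: "s ''rk'' 0 = R zterm"
    using RS tablesD(2)[OF T] by (force simp: ranked_at_def interned_def)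
  have n0: "nodes t 0 = {}" for t by (simp add: nodes_def)
  consider (diff) "iR \<noteq> iS" | (none) "\<not> iR" "\<not> iS" | (both) iR iS by blast
  then show ?thesis
  proof cases
    case diff
    have "queue (length ls) (M + 1) (s(''ok'' := (s ''ok'')(0 := 0))) 0"
      using Q queue_cong(1)[of "s(''ok'' := (s ''ok'')(0 := 0))" s] tt by simp
    with diff show ?thesis
      by (cases iR) (auto simp: seed_def f n0 tt)
  next
    case none
    with Q show ?thesis by (auto simp: seed_def f n0 tt ok)
  next
    case both
    define u where "u = s(''r2'' := (s ''r2'')(0 := s ''lb'' 0), ''s2'' := (s ''s2'')(0 := s ''ub'' 0),
      ''lb'' := (s ''lb'')(0 := 2 * R zterm), ''ub'' := (s ''ub'')(0 := 2 * R zterm), ''k'' := (s ''k'')(0 := int k))"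
    have tu: "u ''tt'' 0 = s ''tt'' 0" by (simp add: u_def)
    have Qu: "queue (length ls) (u ''tt'' 0) u 0"
      unfolding tu using Q queue_cong(1)[of u s] by (simp add: u_def)
    define x where "x = (int k, 2 * R zterm, 2 * R zterm, 2 * S zterm, 2 * S zterm)"
    have x: "x = (u ''k'' 0, u ''lb'' 0, u ''ub'' 0, u ''r2'' 0, u ''s2'' 0)"
      using f(3) both by (simp add: x_def u_def)
    have xr: "x \<in> node_range (length ls) (u ''tt'' 0)"
      unfolding tu tt using z st by (simp add: x_def node_range_def)
    have "runs push u (\<lambda>\<tau> s'. \<tau> \<le> 10 \<and> (\<exists>k0. queue (length ls) (s ''tt'' 0) s' k0 \<and> nodes s' k0 = {x}) \<and> s' ''ok'' 0 = 1)"
    proof (rule runs_call[OF push[OF Qu x xr]], goal_cases)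
      case (1 \<tau> s')
      then show ?case using ok unfolding tu n0 by (auto simp: u_def)
    qed
    then show ?thesis
      unfolding x_def using both
      apply (simp add: seed_def f rz st u_def)
      apply (erule runs_call)
      apply simp
      done
  qed
qed

lemma explore:
  assumes T: "tables s ts" and RS: "ranked_at s ts 0 R" "ranked_at s ts (int (length ts)) S"
    and z: "0 \<le> R zterm" "2 * R zterm < M" "0 \<le> S zterm" "2 * S zterm < M"
    and M: "M = 2 * int (length ts) - 1"
    and vis: "\<forall>i. s ''vis'' i \<le> s ''stamp'' 0"
  shows "runs explore s (\<lambda>\<tau> s'. \<tau> \<le> TX
    \<and> s' ''ok'' 0 = (if same_lang A M R S then 1 else 0) \<and> (\<forall>i. s' ''vis'' i \<le> s' ''stamp'' 0))"
proof -
  obtain k where k: "k < length ls" "ls ! k = start A" "s ''start'' 0 = int k"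
    using T by (auto simp: tables_def)
  define iR where "iR = (starts A R)"
  define iS where "iS = (starts A S)"
  define tv where "tv = insert ''rk'' table_vars"
  have cong: "tables t ts" if "\<forall>y \<in> tv. t y = s y" for t
    using that by (intro tables_cong[OF T]) (simp add: tv_def)
  have rk: "ranked_at t ts b R' \<longleftrightarrow> ranked_at s ts b R'" if "\<forall>y \<in> tv. t y = s y" for t b R'
    using that by (simp add: ranked_at_def tv_def)
  have nt: "s ''nt'' 0 = int (length ts)" using T by (simp add: tables_def interned_def)
  define s0 where "s0 = s(''stamp'' := (s ''stamp'')(0 := s ''stamp'' 0 + 1), ''ok'' := (s ''ok'')(0 := 1),
    ''head'' := (s ''head'')(0 := 0), ''tail'' := (s ''tail'')(0 := 0), ''b'' := (s ''b'')(0 := 0))"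
  have tv0: "\<forall>y \<in> tv. s0 y = s y" by (simp add: s0_def tv_def)
  have f0: "s0 ''ok'' 0 = 1" "s0 ''head'' 0 = 0" "s0 ''tail'' 0 = 0" "\<forall>i. s0 ''vis'' i < s0 ''stamp'' 0" "s0 ''b'' 0 = 0"
    using vis by (simp_all add: s0_def)
  have R0: "ranked_at s0 ts (s0 ''b'' 0) R" unfolding rk[OF tv0] f0 by (rule RS)
  show ?thesis
    unfolding explore_def
    apply (simp add: s0_def[symmetric] split del: if_split)
  proof (rule runs_call[OF start_ok[OF cong[OF tv0] R0]], goal_cases)
    case (1 t1 s1)
    have tv1: "\<forall>y \<in> tv. s1 y = s y" using 1(2) tv0 by (simp add: tv_def)
    have e1: "s1 ''en'' 0 = of_bool iR" using 1(1) by (auto simp: iR_def split: if_splits)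
    have f1: "s1 ''ok'' 0 = 1" "s1 ''head'' 0 = 0" "s1 ''tail'' 0 = 0" "\<forall>i. s1 ''vis'' i < s1 ''stamp'' 0"
      using 1(2) f0 by simp_all
    have nt1: "s1 ''nt'' 0 = int (length ts)" using tv1 nt by (simp add: tv_def)
    have t1: "t1 \<le> TS + 6" using 1(1) by simp
    define u1 where "u1 = s1(''f'' := (s1 ''f'')(0 := of_bool iR), ''b'' := (s1 ''b'')(0 := int (length ts)))"
    have tu1: "\<forall>y \<in> tv. u1 y = s y" using tv1 by (simp add: u1_def tv_def)
    have R1: "ranked_at u1 ts (u1 ''b'' 0) S" unfolding rk[OF tu1] using RS by (simp add: u1_def)
    show ?case
      apply (simp add: e1 nt1 u1_def[symmetric] split del: if_split)
    proof (rule runs_call[OF start_ok[OF cong[OF tu1] R1]], goal_cases)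
      case (1 t2 s2)
      have tv2: "\<forall>y \<in> tv. s2 y = s y" using 1(2) tu1 by (simp add: tv_def)
      have e2: "s2 ''en'' 0 = of_bool iS" "iS \<longrightarrow> s2 ''lb'' 0 = 2 * S zterm \<and> s2 ''ub'' 0 = 2 * S zterm"
        using 1(1) by (auto simp: iS_def split: if_splits)
      have f2: "s2 ''ok'' 0 = 1" "s2 ''head'' 0 = 0" "s2 ''tail'' 0 = 0" "\<forall>i. s2 ''vis'' i < s2 ''stamp'' 0" "s2 ''f'' 0 = of_bool iR"
        using 1(2) f1 by (simp_all add: u1_def)
      have st2: "s2 ''start'' 0 = int k" using tv2 k by (simp add: tv_def)
      have t2: "t2 \<le> TS + 6" using 1(1) by simp
      \<comment> \<open>Every entry of \<open>vis\<close> is below the fresh stamp, so the queue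
        counts as empty although nothing has been cleared.\<close>
      have Q2: "queue (length ls) (s2 ''tt'' 0) s2 0"
        using f2 by (auto simp: queue_def nodes_def less_imp_le less_imp_neq)
      have R2: "ranked_at s2 ts 0 R" unfolding rk[OF tv2] by (rule RS)
      show ?case
        apply (simp split del: if_split)
      proof (rule runs_call[OF seed[OF cong[OF tv2] R2 z M Q2 k(1,2) st2 iR_def iS_def f2(5) e2 f2(1)]], goal_cases)
        case (1 t3 s3)
        have tv3: "\<forall>y \<in> tv. s3 y = s y" using 1(2) tv2 by (simp add: tv_def)
        have R3: "ranked_at s3 ts 0 R" "ranked_at s3 ts (int (length ts)) S" unfolding rk[OF tv3] by (rule RS)+
        have h3: "s3 ''head'' 0 = 0" using 1(2) f2 by simp
        have tt3: "s3 ''tt'' 0 = s2 ''tt'' 0" using tv2 tv3 by (simp add: tv_def)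
        obtain k0 where k0: "queue (length ls) (s3 ''tt'' 0) s3 k0"
          "nodes s3 k0 = (if iR \<and> iS then {(int k, 2 * R zterm, 2 * R zterm, 2 * S zterm, 2 * S zterm)} else {})"
          unfolding tt3 using 1(1) by blast
        have t3: "t3 \<le> 17" and ok3: "s3 ''ok'' 0 = (if iR \<longleftrightarrow> iS then 1 else 0)" using 1(1) by blast+
        show ?case
        apply (rule runs_call[OF explore_loop[OF cong[OF tv3] R3 z M k0(1) h3 k(1,2) k0(2)[unfolded iR_def iS_def]
              ok3[unfolded iR_def iS_def]]])
       proof goal_cases
          case (1 t4 s4)
          then show ?case using t1 t2 t3 by (simp add: TX_def)
        qed
      qed
    qed
  qed
qed

end

section \<open>Reading the input\<close>

definition read_guard :: prog where
  "read_guard = (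
     ''c'' ::= Get ''in'' (V ''p'') ;;
     ''p'' ::= Add (V ''p'') (Const 1) ;;
     For ''j'' ''c'' (
       ''ad'' ::= Add (V ''p'') (Const 1) ;;
       lookup ;;
       Cond (Less (V ''id'') (V ''nt'')) Skip
         (Put ''adr'' (V ''id'') (V ''ad'') ;; ''nt'' ::= Add (V ''nt'') (Const 1)) ;;
       ''p'' ::= Add (V ''p'') (V ''w'')))"

definition read_edge :: prog where
  "read_edge = (
     ''e'' ::= Mul (Get ''in'' (V ''p'')) (V ''na'') ;;
     ''p'' ::= Add (V ''p'') (Const 1) ;;
     ''g'' ::= V ''p'' ;;
     read_guard ;;
     ''e'' ::= Add (V ''e'') (Get ''in'' (V ''p'')) ;;
     Put ''edge'' (V ''e'') (V ''g'') ;;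
     Put ''rst'' (V ''e'') (Get ''in'' (Add (V ''p'') (Const 1))) ;;
     Put ''tgt'' (V ''e'') (Get ''in'' (Add (V ''p'') (Const 2))) ;;
     ''p'' ::= Add (V ''p'') (Const 3))"

text \<open>
  Terms are represented by the addresses of their codes in the input.  The input is preceded by
  zeros, so a negative address represents the zero term.
\<close>

definition parse :: prog where
  "parse = (
     ''nl'' ::= Get ''in'' (Const 0) ;;
     ''na'' ::= Get ''in'' (Const 1) ;;
     ''np'' ::= Get ''in'' (Const 2) ;;
     ''start'' ::= Get ''in'' (Const 3) ;;
     ''w1'' ::= Add (V ''np'') (Const 1) ;;
     ''w'' ::= Add (V ''np'') (Const 2) ;;
     ''nt'' ::= Const 1 ;;
     Put ''adr'' (Const 0) (Sub (Const 0) (V ''w1'')) ;;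
     ''p'' ::= Const 4 ;;
     For ''l'' ''nl'' (Put ''inv'' (V ''l'') (V ''p'') ;; read_guard) ;;
     ''ne'' ::= Get ''in'' (V ''p'') ;;
     ''p'' ::= Add (V ''p'') (Const 1) ;;
     For ''l'' ''ne'' read_edge ;;
     ''tt'' ::= Mul (Const 2) (V ''nt'') ;;
     ''top'' ::= Sub (V ''tt'') (Const 1))"

lemmas writes_read_guard [simp] = arg_cong[OF read_guard_def, of writes, unfolded writes.simps writes_For]
lemmas writes_read_edge [simp] = arg_cong[OF read_edge_def, of writes, unfolded writes.simps]
lemmas writes_parse [simp] = arg_cong[OF parse_def, of writes, unfolded writes.simps writes_For]

lemma position_nth:
  assumes "distinct xs" "i < length xs"
  shows "position xs (xs ! i) = int i"
proof -
  have "(LEAST k. k < length xs \<and> xs ! k = xs ! i) = i"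
    using assms by (intro Least_equality) (auto simp: nth_eq_iff_index_eq)
  then show ?thesis by (simp add: position_def)
qed

section \<open>Correctness and cost of the parser\<close>

context coded
begin

definition "TG = 5 * X * (TL + 8) + 4"

text \<open>The edge table when only the edges in \<open>Y\<close> have been read; it is the loop
  invariant for reading the edges.\<close>

definition "Eopt Y l a = (if \<exists>g r l'. (l, g, a, r, l') \<in> Y then edge_opt A l a else None)"

lemma base_cong: "base s \<Longrightarrow> \<forall>y \<in> {''in'', ''w1'', ''w''}. s' y = s y \<Longrightarrow> base s'"
  by (simp add: base_def)

lemma interned_cong: "interned s ts \<Longrightarrow> \<forall>y \<in> {''nt'', ''adr''}. s' y = s y \<Longrightarrow> interned s' ts"
  by (simp add: interned_def)

lemma interned_append:
  assumes "interned s ts" "t \<in> terms A" "t \<notin> set ts" "seg inp a (tcode ps t)"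
    "s' ''nt'' 0 = s ''nt'' 0 + 1" "s' ''adr'' = (s ''adr'')(int (length ts) := a)"
  shows "interned s' (ts @ [t])"
  using assms by (auto simp: interned_def nth_append less_Suc_eq)

lemma read_guard:
  assumes b: "base s" and i: "interned s ts" and us: "seg inp (s ''p'' 0) us" "code_guard ps g us" and g: "snd ` g \<subseteq> LT A"
  shows "runs read_guard s (\<lambda>\<tau> s'. \<tau> \<le> TG \<and> s' ''p'' 0 = s ''p'' 0 + int (length us)
    \<and> (\<exists>ts'. interned s' ts' \<and> set ts' = set ts \<union> snd ` g))"
proof -
  from us(2) obtain cs where cs: "distinct cs" "set cs = g" "us = int (length cs) # concat (map (constraint_code ps) cs)"
    by (rule code_guardE)
  have len: "length us = 1 + length cs * (m + 2)"
  proof -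
    have "length (concat (map (constraint_code ps) xs)) = length xs * (m + 2)" for xs
      by (induction xs) (auto simp: constraint_code_tcode split: prod.splits)
    with cs show ?thesis by simp
  qed
  have cc: "inp (s ''p'' 0) = int (length cs)"
    "\<And>j. j < length cs \<Longrightarrow> seg inp (s ''p'' 0 + 1 + int j * (int m + 2)) (constraint_code ps (cs ! j))"
  proof -
    show "inp (s ''p'' 0) = int (length cs)" using us(1) cs(3) by (simp add: seg_Cons)
    fix j assume "j < length cs"
    then have "seg inp (s ''p'' 0 + 1 + int j * int (m + 2)) (map (constraint_code ps) cs ! j)"
      using us(1) cs(3)
      by (intro seg_concat_nth) (auto simp: seg_Cons constraint_code_tcode split: prod.splits)
    with \<open>j < length cs\<close> show "seg inp (s ''p'' 0 + 1 + int j * (int m + 2)) (constraint_code ps (cs ! j))"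
      by (simp add: algebra_simps)
  qed
  have bb: "s ''in'' = inp" "s ''w'' 0 = int m + 2" using b by (simp_all add: base_def)
  define P where "P j s' \<longleftrightarrow> s' ''p'' 0 = s ''p'' 0 + 1 + int j * (int m + 2)
    \<and> (\<exists>ts'. interned s' ts' \<and> set ts' = set ts \<union> snd ` set (take j cs))" for j s'
  have Pc: "P j (t(''j'' := y)) \<longleftrightarrow> P j t" for j t y by (simp add: P_def interned_def)
  show ?thesis
    unfolding read_guard_def runs_Seq runs_Put
  proof (rule runs_For[where n = "length cs" and c = "TL + 6" and I = P], goal_cases)
    case (5)
    have "interned (s(''c'' := (s ''c'')(0 := int (length cs)), ''p'' := (s ''p'')(0 := s ''p'' 0 + 1), ''j'' := (s ''j'')(0 := 0))) ts"
      using i by (rule interned_cong) simp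
    then show ?case by (auto simp: bb cc P_def)
  next
    case (6 j s1)
    from 6(2) obtain ts1 where p1: "s1 ''p'' 0 = s ''p'' 0 + 1 + int j * (int m + 2)"
      and ts1: "interned s1 ts1" "set ts1 = set ts \<union> snd ` set (take j cs)" by (auto simp: P_def)
    obtain c t where ct: "cs ! j = (c, t)" by (metis prod.exhaust)
    have "t \<in> LT A" using ct 6(1) cs(2) g by (metis image_subset_iff nth_mem snd_conv)
    then have tt: "t \<in> terms A" by (simp add: terms_def)
    have h: "seg inp (s1 ''p'' 0 + 1) (tcode ps t)"
      using cc(2)[OF 6(1)] p1 ct by (simp add: constraint_code_tcode seg_Cons)
    have tk: "snd ` set (take (Suc j) cs) = insert t (snd ` set (take j cs))"
      using 6(1) ct by (simp add: take_Suc_conv_app_nth)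
    define s2 where "s2 = s1(''ad'' := (s1 ''ad'')(0 := s1 ''p'' 0 + 1))"
    have w1: "s1 ''w'' 0 = int m + 2" using 6(4) bb by simp
    have s2: "base s2" "interned s2 ts1" "seg inp (s2 ''ad'' 0) (tcode ps t)"
      using base_cong[OF b, of s2] interned_cong[OF ts1(1), of s2] 6(4) h by (simp_all add: s2_def)
    show ?case
      apply (simp add: s2_def[symmetric])
    proof (rule runs_call[OF lookup[OF s2 tt]], goal_cases)
      case (1 \<tau> s3)
      have f3: "s3 ''p'' 0 = s1 ''p'' 0" "s3 ''w'' 0 = int m + 2" "s3 ''nt'' = s1 ''nt''" "s3 ''adr'' = s1 ''adr''" "s3 ''ad'' 0 = s1 ''p'' 0 + 1"
        using 1(2) w1 by (simp_all add: s2_def)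
      have nt: "s3 ''nt'' 0 = int (length ts1)" using ts1 f3 by (simp add: interned_def)
      have nt1: "s1 ''nt'' 0 = int (length ts1)" using ts1 by (simp add: interned_def)
      have t: "\<tau> \<le> TL" using 1(1) by simp
      have pp: "s1 ''p'' 0 + (int m + 2) = s ''p'' 0 + 1 + int (Suc j) * (int m + 2)"
        using p1 by (simp add: algebra_simps)
      from 1(1) consider k where "k < length ts1" "s3 ''id'' 0 = int k" "ts1 ! k = t"
        | "s3 ''id'' 0 = int (length ts1)" "t \<notin> set ts1" by blast
      then show ?case
      proof cases
        case 1
        have "t \<in> set ts1" using 1 by auto
        have "interned (s3(''p'' := (s3 ''p'')(0 := s1 ''p'' 0 + (int m + 2)))) ts1"
          using ts1(1) by (rule interned_cong) (simp add: f3)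
        with ts1(2) \<open>t \<in> set ts1\<close> have "P (Suc j) (s3(''p'' := (s3 ''p'')(0 := s1 ''p'' 0 + (int m + 2))))"
          unfolding P_def tk pp by auto
        with 1 t show ?thesis by (simp add: nt nt1 f3 Pc)
      next
        case 2
        define s4 where "s4 = s3(''adr'' := (s3 ''adr'')(int (length ts1) := s1 ''p'' 0 + 1),
          ''nt'' := (s3 ''nt'')(0 := int (length ts1) + 1), ''p'' := (s3 ''p'')(0 := s1 ''p'' 0 + (int m + 2)))"
        have "interned s4 (ts1 @ [t])"
          by (rule interned_append[OF ts1(1) tt 2(2) h]) (use nt f3 in \<open>simp_all add: s4_def\<close>)
        with ts1(2) have "P (Suc j) s4"
          unfolding P_def tk by (intro conjI exI[of _ "ts1 @ [t]"]) (auto simp: s4_def pp)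
        with 2 t show ?thesis by (simp add: nt nt1 f3 Pc s4_def)
      qed
    qed
  next
    case (7 s' \<tau>)
    have "length cs \<le> 5 * X" using card_guard[OF g] cs by (metis distinct_card)
    then have "\<tau> \<le> 5 * X * (TL + 8) + 2" by (rule loop_bound[OF 7(3)]) simp
    then have "1 + 1 + \<tau> \<le> TG" by (simp add: TG_def)
    moreover have "s' ''p'' 0 = s ''p'' 0 + int (length us)" using 7(1) by (simp add: P_def len algebra_simps)
    moreover have "\<exists>ts'. interned s' ts' \<and> set ts' = set ts \<union> snd ` g" using 7(1) cs by (simp add: P_def)
    ultimately show ?case by simp
  qed (use bb cc in auto)
qed

text \<open>By determinism an edge is determined by its source and its action. This keeps the time
  for reading the edges linear in the number of locations once the number of actions is
  fixed.\<close>

lemma card_edges: "card (edges A) \<le> length ls * length acs"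
proof -
  have fin: "finite (locs A)" "finite (acts A)" and
    e: "\<forall>(l, g, a, r, l') \<in> edges A. l \<in> locs A \<and> a \<in> acts A"
    using pta unfolding extended_1c_pta_def by blast+
  define f :: "('l, 'a, 'p lterm) edge \<Rightarrow> 'l \<times> 'a" where "f = (\<lambda>(l, g, a, r, l'). (l, a))"
  have "inj_on f (edges A)"
    unfolding inj_on_def f_def using det unfolding deterministic_def by fastforce
  then have "card (edges A) = card (f ` edges A)" by (simp add: card_image)
  also have "\<dots> \<le> card (locs A \<times> acts A)"
    using fin e by (intro card_mono) (auto simp: f_def)
  also have "\<dots> = length ls * length acs"
    using ls acs by (simp add: card_cartesian_product flip: distinct_card)
  finally show ?thesis .
qed

text \<open>The premise \<open>0 < s ''p'' 0\<close> makes the recorded guard address positive,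
  which distinguishes the entry from a missing edge.\<close>

lemma read_edge:
  assumes b: "base s" and i: "interned s ts" and us: "seg inp (s ''p'' 0) us" "code_edge ls acs ps x us"
    and x: "x = (l, g, a, r, l')" "x \<in> edges A" and p: "0 < s ''p'' 0" and na: "s ''na'' 0 = int (length acs)"
    and E: "\<forall>i < length ls. \<forall>j < length acs.
      entry_at s i j (Eopt Y (ls ! i) (acs ! j))"
  shows "runs read_edge s (\<lambda>\<tau> s'. \<tau> \<le> TG + 8 \<and> s' ''p'' 0 = s ''p'' 0 + int (length us)
    \<and> (\<exists>ts'. interned s' ts' \<and> set ts' = set ts \<union> snd ` g)
    \<and> (\<forall>i < length ls. \<forall>j < length acs.
      entry_at s' i j (Eopt (insert x Y) (ls ! i) (acs ! j))))"
proof -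
  have "\<forall>(l, g, a, r, l') \<in> edges A. l \<in> locs A \<and> a \<in> acts A \<and> l' \<in> locs A"
    using pta unfolding extended_1c_pta_def by blast
  from bspec[OF this x(2)] have "l \<in> set ls" "a \<in> set acs" "l' \<in> set ls" using x(1) ls acs by simp_all
  then obtain i0 j0 k0 where ix: "i0 < length ls" "ls ! i0 = l" "j0 < length acs" "acs ! j0 = a" "k0 < length ls" "ls ! k0 = l'"
    by (metis in_set_conv_nth)
  have pos: "position ls l = int i0" "position acs a = int j0" "position ls l' = int k0"
    using position_nth[OF ls(1) ix(1)] position_nth[OF acs(1) ix(3)] position_nth[OF ls(1) ix(5)] ix by simp_all
  from us(2) obtain gs where gs: "code_guard ps g gs" "us = int i0 # gs @ [int j0, of_bool r, int k0]"
    by (auto simp: code_edge_def x(1) pos)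
  have sg: "inp (s ''p'' 0) = int i0" "seg inp (s ''p'' 0 + 1) gs"
    "inp (s ''p'' 0 + 1 + int (length gs)) = int j0" "inp (s ''p'' 0 + 1 + int (length gs) + 1) = of_bool r"
    "inp (s ''p'' 0 + 1 + int (length gs) + 2) = int k0"
    using us(1) by (simp_all add: gs(2) seg_Cons seg_append)
  have sg': "inp (2 + (s ''p'' 0 + int (length gs))) = of_bool r" "inp (3 + (s ''p'' 0 + int (length gs))) = int k0"
  proof -
    have "2 + (s ''p'' 0 + int (length gs)) = s ''p'' 0 + 1 + int (length gs) + 1"
      "3 + (s ''p'' 0 + int (length gs)) = s ''p'' 0 + 1 + int (length gs) + 2" by simp_all
    then show "inp (2 + (s ''p'' 0 + int (length gs))) = of_bool r" "inp (3 + (s ''p'' 0 + int (length gs))) = int k0"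
      using sg(4,5) by metis+
  qed
  have eo: "edge_opt A l a = Some (g, r, l')" using x edge_opt_iff[OF det] by simp
  have gLT: "snd ` g \<subseteq> LT A" using edge_LT(1)[OF eo] .
  have bb: "s ''in'' = inp" using b by (simp add: base_def)
  define s1 where "s1 = s(''e'' := (s ''e'')(0 := int i0 * int (length acs)), ''p'' := (s ''p'')(0 := s ''p'' 0 + 1),
    ''g'' := (s ''g'')(0 := s ''p'' 0 + 1))"
  have b1: "base s1" using b by (rule base_cong) (simp add: s1_def)
  have i1: "interned s1 ts" using i by (rule interned_cong) (simp add: s1_def)
  have sg1: "seg inp (s1 ''p'' 0) gs" using sg by (simp add: s1_def)
  define ix0 where "ix0 = int i0 * int (length acs) + int j0"
  show ?thesis
    unfolding read_edge_def
    apply (simp add: bb na sg s1_def[symmetric])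
  proof (rule runs_call[OF read_guard[OF b1 i1 sg1 gs(1) gLT]], goal_cases)
    case (1 t s2)
    have f2: "s2 ''e'' 0 = int i0 * int (length acs)" "s2 ''g'' 0 = s ''p'' 0 + 1" "s2 ''edge'' = s ''edge''"
      "s2 ''rst'' = s ''rst''" "s2 ''tgt'' = s ''tgt''" "s2 ''in'' = inp"
      using 1(2) bb by (simp_all add: s1_def)
    have p2: "s2 ''p'' 0 = s ''p'' 0 + 1 + int (length gs)" using 1(1) by (simp add: s1_def)
    have ts2: "\<exists>ts'. interned s2 ts' \<and> set ts' = set ts \<union> snd ` g" using 1(1) by blast
    define s3 where "s3 = s2(''e'' := (s2 ''e'')(0 := ix0), ''edge'' := (s ''edge'')(ix0 := s ''p'' 0 + 1),
      ''rst'' := (s ''rst'')(ix0 := of_bool r), ''tgt'' := (s ''tgt'')(ix0 := int k0),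
      ''p'' := (s2 ''p'')(0 := s ''p'' 0 + 1 + int (length gs) + 3))"
    have E3: "entry_at s3 i j (Eopt (insert x Y) (ls ! i) (acs ! j))"
      if ij: "i < length ls" "j < length acs" for i j
    proof (cases "i = i0 \<and> j = j0")
      case True
      have "guardat ps inp (s ''p'' 0 + 1) g" using gs(1) sg(2) by (auto simp: guardat_def)
      moreover have "Eopt (insert x Y) (ls ! i) (acs ! j) = Some (g, r, l')"
        unfolding Eopt_def using True ix eo x(1) by auto
      ultimately show ?thesis using True p ix by (auto simp: s3_def ix0_def entry_def)
    next
      case False
      have "int i * int (length acs) + int j \<noteq> ix0"
      proof
        assume "int i * int (length acs) + int j = ix0"
        \<comment> \<open>Distinct pairs of location and action occupy distinct cells, so the
          assignment leaves all other entries intact.\<close>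
        from digit_inject[OF this[unfolded ix0_def]] ij ix False show False by simp
      qed
      moreover have "Eopt (insert x Y) (ls ! i) (acs ! j) = Eopt Y (ls ! i) (acs ! j)"
      proof -
        have "\<not> (ls ! i = l \<and> acs ! j = a)"
          using False ix ij ls(1) acs(1) by (metis nth_eq_iff_index_eq)
        then show ?thesis unfolding Eopt_def x(1) by auto
      qed
      ultimately show ?thesis using E ij by (simp add: s3_def)
    qed
    have ts3: "\<exists>ts'. interned s3 ts' \<and> set ts' = set ts \<union> snd ` g"
    proof -
      from ts2 obtain ts' where "interned s2 ts'" "set ts' = set ts \<union> snd ` g" by blast
      moreover from this(1) have "interned s3 ts'" by (rule interned_cong) (simp add: s3_def)
      ultimately show ?thesis by blast
    qed
    have t: "t \<le> TG" using 1(1) by blast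
    have "s3 ''p'' 0 = s ''p'' 0 + int (length us)" by (simp add: s3_def gs(2))
    then have "t + 8 \<le> TG + 8 \<and> s3 ''p'' 0 = s ''p'' 0 + int (length us)
      \<and> (\<exists>ts'. interned s3 ts' \<and> set ts' = set ts \<union> snd ` g)
      \<and> (\<forall>i < length ls. \<forall>j < length acs.
        entry_at s3 i j (Eopt (insert x Y) (ls ! i) (acs ! j)))"
      using E3 ts3 t by simp
    moreover have "runs (''e'' ::= Add (V ''e'') (Get ''in'' (V ''p'')) ;;
       Put ''edge'' (V ''e'') (V ''g'') ;;
       Put ''rst'' (V ''e'') (Get ''in'' (Add (V ''p'') (Const 1))) ;;
       Put ''tgt'' (V ''e'') (Get ''in'' (Add (V ''p'') (Const 2))) ;;
       ''p'' ::= Add (V ''p'') (Const 3)) s2 (\<lambda>u s'. u = 5 \<and> s' = s3)"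
      by (simp add: f2 p2 sg sg' ix0_def[symmetric] s3_def)
    ultimately show ?case by (elim runs_call) simp
  qed
qed

definition "TQ = length ls * (TG + 3) + length ls * length acs * (TG + 10) + 20"

lemma parse:
  assumes s: "s ''in'' = inp" "\<forall>i. s ''edge'' i = 0" and neg: "\<forall>i < 0. inp i = 0"
    and invs: "list_all2 (\<lambda>l. code_guard ps (invar A l)) ls invs"
    and es: "enumerates xs (edges A)" "list_all2 (code_edge ls acs ps) xs us"
    and inp: "seg inp 0 ([int (length ls), int (length acs), int m, position ls (start A)]
      @ concat invs @ (int (length xs) # concat us) @ vs)"
  shows "runs parse s (\<lambda>\<tau> s'. \<tau> \<le> TQ \<and> (\<exists>ts. tables s' ts) \<and> seg inp (s' ''p'' 0) vs)"
proof -
  have hd: "inp 0 = int (length ls)" "inp 1 = int (length acs)" "inp 2 = int m" "inp 3 = position ls (start A)"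
    and sg: "seg inp 4 (concat invs)" "inp (4 + int (length (concat invs))) = int (length xs)"
      "seg inp (5 + int (length (concat invs))) (concat us)"
      "seg inp (5 + int (length (concat invs)) + int (length (concat us))) vs"
    using inp by (simp_all add: seg_Cons seg_append algebra_simps)
  have li: "length invs = length ls" "length us = length xs"
    using invs es by (simp_all add: list_all2_lengthD)
  have split: "seg inp (q + int (length (concat (take i yss)))) (yss ! i)"
    if "seg inp q (concat yss)" "i < length yss" for q i and yss :: "int list list"
  proof -
    have "concat yss = concat (take i yss) @ yss ! i @ concat (drop (Suc i) yss)"
      using that(2) by (metis concat.simps(2) concat_append id_take_nth_drop)
    with that(1) show ?thesis by (metis seg_append)
  qed
  have ct: "length (concat (take (Suc i) yss)) = length (concat (take i yss)) + length (yss ! i)"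
    if "i < length yss" for i and yss :: "int list list"
    using that by (simp add: take_Suc_conv_app_nth)
  have stA: "start A \<in> set ls" using pta ls by (simp add: extended_1c_pta_def)
  then obtain k where k: "k < length ls" "ls ! k = start A" by (metis in_set_conv_nth)
  then have posk: "position ls (start A) = int k" using position_nth[OF ls(1)] by metis
  define s1 where "s1 = s(''nl'' := (s ''nl'')(0 := int (length ls)), ''na'' := (s ''na'')(0 := int (length acs)),
    ''np'' := (s ''np'')(0 := int m), ''start'' := (s ''start'')(0 := int k), ''w1'' := (s ''w1'')(0 := int m + 1),
    ''w'' := (s ''w'')(0 := int m + 2), ''nt'' := (s ''nt'')(0 := 1), ''adr'' := (s ''adr'')(0 := - int m - 1),
    ''p'' := (s ''p'')(0 := 4))"
  have b1: "base s1" using s by (simp add: base_def s1_def)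
  \<comment> \<open>The code of a term has \<open>m + 1\<close> cells; starting at
    \<open>- m - 1\<close> it ends just before cell 0, where the input begins.\<close>
  have zc: "seg inp (- int m - 1) (tcode ps zterm)"
    unfolding seg_def
  proof (intro allI impI)
    fix i assume i: "i < length (tcode ps zterm)"
    then have "inp (- int m - 1 + int i) = 0" using neg by simp
    moreover have "tcode ps zterm ! i = 0" using i by (simp add: tcode_def zterm_def nth_append)
    ultimately show "inp (- int m - 1 + int i) = tcode ps zterm ! i" by simp
  qed
  have i1: "interned s1 [zterm]" using zc by (simp add: interned_def s1_def terms_def)
  define P where "P i t \<longleftrightarrow> t ''p'' 0 = 4 + int (length (concat (take i invs)))
    \<and> (\<exists>ts. interned t ts \<and> set ts = insert zterm (\<Union>l \<in> set (take i ls). snd ` invar A l))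
    \<and> (\<forall>i' < i. guardat ps inp (t ''inv'' (int i')) (invar A (ls ! i')))" for i t
  have Pc: "P i (t(''l'' := y)) \<longleftrightarrow> P i t" for i t y by (simp add: P_def interned_def)
  define L1 where "L1 = For ''l'' ''nl'' (Put ''inv'' (V ''l'') (V ''p'') ;; read_guard)"
  have loop1: "runs L1 s1 (\<lambda>\<tau> s'. \<tau> \<le> length ls * (TG + 3) + 2 \<and> P (length ls) s'
      \<and> (\<forall>y. y \<notin> insert ''l'' (insert ''inv'' (writes read_guard)) \<longrightarrow> s' y = s1 y))"
    unfolding L1_def
  proof (rule runs_For[where n = "length ls" and c = "TG + 1" and I = P], goal_cases)
    case 5
    have "interned (s1(''l'' := (s1 ''l'')(0 := 0))) [zterm]" using i1 by (rule interned_cong) simp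
    then show ?case by (auto simp: P_def s1_def)
  next
    case (6 i s2)
    from 6(2) obtain ts where p2: "s2 ''p'' 0 = 4 + int (length (concat (take i invs)))"
      and ts: "interned s2 ts" "set ts = insert zterm (\<Union>l \<in> set (take i ls). snd ` invar A l)"
      and G: "\<forall>i' < i. guardat ps inp (s2 ''inv'' (int i')) (invar A (ls ! i'))" by (auto simp: P_def)
    define s3 where "s3 = s2(''inv'' := (s2 ''inv'')(int i := s2 ''p'' 0))"
    have b3: "base s3" using b1 by (rule base_cong) (use 6(4) in \<open>simp add: s3_def\<close>)
    have i3: "interned s3 ts" using ts(1) by (rule interned_cong) (simp add: s3_def)
    have sg3: "seg inp (s3 ''p'' 0) (invs ! i)" using split[OF sg(1)] 6(1) li p2 by (simp add: s3_def)
    have cg: "code_guard ps (invar A (ls ! i)) (invs ! i)" using invs 6(1) by (simp add: list_all2_conv_all_nth)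
    have LT: "snd ` invar A (ls ! i) \<subseteq> LT A" using invar_LT 6(1) ls nth_mem by metis
    show ?case
      apply (simp add: 6(3) s3_def[symmetric])
    proof (rule runs_call[OF read_guard[OF b3 i3 sg3 cg LT]], goal_cases)
      case (1 \<tau> s4)
      have iv: "s4 ''inv'' = (s2 ''inv'')(int i := s2 ''p'' 0)" using 1(2) by (auto simp: s3_def fun_eq_iff)
      have "s4 ''p'' 0 = 4 + int (length (concat (take (Suc i) invs)))"
        using 1(1) p2 ct[of i invs] 6(1) li by (simp add: s3_def)
      moreover have "\<exists>ts. interned s4 ts \<and> set ts = insert zterm (\<Union>l \<in> set (take (Suc i) ls). snd ` invar A l)"
        using 1(1) ts(2) 6(1) by (simp add: take_Suc_conv_app_nth Un_commute)
      moreover have "\<forall>i' < Suc i. guardat ps inp (s4 ''inv'' (int i')) (invar A (ls ! i'))"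
        using G cg sg3 by (auto simp: iv less_Suc_eq guardat_def s3_def)
      ultimately have "P (Suc i) s4" unfolding P_def by blast
      with 1(1) show ?case by (simp add: Pc)
    qed
  next
    case (7 s' \<tau>)
    have "\<tau> \<le> length ls * (TG + 3) + 2" by (rule loop_bound[OF 7(3)]) simp_all
    with 7 show ?case by auto
  qed (simp_all add: s1_def)
  define L2 where "L2 = For ''l'' ''ne'' read_edge"
  have post1: "runs (''ne'' ::= Get ''in'' (V ''p'') ;; ''p'' ::= Add (V ''p'') (Const 1) ;; L2 ;;
     ''tt'' ::= Mul (Const 2) (V ''nt'') ;; ''top'' ::= Sub (V ''tt'') (Const 1)) s2
     (\<lambda>\<tau> s'. \<tau> \<le> length ls * length acs * (TG + 10) + 6 \<and> (\<exists>ts. tables s' ts) \<and> seg inp (s' ''p'' 0) vs)"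
    if P2: "P (length ls) s2" and f2: "\<forall>y. y \<notin> insert ''l'' (insert ''inv'' (writes read_guard)) \<longrightarrow> s2 y = s1 y" for s2
  proof -
    from P2 obtain ts where p2: "s2 ''p'' 0 = 4 + int (length (concat invs))"
      and ts: "interned s2 ts" "set ts = insert zterm (\<Union>l \<in> set ls. snd ` invar A l)"
      and G: "\<forall>i < length ls. guardat ps inp (s2 ''inv'' (int i)) (invar A (ls ! i))" using li by (auto simp: P_def)
    have g2: "s2 ''nl'' 0 = int (length ls)" "s2 ''na'' 0 = int (length acs)" "s2 ''np'' 0 = int m" "s2 ''start'' 0 = int k"
      "s2 ''w1'' 0 = int m + 1" "s2 ''w'' 0 = int m + 2" "s2 ''edge'' = s ''edge''" "s2 ''in'' = inp"
      using f2 s by (simp_all add: s1_def)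
    define s3 where "s3 = s2(''ne'' := (s2 ''ne'')(0 := int (length xs)), ''p'' := (s2 ''p'')(0 := 5 + int (length (concat invs))))"
    define E where "E e t \<longleftrightarrow> (\<forall>i < length ls. \<forall>j < length acs.
      entry_at t i j (Eopt (set (take e xs)) (ls ! i) (acs ! j)))" for e t
    define P' where "P' e t \<longleftrightarrow> t ''p'' 0 = 5 + int (length (concat invs)) + int (length (concat (take e us)))
      \<and> (\<exists>ts'. interned t ts' \<and> set ts' = set ts \<union> (\<Union>(l, g, a, r, l') \<in> set (take e xs). snd ` g))
      \<and> E e t" for e t
    have Pc': "P' i (t(''l'' := y)) \<longleftrightarrow> P' i t" for i t y by (simp add: P'_def E_def interned_def)
    have loop2: "runs L2 s3 (\<lambda>\<tau> s'. \<tau> \<le> length ls * length acs * (TG + 10) + 2 \<and> P' (length xs) s'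
        \<and> (\<forall>y. y \<notin> insert ''l'' (writes read_edge) \<longrightarrow> s' y = s3 y))"
      unfolding L2_def
    proof (rule runs_For[where n = "length xs" and c = "TG + 8" and I = P'], goal_cases)
      case 5
      have "interned (s3(''l'' := (s3 ''l'')(0 := 0))) ts" using ts(1) by (rule interned_cong) (simp add: s3_def)
      moreover have "E 0 (s3(''l'' := (s3 ''l'')(0 := 0)))" using s(2) by (simp add: E_def Eopt_def entry_def s3_def g2)
      ultimately show ?case by (auto simp: P'_def s3_def)
    next
      case (6 e s4)
      from 6(2) obtain ts4 where p4: "s4 ''p'' 0 = 5 + int (length (concat invs)) + int (length (concat (take e us)))"
        and ts4: "interned s4 ts4" "set ts4 = set ts \<union> (\<Union>(l, g, a, r, l') \<in> set (take e xs). snd ` g)"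
        and E4: "E e s4" unfolding P'_def by blast
      obtain l g a r l' where x: "xs ! e = (l, g, a, r, l')" by (metis prod_cases5)
      have xe: "xs ! e \<in> edges A" using es(1) nth_mem[OF 6(1)] unfolding enumerates_def by metis
      have b4: "base s4" using g2 6(4) by (simp add: base_def s3_def)
      have sg4: "seg inp (s4 ''p'' 0) (us ! e)" unfolding p4 using split[OF sg(3)] 6(1) li by simp
      have ce: "code_edge ls acs ps (xs ! e) (us ! e)" using es(2) 6(1) by (simp add: list_all2_conv_all_nth)
      have pp: "0 < s4 ''p'' 0" using p4 by simp
      have na4: "s4 ''na'' 0 = int (length acs)" using g2 6(4) by (simp add: s3_def)
      show ?case
      proof (rule runs_call[OF read_edge[OF b4 ts4(1) sg4 ce x xe pp na4 E4[unfolded E_def]]], goal_cases)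
        case (1 \<tau> s5)
        have tk: "set (take (Suc e) xs) = insert (xs ! e) (set (take e xs))"
          using 6(1) by (simp add: take_Suc_conv_app_nth)
        have "E (Suc e) s5" unfolding E_def tk using 1(1) by blast
        moreover have "s5 ''p'' 0 = 5 + int (length (concat invs)) + int (length (concat (take (Suc e) us)))"
          using 1(1) p4 ct[of e us] 6(1) li by simp
        moreover have "\<exists>ts'. interned s5 ts' \<and> set ts' = set ts \<union> (\<Union>(l, g, a, r, l') \<in> set (take (Suc e) xs). snd ` g)"
        proof -
          from 1(1) obtain ts' where "interned s5 ts'" "set ts' = set ts4 \<union> snd ` g" by blast
          then show ?thesis by (intro exI[of _ ts']) (simp add: tk x ts4(2) Un_ac)
        qed
        ultimately have "P' (Suc e) s5" unfolding P'_def by blast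
        with 1(1) show ?case by (simp add: Pc')
      qed
    next
      case (7 s' \<tau>)
      have "length xs = card (edges A)" using es(1) distinct_card[of xs] unfolding enumerates_def by metis
      then have "\<tau> \<le> length ls * length acs * (TG + 10) + 2"
        using card_edges by (intro loop_bound[OF 7(3)]) simp_all
      with 7 show ?case by auto
    qed (simp_all add: s3_def)
    have sgn: "inp (4 + int (length (concat invs))) = int (length xs)" by (rule sg(2))
    show ?thesis
      apply (simp add: g2 p2 sgn[simplified] s3_def[symmetric])
    proof (rule runs_call[OF loop2], goal_cases)
      case (1 \<tau> s4)
      then obtain ts4 where p4: "s4 ''p'' 0 = 5 + int (length (concat invs)) + int (length (concat us))"
        and ts4: "interned s4 ts4" "set ts4 = set ts \<union> (\<Union>(l, g, a, r, l') \<in> set xs. snd ` g)"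
        and E4: "E (length xs) s4" unfolding P'_def using li by auto
      have T4: "set ts4 = terms A"
        unfolding ts4(2) ts(2) terms_def LT_def using es(1) ls(2) by (simp add: enumerates_def)
      define s5 where "s5 = s4(''tt'' := (s4 ''tt'')(0 := 2 * int (length ts4)), ''top'' := (s4 ''top'')(0 := 2 * int (length ts4) - 1))"
      have f4: "s4 ''nl'' 0 = int (length ls)" "s4 ''na'' 0 = int (length acs)" "s4 ''np'' 0 = int m" "s4 ''start'' 0 = int k"
        "s4 ''w1'' 0 = int m + 1" "s4 ''w'' 0 = int m + 2" "s4 ''in'' = inp" "s4 ''inv'' = s2 ''inv''"
        using 1(1) g2 by (simp_all add: s3_def)
      have Eo: "Eopt (set xs) l a = edge_opt A l a" for l a
        using es(1) by (simp add: Eopt_def edge_opt_def enumerates_def)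
      have "tables s5 ts4"
        unfolding tables_def
      proof (intro conjI)
        show "interned s5 ts4" using ts4(1) by (rule interned_cong) (simp add: s5_def)
        show "\<forall>i < length ls. \<forall>j < length acs.
          entry_at s5 i j (edge_opt A (ls ! i) (acs ! j))"
          using E4 by (simp add: E_def Eo s5_def)
        show "\<exists>k < length ls. ls ! k = start A \<and> s5 ''start'' 0 = int k" using k f4 by (simp add: s5_def)
      qed (use f4 G T4 in \<open>simp_all add: s5_def base_def\<close>)
      moreover have "seg inp (s5 ''p'' 0) vs" using sg(4) by (simp add: s5_def p4)
      moreover have "s4 ''nt'' 0 = int (length ts4)" using ts4(1) by (simp add: interned_def)
      ultimately show ?case using 1(1) by (auto simp: s5_def)
    qed
  qed
  have "runs (L1 ;; (''ne'' ::= Get ''in'' (V ''p'') ;; ''p'' ::= Add (V ''p'') (Const 1) ;; L2 ;;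
     ''tt'' ::= Mul (Const 2) (V ''nt'') ;; ''top'' ::= Sub (V ''tt'') (Const 1))) s1
     (\<lambda>\<tau> s'. \<tau> + 9 \<le> TQ \<and> (\<exists>ts. tables s' ts) \<and> seg inp (s' ''p'' 0) vs)"
    unfolding runs_Seq[of L1]
  proof (rule runs_call[OF loop1], goal_cases)
    case (1 t s2)
    show ?case
      by (rule runs_call[OF post1]) (use 1(1) in \<open>auto simp: TQ_def\<close>)
  qed
  then show ?thesis
    unfolding parse_def L1_def[symmetric] L2_def[symmetric]
    apply (simp add: s hd posk s1_def[symmetric])
    apply (erule runs_call)
    apply (erule runs_call)
    apply simp
    done
qed

end

section \<open>Enumerating the rank functions\<close>

text \<open>All terms are evaluated over the same denominator \<open>dn\<close>, so it suffices to compare numerators.\<close>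

definition evaluate :: prog where
  "evaluate =
     For ''i'' ''nt'' (
       ''acc'' ::= Const 0 ;;
       ''dn'' ::= Const 1 ;;
       For ''q'' ''np'' (
         ''x'' ::= Get ''in'' (Add (V ''p'') (Mul (Const 2) (V ''q''))) ;;
         ''y'' ::= Get ''in'' (Add (V ''p'') (Add (Mul (Const 2) (V ''q'')) (Const 1))) ;;
         ''acc'' ::= Add (Mul (V ''acc'') (V ''y''))
            (Mul (Mul (Get ''in'' (Add (Get ''adr'' (V ''i'')) (V ''q''))) (V ''x'')) (V ''dn'')) ;;
         ''dn'' ::= Mul (V ''dn'') (V ''y'')) ;;
       Put ''val'' (V ''i'') (Add (V ''acc'') (Mul (Get ''in'' (Add (Get ''adr'' (V ''i'')) (V ''np''))) (V ''dn''))))"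

text \<open>Counting the smaller entries gives ranks without sorting, with equal ranks for equal
  values. The same loop sets the candidate ranks to 0, the initial value of the counter.\<close>

definition rank_terms :: prog where
  "rank_terms =
     For ''i'' ''nt'' (
       ''c'' ::= Const 0 ;;
       For ''j'' ''nt'' (
         Cond (Less (Get ''val'' (V ''j'')) (Get ''val'' (V ''i''))) (''c'' ::= Add (V ''c'') (Const 1)) Skip) ;;
       Put ''rk'' (V ''i'') (V ''c'') ;;
       Put ''rk'' (Add (V ''nt'') (V ''i'')) (Const 0))"

definition count_ranks :: prog where
  "count_ranks = (''tot'' ::= Const 1 ;; For ''i'' ''nt'' (''tot'' ::= Mul (V ''tot'') (V ''nt'')))"

text \<open>The candidate ranks are the digits of a counter in base \<open>nt\<close>; \<open>f\<close> is the carry.\<close>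

definition next_ranks :: prog where
  "next_ranks = (
     ''f'' ::= Const 1 ;;
     For ''i'' ''nt'' (
       Cond (Less (Const 0) (V ''f''))
         (Cond (Less (Add (Get ''rk'' (Add (V ''nt'') (V ''i''))) (Const 1)) (V ''nt''))
           (Put ''rk'' (Add (V ''nt'') (V ''i'')) (Add (Get ''rk'' (Add (V ''nt'') (V ''i''))) (Const 1)) ;; ''f'' ::= Const 0)
           (Put ''rk'' (Add (V ''nt'') (V ''i'')) (Const 0)))
         Skip))"

definition out :: "exp \<Rightarrow> prog" where
  "out e = (Put ''out'' (V ''op'') e ;; ''op'' ::= Add (V ''op'') (Const 1))"

text \<open>All ordered pairs of terms are written, so the length \<open>nt * nt\<close> of the
  clause is known in advance and can precede it. The values 0, 4 and 2 assigned to \<open>o\<close>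
  are the codes of \<open>Lt\<close>, \<open>Gt\<close> and \<open>Eq\<close>.\<close>

definition emit :: prog where
  "emit = (
     ''cnt'' ::= Add (V ''cnt'') (Const 1) ;;
     out (Mul (V ''nt'') (V ''nt'')) ;;
     For ''i'' ''nt'' (For ''j'' ''nt'' (
       ''x'' ::= Get ''rk'' (Add (V ''nt'') (V ''i'')) ;;
       ''y'' ::= Get ''rk'' (Add (V ''nt'') (V ''j'')) ;;
       Cond (Less (V ''x'') (V ''y'')) (''o'' ::= Const 0)
         (Cond (Less (V ''y'') (V ''x'')) (''o'' ::= Const 4) (''o'' ::= Const 2)) ;;
       out (V ''o'') ;;
       For ''q'' ''w1'' (out (Sub (Get ''in'' (Add (Get ''adr'' (V ''i'')) (V ''q''))) (Get ''in'' (Add (Get ''adr'' (V ''j'')) (V ''q''))))))))"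

text \<open>The number of clauses is known only at the end, so output starts at cell 1 and cell 0 is
  filled last.\<close>

definition synth :: prog where
  "synth = (
     parse ;; evaluate ;; rank_terms ;; count_ranks ;;
     ''cnt'' ::= Const 0 ;; ''op'' ::= Const 1 ;;
     For ''n'' ''tot'' (explore ;; Cond (Less (Const 0) (V ''ok'')) emit Skip ;; next_ranks) ;;
     Put ''out'' (Const 0) (V ''cnt''))"

lemmas writes_evaluate [simp] = arg_cong[OF evaluate_def, of writes, unfolded writes.simps writes_For]
lemmas writes_rank_terms [simp] = arg_cong[OF rank_terms_def, of writes, unfolded writes.simps writes_For]
lemmas writes_count_ranks [simp] = arg_cong[OF count_ranks_def, of writes, unfolded writes.simps writes_For]
lemmas writes_next_ranks [simp] = arg_cong[OF next_ranks_def, of writes, unfolded writes.simps writes_For]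
lemma writes_out [simp]: "writes (out e) = {''out'', ''op''}"
  by (auto simp: out_def)
lemmas writes_emit [simp] = arg_cong[OF emit_def, of writes, unfolded writes.simps writes_For]

section \<open>Counting in base N\<close>

definition digit :: "nat \<Rightarrow> nat \<Rightarrow> nat \<Rightarrow> nat" where
  "digit N c i = c div N ^ i mod N"

text \<open>Existence of base \<open>N\<close> representations, by adding a leading digit: it
  guarantees that the counter meets every rank function.\<close>

lemma digits_surj:
  assumes "\<And>i. i < n \<Longrightarrow> f i < N" "0 < N"
  shows "\<exists>c < N ^ n. \<forall>i < n. digit N c i = f i"
  using assms(1)
proof (induction n)
  case (Suc n)
  then obtain c where c: "c < N ^ n" "\<forall>i < n. digit N c i = f i" by auto
  define d where "d = c + f n * N ^ n"
  have "d < N ^ n + f n * N ^ n" using c(1) by (simp add: d_def)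
  also have "\<dots> = (f n + 1) * N ^ n" by simp
  also have "\<dots> \<le> N * N ^ n" using Suc.prems[of n] by (intro mult_right_mono) auto
  finally have "d < N ^ Suc n" by simp
  moreover have "digit N d i = f i" if "i < Suc n" for i
  proof (cases "i = n")
    case True
    with c(1) Suc.prems[of n] assms(2) show ?thesis by (simp add: digit_def d_def)
  next
    case False
    define j where "j = n - Suc i"
    have j: "n = i + Suc j" using that False by (simp add: j_def)
    have "d div N ^ i = c div N ^ i + f n * N ^ Suc j"
    proof -
      have "d = c + (f n * N ^ Suc j) * N ^ i" by (simp add: d_def j power_add ac_simps)
      then show ?thesis using assms(2) by simp
    qed
    then have "digit N d i = digit N c i" by (simp add: digit_def mult.left_commute[of "f n"])
    with c(2) False that show ?thesis by simp
  qed
  ultimately show ?case by blast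
qed auto

lemma div_Suc_not_dvd: "\<not> k dvd Suc c \<Longrightarrow> Suc c div k = c div k"
  by (metis div_Suc dvd_eq_mod_eq_0)

lemma div_Suc_dvd: "k dvd Suc c \<Longrightarrow> Suc c div k = Suc (c div k)"
  by (metis div_Suc dvd_eq_mod_eq_0)

lemma mod_Suc_cases:
  fixes N :: nat
  assumes "0 < N"
  shows "Suc x mod N = (if x mod N + 1 < N then x mod N + 1 else 0)"
proof (cases "Suc (x mod N) = N")
  case True
  then have "\<not> x mod N + 1 < N" by linarith
  with True show ?thesis by (simp add: mod_Suc)
next
  case False
  with mod_less_divisor[OF assms, of x] have "x mod N + 1 < N" by linarith
  with False show ?thesis by (simp add: mod_Suc)
qed

context coded
begin

definition "TR = X * (X * 6 + 12) + 10"

text \<open>The carry reaches digit \<open>i\<close> exactly if all lower digits wrap around, that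
  is, if \<open>N ^ i\<close> divides \<open>Suc c\<close>; this is the invariant for
  \<open>f\<close>.\<close>

lemma next_ranks:
  assumes nt: "s ''nt'' 0 = int N" "0 < N" "N \<le> X"
    and rk: "\<forall>i < N. s ''rk'' (int N + int i) = int (digit N c i)"
  shows "runs next_ranks s (\<lambda>\<tau> s'. \<tau> \<le> X * 7 + 3
    \<and> (\<forall>i < N. s' ''rk'' (int N + int i) = int (digit N (Suc c) i))
    \<and> (\<forall>i < int N. s' ''rk'' i = s ''rk'' i))"
  unfolding next_ranks_def runs_Seq runs_Put
proof (rule runs_For[where n = N and c = 5 and I = "\<lambda>i s'.
      s' ''f'' 0 = of_bool (N ^ i dvd Suc c)
    \<and> (\<forall>j < N. s' ''rk'' (int N + int j) = int (if j < i then digit N (Suc c) j else digit N c j))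
    \<and> (\<forall>j < int N. s' ''rk'' j = s ''rk'' j)"], goal_cases)
  case (6 i s')
  have f: "s' ''nt'' 0 = int N" "s' ''i'' 0 = int i" using 6(3,4) nt by simp_all
  have rki: "s' ''rk'' (int N + int i) = int (digit N c i)" using 6(1,2) by simp
  \<comment> \<open>The carry is passed on exactly if it has arrived and the new digit is 0.\<close>
  have rest: "N ^ Suc i dvd Suc c \<longleftrightarrow> N ^ i dvd Suc c \<and> digit N (Suc c) i = 0"
  proof -
    have "N ^ Suc i dvd Suc c \<longleftrightarrow> N ^ i dvd Suc c \<and> N dvd Suc c div N ^ i"
      using nt(2) by (metis dvd_div_iff_mult dvd_mult_left power_Suc2 power_not_zero mult.commute not_gr_zero)
    then show ?thesis by (simp add: digit_def dvd_eq_mod_eq_0)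
  qed
  show ?case
  proof (cases "N ^ i dvd Suc c")
    case False
    then have "digit N (Suc c) i = digit N c i" by (simp add: digit_def div_Suc_not_dvd)
    with False rest 6(2) f show ?thesis by (auto simp: less_Suc_eq)
  next
    case True
    then have d: "digit N (Suc c) i = (if digit N c i + 1 < N then digit N c i + 1 else 0)"
      by (simp only: digit_def div_Suc_dvd mod_Suc_cases[OF nt(2)])
    show ?thesis
    proof (cases "digit N c i + 1 < N")
      case lt: True
      then have "int (digit N c i) + 1 < int N" by simp
      with lt True rest d 6(2) f show ?thesis by (auto simp: less_Suc_eq rki)
    next
      case False
      then have "\<not> int (digit N c i) + 1 < int N" by simp
      with False True rest d 6(2) f show ?thesis by (auto simp: less_Suc_eq rki)
    qed
  qed
next
  case (7 s' \<tau>)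
  have "\<tau> \<le> X * 7 + 2" by (rule loop_bound[OF 7(3)]) (use nt in simp_all)
  with 7(1) show ?case by auto
qed (use nt rk in auto)

lemma count_ranks:
  assumes nt: "s ''nt'' 0 = int N" "N \<le> X"
  shows "runs count_ranks s (\<lambda>\<tau> s'. \<tau> \<le> X * 3 + 3 \<and> s' ''tot'' 0 = int (N ^ N))"
  unfolding count_ranks_def runs_Seq runs_Put
proof (rule runs_For[where n = N and c = 1 and I = "\<lambda>i s'. s' ''tot'' 0 = int (N ^ i)"], goal_cases)
  case (6 i s')
  then have "s' ''nt'' 0 = int N" using nt by simp
  with 6 show ?case by (simp add: mult.commute)
next
  case (7 s' \<tau>)
  have "\<tau> \<le> X * 3 + 2" by (rule loop_bound[OF 7(3)]) (use nt in simp_all)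
  with 7 show ?case by simp
qed (use nt in auto)

lemma rank_terms:
  assumes nt: "s ''nt'' 0 = int N" "N \<le> X"
  shows "runs rank_terms s (\<lambda>\<tau> s'. \<tau> \<le> TR
    \<and> (\<forall>i < N. s' ''rk'' (int i) = int (card {j. j < N \<and> s ''val'' (int j) < s ''val'' (int i)}))
    \<and> (\<forall>i < N. s' ''rk'' (int N + int i) = 0))"
  unfolding rank_terms_def
proof (rule runs_For[where n = N and c = "X * 4 + 5 + 2" and I = "\<lambda>i s'.
    (\<forall>i' < i. s' ''rk'' (int i') = int (card {j. j < N \<and> s ''val'' (int j) < s ''val'' (int i')}))
    \<and> (\<forall>i' < i. s' ''rk'' (int N + int i') = 0)"], goal_cases)
  case (6 i s')
  have f: "s' ''nt'' 0 = int N" "s' ''val'' = s ''val''" using 6(4) nt by simp_all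
  show ?case
    unfolding runs_Seq runs_Put
  proof (rule runs_For[where n = N and c = 2 and I = "\<lambda>k s''.
      s'' ''c'' 0 = int (card {j. j < k \<and> s ''val'' (int j) < s ''val'' (int i)})"], goal_cases)
    case (6 k s'')
    have g: "s'' ''val'' = s ''val''" "s'' ''i'' 0 = int i"
      using 6(4) f \<open>s' ''i'' 0 = int i\<close> by simp_all
    have "{j. j < Suc k \<and> s ''val'' (int j) < s ''val'' (int i)} =
      (if s ''val'' (int k) < s ''val'' (int i) then insert k else id) {j. j < k \<and> s ''val'' (int j) < s ''val'' (int i)}"
      by (auto simp: less_Suc_eq)
    with 6(2,3) g show ?case by simp
  next
    case (7 s'' \<tau>)
    have "\<tau> \<le> X * 4 + 2" by (rule loop_bound[OF 7(3)]) (use nt in simp_all)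
    moreover have "s'' ''nt'' 0 = int N" "s'' ''i'' 0 = int i" "s'' ''rk'' = s' ''rk''"
      using 7(2) f \<open>s' ''i'' 0 = int i\<close> by simp_all
    ultimately show ?case using 7(1) \<open>(\<forall>i' < i. _) \<and> _\<close> \<open>i < N\<close> by (auto simp: less_Suc_eq)
  qed (use f in auto)
next
  case (7 s' \<tau>)
  have "\<tau> \<le> X * (X * 4 + 5 + 2 + 2) + 2" by (rule loop_bound[OF 7(3)]) (use nt in simp_all)
  also have "\<dots> \<le> TR" by (simp add: TR_def algebra_simps)
  finally show ?case using 7(1) by blast
qed (use nt in auto)

definition evaluates :: "memory \<Rightarrow> 'p lterm list \<Rightarrow> ('p \<Rightarrow> rat) \<Rightarrow> bool" where
  "evaluates s ts v \<longleftrightarrow> (\<exists>d > 0. \<forall>i < length ts. of_int (s ''val'' (int i)) = d * eval_lterm (params A) v (ts ! i))"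

lemma evaluate:
  assumes T: "tables s ts" and v: "seg inp (s ''p'' 0) (valuation_code ps v)"
  shows "runs evaluate s (\<lambda>\<tau> s'. \<tau> \<le> X * (m * 6 + 10) + 2 \<and> evaluates s' ts v)"
proof -
  have nt: "s ''nt'' 0 = int (length ts)" "s ''np'' 0 = int m" "s ''in'' = inp" using T by (simp_all add: tables_def interned_def base_def)
  have vp: "inp (s ''p'' 0 + 2 * int q) = fst (quotient_of (v (ps ! q)))" "inp (s ''p'' 0 + (2 * int q + 1)) = snd (quotient_of (v (ps ! q)))"
    if "q < m" for q
  proof -
    have "seg inp (s ''p'' 0 + int q * int 2) (map (\<lambda>p. [fst (quotient_of (v p)), snd (quotient_of (v p))]) ps ! q)"
      using v that unfolding valuation_code_def by (intro seg_concat_nth) auto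
    then show "inp (s ''p'' 0 + 2 * int q) = fst (quotient_of (v (ps ! q)))" "inp (s ''p'' 0 + (2 * int q + 1)) = snd (quotient_of (v (ps ! q)))"
      using that by (simp_all add: seg_Cons algebra_simps)
  qed
  define den where "den q = snd (quotient_of (v (ps ! q)))" for q
  have dpos: "den q > 0" for q unfolding den_def by (rule quotient_of_denom_pos')
  have vq: "v (ps ! q) * of_int (den q) = of_int (fst (quotient_of (v (ps ! q))))" for q
    using quotient_of_div[of "v (ps ! q)" "fst (quotient_of (v (ps ! q)))" "den q"] dpos[of q]
    by (simp add: den_def field_simps)
  \<comment> \<open>The value of \<open>dn\<close> after \<open>q\<close> parameters. It does not
    depend on the term being evaluated, so \<open>D m\<close> is a common positive denominator and
    comparing numerators compares the terms.\<close>
  define D where "D q = (\<Prod>q' < q. den q')" for q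
  have Dpos: "D q > 0" for q unfolding D_def using dpos by (intro prod_pos) auto
  define P where "P i s' \<longleftrightarrow> (\<forall>i' < i. of_int (s' ''val'' (int i')) = of_int (D m) * eval_lterm (params A) v (ts ! i'))" for i s'
  show ?thesis
    unfolding evaluate_def
  proof (rule runs_For[where n = "length ts" and c = "m * 6 + 5 + 2" and I = P], goal_cases)
    case (6 i s')
    obtain \<alpha> c where t: "ts ! i = (\<alpha>, c)" by (metis prod.exhaust)
    have f: "s' ''np'' 0 = int m" "s' ''in'' = inp" "s' ''adr'' = s ''adr''" "s' ''p'' = s ''p''" using 6(4) nt by simp_all
    have sg: "seg inp (s ''adr'' (int i)) (map \<alpha> ps @ [c])"
      using T 6(1) t by (force simp: tables_def interned_def tcode_def)
    have al: "inp (s ''adr'' (int i) + int q) = \<alpha> (ps ! q)" if "q < m" for q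
      using sg that by (auto simp: seg_def nth_append)
    have cc: "inp (s ''adr'' (int i) + int m) = c" using sg by (auto simp: seg_append seg_Cons)
    show ?case
      unfolding runs_Seq runs_Put
    proof (rule runs_For[where n = m and c = 4 and I = "\<lambda>q s''. s'' ''dn'' 0 = D q \<and>
        rat_of_int (s'' ''acc'' 0) = of_int (D q) * (\<Sum>q' < q. of_int (\<alpha> (ps ! q')) * v (ps ! q'))"], goal_cases)
      case (6 q s'')
      have g: "s'' ''in'' = inp" "s'' ''adr'' = s ''adr''" "s'' ''p'' = s ''p''" "s'' ''i'' 0 = int i"
        using 6(4) f \<open>s' ''i'' 0 = int i\<close> by simp_all
      have D: "D (Suc q) = D q * den q" by (simp add: D_def)
      have "rat_of_int (s'' ''acc'' 0 * den q + \<alpha> (ps ! q) * fst (quotient_of (v (ps ! q))) * D q)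
          = of_int (D (Suc q)) * (\<Sum>q' < Suc q. of_int (\<alpha> (ps ! q')) * v (ps ! q'))"
        using 6(2) by (simp add: D vq[symmetric] algebra_simps)
      with 6(1-3) show ?case by (simp add: g vp al den_def[symmetric] D)
    next
      case (7 s'' \<tau>)
      have g: "s'' ''in'' = inp" "s'' ''adr'' = s ''adr''" "s'' ''i'' 0 = int i" "s'' ''val'' = s' ''val''" "s'' ''np'' 0 = int m"
        using 7(2) f \<open>s' ''i'' 0 = int i\<close> by simp_all
      have "eval_lterm (params A) v (ts ! i) = (\<Sum>q < m. of_int (\<alpha> (ps ! q)) * v (ps ! q)) + of_int c"
      proof -
        have "(\<Sum>p \<in> params A. of_int (\<alpha> p) * v p) = (\<Sum>p \<leftarrow> ps. of_int (\<alpha> p) * v p)"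
          using ps by (simp add: sum_list_distinct_conv_sum_set)
        also have "\<dots> = (\<Sum>q < m. of_int (\<alpha> (ps ! q)) * v (ps ! q))"
          by (simp add: sum_list_sum_nth atLeast0LessThan)
        finally show ?thesis by (simp add: eval_lterm_def t)
      qed
      then have "rat_of_int (s'' ''acc'' 0 + c * s'' ''dn'' 0) = of_int (D m) * eval_lterm (params A) v (ts ! i)"
        using 7(1) by (simp add: algebra_simps)
      with 7(3) \<open>P i s'\<close> show ?case
        by (auto simp: g cc P_def less_Suc_eq)
    qed (use f in \<open>auto simp: D_def\<close>)
  next
    case (7 s' \<tau>)
    have "\<tau> \<le> X * (m * 6 + 5 + 2 + 2) + 2"
      by (rule loop_bound[OF 7(3)]) (use length_interned[OF tablesD(2)[OF T]] in simp_all)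
    also have "\<dots> \<le> X * (m * 6 + 10) + 2" by simp
    finally have "\<tau> \<le> X * (m * 6 + 10) + 2" .
    moreover have "evaluates s' ts v"
      unfolding evaluates_def using 7(1) Dpos by (intro exI[of _ "of_int (D m)"]) (simp add: P_def)
    ultimately show ?case by simp
  qed (use nt in \<open>auto simp: P_def\<close>)
qed

end

section \<open>The order of the terms as a conjunction of linear constraints\<close>

definition order_cmp :: "int \<Rightarrow> int \<Rightarrow> cmp" where
  "order_cmp x y = (if x < y then Lt else if y < x then Gt else Eq)"

definition term_diff :: "'p lterm \<Rightarrow> 'p lterm \<Rightarrow> 'p lterm" where
  "term_diff t u = (\<lambda>p. fst t p - fst u p, snd t - snd u)"

definition order_row :: "'p lterm list \<Rightarrow> ('p lterm \<Rightarrow> int) \<Rightarrow> 'p lterm \<Rightarrow> (cmp \<times> 'p lterm) list" where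
  "order_row ts S t = map (\<lambda>u. (order_cmp (S t) (S u), term_diff t u)) ts"

definition order_clause :: "'p lterm list \<Rightarrow> ('p lterm \<Rightarrow> int) \<Rightarrow> (cmp \<times> 'p lterm) list" where
  "order_clause ts S = concat (map (order_row ts S) ts)"

lemma eval_term_diff: "eval_lterm P v (term_diff t u) = eval_lterm P v t - eval_lterm P v u"
  by (simp add: eval_lterm_def term_diff_def algebra_simps sum_subtractf split: prod.splits)

lemma holds_order_cmp:
  fixes x y :: rat
  shows "holds (order_cmp a b) (x - y) 0 \<longleftrightarrow> (x < y \<longleftrightarrow> a < b) \<and> (y < x \<longleftrightarrow> b < a)"
  by (cases a b rule: linorder_cases) (auto simp: order_cmp_def)

text \<open>Each constraint prescribes the sign of the difference of two terms; over all ordered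
  pairs these signs amount to the order given by \<open>S\<close>. Hence the clause of a rank
  function that cannot be realised is unsatisfiable.\<close>

lemma order_clause_iff:
  assumes "set ts = terms A"
  shows "(\<forall>(c, t) \<in> set (order_clause ts S). holds c (eval_lterm (params A) v t) 0) \<longleftrightarrow> ranks A v S"
proof -
  let ?e = "eval_lterm (params A) v"
  have h: "holds (order_cmp (S t) (S u)) (?e (term_diff t u)) 0 \<longleftrightarrow> (?e t < ?e u \<longleftrightarrow> S t < S u) \<and> (?e u < ?e t \<longleftrightarrow> S u < S t)" for t u
    unfolding eval_term_diff by (rule holds_order_cmp)
  have "set (order_clause ts S) = (\<lambda>(t, u). (order_cmp (S t) (S u), term_diff t u)) ` (terms A \<times> terms A)"
    using assms by (force simp: order_clause_def order_row_def)
  then have "(\<forall>(c, t) \<in> set (order_clause ts S). holds c (?e t) 0)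
      \<longleftrightarrow> (\<forall>x \<in> terms A \<times> terms A. holds (order_cmp (S (fst x)) (S (snd x))) (?e (term_diff (fst x) (snd x))) 0)"
    by (simp only: ball_simps split_beta fst_conv snd_conv)
  also have "\<dots> \<longleftrightarrow> (\<forall>t \<in> terms A. \<forall>u \<in> terms A. holds (order_cmp (S t) (S u)) (?e (term_diff t u)) 0)"
    by (metis (no_types, lifting) SigmaE SigmaI fst_conv snd_conv)
  finally show ?thesis unfolding h ranks_def by metis
qed

lemma length_order_clause: "length (order_clause ts S) = length ts * length ts"
proof -
  have "length (concat (map (order_row ts S) us)) = length us * length ts" for us
    by (induction us) (auto simp: order_row_def)
  then show ?thesis by (simp add: order_clause_def)
qed

definition written :: "memory \<Rightarrow> int list \<Rightarrow> bool" where
  "written s us \<longleftrightarrow> s ''op'' 0 = 1 + int (length us) \<and> seg (s ''out'') 1 us"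

lemma seg_update: "p + int (length us) \<le> x \<Longrightarrow> seg (f(x := y)) p us \<longleftrightarrow> seg f p us"
  by (auto simp: seg_def)

lemma out:
  assumes "written s us" "exp_val e s = y"
  shows "runs (out e) s (\<lambda>\<tau> s'. \<tau> = 2 \<and> written s' (us @ [y]))"
  using assms by (simp add: out_def written_def seg_append seg_update seg_Cons ac_simps)

context coded
begin

definition "TM = X * (X * (4 * m + 17) + 4) + 10"

lemma tcode_term_diff: "q < m + 1 \<Longrightarrow> tcode ps (term_diff t u) ! q = tcode ps t ! q - tcode ps u ! q"
  by (auto simp: tcode_def term_diff_def nth_append)

lemma emit:
  assumes T: "tables s ts" and S: "ranked_at s ts (int (length ts)) S" and w: "written s us"
  shows "runs emit s (\<lambda>\<tau> s'. \<tau> \<le> TM \<and> s' ''cnt'' 0 = s ''cnt'' 0 + 1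
    \<and> written s' (us @ list_code (constraint_code ps) (order_clause ts S)))"
proof -
  define N where "N = length ts"
  have NX: "N \<le> X" unfolding N_def by (rule length_interned[OF tablesD(2)[OF T]])
  have nt: "s ''nt'' 0 = int N" "s ''in'' = inp" "s ''w1'' 0 = int (m + 1)"
    using T by (simp_all add: N_def tables_def interned_def base_def)
  have rk: "s ''rk'' (int N + int i) = S (ts ! i)" if "i < N" for i
    using S that by (simp add: ranked_at_def N_def)
  have ad: "inp (s ''adr'' (int i) + int q) = tcode ps (ts ! i) ! q" if "i < N" "q < m + 1" for i q
    using T that by (auto simp: tables_def interned_def seg_def N_def)
  define us1 where "us1 = us @ [int (length (order_clause ts S))]"
  define row where "row t = concat (map (constraint_code ps) (order_row ts S t))" for t
  define I where "I i s' \<longleftrightarrow> written s' (us1 @ concat (map row (take i ts)))" for i s'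
  define s1 where "s1 = s(''cnt'' := (s ''cnt'')(0 := s ''cnt'' 0 + 1))"
  have w1: "written s1 us" using w by (simp add: written_def s1_def)
  have sz: "exp_val (Mul (V ''nt'') (V ''nt'')) s1 = int (length (order_clause ts S))"
    by (simp add: s1_def nt length_order_clause N_def[symmetric])
  show ?thesis
    unfolding emit_def
    apply (simp add: s1_def[symmetric])
  proof (rule runs_call[OF out[OF w1 sz]], goal_cases)
    case (1 \<tau>0 s2)
    have w2: "written s2 us1" using 1(1) by (simp add: us1_def)
    have t0: "\<tau>0 = 2" using 1(1) by simp
    have f2: "s2 ''nt'' 0 = int N" "s2 ''in'' = inp" "s2 ''w1'' 0 = int (m + 1)" "s2 ''rk'' = s ''rk''" "s2 ''adr'' = s ''adr''"
      "s2 ''cnt'' 0 = s ''cnt'' 0 + 1"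
      using 1(2) nt by (simp_all add: s1_def)
    show ?case
    proof (rule runs_For[where n = N and c = "X * (4 * m + 17) + 2" and I = I], goal_cases)
      case 5
      then show ?case using w2 by (simp add: I_def written_def)
    next
      case (6 i s3)
      have f3: "s3 ''nt'' 0 = int N" "s3 ''in'' = inp" "s3 ''w1'' 0 = int (m + 1)" "s3 ''rk'' = s ''rk''" "s3 ''adr'' = s ''adr''"
        "s3 ''i'' 0 = int i"
        using 6(3,4) f2 by simp_all
      define us3 where "us3 = us1 @ concat (map row (take i ts))"
      define c where "c j = constraint_code ps (order_cmp (S (ts ! i)) (S (ts ! j)), term_diff (ts ! i) (ts ! j))" for j
      define J where "J j s' \<longleftrightarrow> written s' (us3 @ concat (map c [0..<j]))" for j s'
      show ?case
      proof (rule runs_For[where n = N and c = "4 * m + 15" and I = J], goal_cases)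
        case 5
        then show ?case using 6(2) by (simp add: I_def J_def us3_def written_def)
      next
        case (6 j s4)
        have f4: "s4 ''nt'' 0 = int N" "s4 ''in'' = inp" "s4 ''w1'' 0 = int (m + 1)" "s4 ''rk'' = s ''rk''" "s4 ''adr'' = s ''adr''"
          "s4 ''i'' 0 = int i" "s4 ''j'' 0 = int j"
          using 6(3,4) f3 by simp_all
        define us4 where "us4 = us3 @ concat (map c [0..<j])"
        define o' where "o' = cmp_code (order_cmp (S (ts ! i)) (S (ts ! j)))"
        define s5 where "s5 = s4(''x'' := (s4 ''x'')(0 := S (ts ! i)), ''y'' := (s4 ''y'')(0 := S (ts ! j)), ''o'' := (s4 ''o'')(0 := o'))"
        have w5: "written s5 us4" using 6(2) by (simp add: J_def us4_def written_def s5_def)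
        have o5: "exp_val (V ''o'') s5 = o'" by (simp add: s5_def)
        have f5: "s5 ''in'' = inp" "s5 ''w1'' 0 = int (m + 1)" "s5 ''adr'' = s ''adr''" "s5 ''i'' 0 = int i" "s5 ''j'' 0 = int j"
          using f4 by (simp_all add: s5_def)
        have "runs (out (V ''o'') ;;
           For ''q'' ''w1'' (out (Sub (Get ''in'' (Add (Get ''adr'' (V ''i'')) (V ''q''))) (Get ''in'' (Add (Get ''adr'' (V ''j'')) (V ''q''))))))
           s5 (\<lambda>\<tau> s'. \<tau> \<le> 4 * m + 8 \<and> written s' (us4 @ c j))"
          unfolding runs_Seq
        proof (rule runs_call[OF out[OF w5 o5]], goal_cases)
          case (1 \<tau>1 s6)
          have f6: "s6 ''in'' = inp" "s6 ''w1'' 0 = int (m + 1)" "s6 ''adr'' = s ''adr''" "s6 ''i'' 0 = int i" "s6 ''j'' 0 = int j"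
            using 1(2) f5 by simp_all
          have w6: "written s6 (us4 @ [o'])" "\<tau>1 = 2" using 1(1) by simp_all
          define tc where "tc = tcode ps (term_diff (ts ! i) (ts ! j))"
          show ?case
          proof (rule runs_For[where n = "m + 1" and c = 2 and I = "\<lambda>q s'. written s' ((us4 @ [o']) @ take q tc)"], goal_cases)
            case 5
            then show ?case using w6 by (simp add: written_def)
          next
            case (6 q s7)
            have f7: "s7 ''in'' = inp" "s7 ''adr'' = s ''adr''" "s7 ''i'' 0 = int i" "s7 ''j'' 0 = int j" "s7 ''q'' 0 = int q"
              using 6(3,4) f6 by simp_all
            have e: "exp_val (Sub (Get ''in'' (Add (Get ''adr'' (V ''i'')) (V ''q''))) (Get ''in'' (Add (Get ''adr'' (V ''j'')) (V ''q'')))) s7 = tc ! q"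
              using ad \<open>i < N\<close> \<open>j < N\<close> 6(1) by (simp add: f7 tc_def tcode_term_diff)
            have tk: "take (Suc q) tc = take q tc @ [tc ! q]" using 6(1) by (simp add: tc_def take_Suc_conv_app_nth)
            show ?case
            proof (rule runs_call[OF out[OF 6(2) e]], goal_cases)
              case (1 \<tau> s8)
              then show ?case unfolding tk by (simp add: written_def)
            qed
          next
            case (7 s' \<tau>)
            have "c j = o' # tc" by (simp add: c_def constraint_code_tcode o'_def tc_def)
            with 7(1,3) w6 show ?case by (simp add: tc_def)
          qed (use f6 in auto)
        qed
        then have "runs (''x'' ::= Get ''rk'' (Add (V ''nt'') (V ''i'')) ;;
           ''y'' ::= Get ''rk'' (Add (V ''nt'') (V ''j'')) ;;
           Cond (Less (V ''x'') (V ''y'')) (''o'' ::= Const 0)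
             (Cond (Less (V ''y'') (V ''x'')) (''o'' ::= Const 4) (''o'' ::= Const 2)) ;;
           out (V ''o'') ;;
           For ''q'' ''w1'' (out (Sub (Get ''in'' (Add (Get ''adr'' (V ''i'')) (V ''q''))) (Get ''in'' (Add (Get ''adr'' (V ''j'')) (V ''q''))))))
           s4 (\<lambda>\<tau> s'. \<tau> \<le> 4 * m + 15 \<and> written s' (us4 @ c j))"
          apply (simp add: f4 rk \<open>i < N\<close> \<open>j < N\<close> s5_def o'_def order_cmp_def)
          apply (intro conjI impI; simp)
            apply ((erule runs_call)+, simp)+
          done
        then show ?case
          by (rule runs_call) (simp add: J_def us4_def written_def)
      next
        case (7 s' \<tau>)
        have "\<tau> \<le> X * (4 * m + 17) + 2" by (rule loop_bound[OF 7(3)]) (use NX in simp_all)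
        moreover have "map c [0..<N] = map (constraint_code ps) (order_row ts S (ts ! i))"
          by (rule nth_equalityI) (simp_all add: N_def order_row_def c_def)
        ultimately show ?case
          using 7(1) 6(1) by (simp add: I_def J_def us3_def take_Suc_conv_app_nth N_def row_def written_def)
      qed (use f3 in auto)
    next
      case (7 s' \<tau>)
      have "\<tau> \<le> X * (X * (4 * m + 17) + 4) + 2" by (rule loop_bound[OF 7(3)]) (use NX in simp_all)
      moreover have "s' ''cnt'' 0 = s ''cnt'' 0 + 1" using 7(2) f2 by simp
      moreover have "us1 @ concat (map row ts) = us @ list_code (constraint_code ps) (order_clause ts S)"
      proof -
        have "concat (map row vs) = concat (map (constraint_code ps) (concat (map (order_row ts S) vs)))" for vs
          by (induction vs) (auto simp: row_def)
        then show ?thesis by (simp add: us1_def list_code_def order_clause_def)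
      qed
      ultimately show ?case using 7(1) t0 by (simp add: I_def N_def TM_def)
    qed (use f2 in auto)
  qed
qed

end

section \<open>From candidate rank functions to the set of valuations\<close>

definition term_index :: "'p lterm list \<Rightarrow> 'p lterm \<Rightarrow> nat" where
  "term_index ts t = (THE i. i < length ts \<and> ts ! i = t)"

definition candidate :: "'p lterm list \<Rightarrow> nat \<Rightarrow> 'p lterm \<Rightarrow> int" where
  "candidate ts c t = int (digit (length ts) c (term_index ts t))"

lemma candidate_nth:
  assumes "distinct ts" "i < length ts"
  shows "candidate ts c (ts ! i) = int (digit (length ts) c i)"
proof -
  have "term_index ts (ts ! i) = i"
    unfolding term_index_def using assms by (intro the_equality) (auto simp: nth_eq_iff_index_eq)
  then show ?thesis by (simp add: candidate_def)
qed

lemma candidate_bounds: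
  assumes "ts \<noteq> []"
  shows "0 \<le> candidate ts c t" "candidate ts c t < int (length ts)"
  using assms by (simp_all add: candidate_def digit_def)

definition accepted :: "('l, 'a, 'p) pta \<Rightarrow> 'p lterm list \<Rightarrow> ('p lterm \<Rightarrow> int) \<Rightarrow> nat \<Rightarrow> 'p dnf" where
  "accepted A ts R n = map (\<lambda>c. order_clause ts (candidate ts c))
     (filter (\<lambda>c. same_lang A (2 * int (length ts) - 1) R (candidate ts c)) [0..<n])"

text \<open>The specification of what \<open>rank_terms\<close> computes. It stays below the number
  of terms, so the rank function of every valuation is one of the candidates.\<close>

definition rank_of :: "('l, 'a, 'p) pta \<Rightarrow> ('p \<Rightarrow> rat) \<Rightarrow> 'p lterm \<Rightarrow> int" where
  "rank_of A v t = int (card {u \<in> terms A. eval_lterm (params A) v u < eval_lterm (params A) v t})"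

lemma ranks_rank_of:
  assumes "finite (terms A)"
  shows "ranks A v (rank_of A v)"
  unfolding ranks_def
proof (intro ballI)
  let ?e = "eval_lterm (params A) v"
  fix t u assume t: "t \<in> terms A" and u: "u \<in> terms A"
  show "?e t < ?e u \<longleftrightarrow> rank_of A v t < rank_of A v u"
  proof
    assume "?e t < ?e u"
    then have "{w \<in> terms A. ?e w < ?e t} \<subset> {w \<in> terms A. ?e w < ?e u}"
      using t by (intro psubsetI subsetI) (fastforce, blast)
    then show "rank_of A v t < rank_of A v u"
      unfolding rank_of_def using assms by (simp add: psubset_card_mono)
  next
    assume r: "rank_of A v t < rank_of A v u"
    show "?e t < ?e u"
    proof (rule ccontr)
      assume "\<not> ?e t < ?e u"
      then have "{w \<in> terms A. ?e w < ?e u} \<subseteq> {w \<in> terms A. ?e w < ?e t}" by (intro subsetI) simp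
      then have "rank_of A v u \<le> rank_of A v t"
        unfolding rank_of_def using assms by (simp add: card_mono)
      with r show False by simp
    qed
  qed
qed

lemma rank_of_bounds:
  assumes "finite (terms A)" "t \<in> terms A"
  shows "0 \<le> rank_of A v t" "rank_of A v t < int (card (terms A))"
proof -
  have "{u \<in> terms A. eval_lterm (params A) v u < eval_lterm (params A) v t} \<subset> terms A"
    using assms(2) by blast
  then show "rank_of A v t < int (card (terms A))"
    unfolding rank_of_def using assms(1) by (simp add: psubset_card_mono)
qed (simp add: rank_of_def)

context coded
begin

text \<open>If \<open>v'\<close> satisfies an accepted clause, the candidate ranks the terms under
  \<open>v'\<close>, and \<open>same_lang_iff\<close> yields equal languages. Conversely, the rank
  function of \<open>v'\<close> itself occurs among the candidates, is accepted by
  \<open>same_lang_iff\<close>, and its clause holds for \<open>v'\<close>.\<close>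

lemma accepted_correct:
  assumes ts: "distinct ts" "ts \<noteq> []" "set ts = terms A"
  shows "sat_dnf (params A) v' (accepted A ts (rank_of A v) (length ts ^ length ts))
    \<longleftrightarrow> lang (inst v' A) = lang (inst v A)"
proof -
  define N where "N = length ts"
  define M where "M = 2 * int N - 1"
  have fin: "finite (terms A)" by (rule finite_terms[OF pta])
  have card: "card (terms A) = N" using ts by (metis N_def distinct_card)
  have r: "ranked A v (rank_of A v) M"
  proof
    show "2 * rank_of A v t < M" if "t \<in> terms A" for t
      using rank_of_bounds(2)[OF fin that, of v] card by (simp add: M_def)
  qed (use pta det ranks_rank_of[OF fin] in simp_all)
  have s: "ranked A v' (candidate ts c) M" if "ranks A v' (candidate ts c)" for c
  proof
    show "2 * candidate ts c t < M" for t
      using candidate_bounds(2)[OF ts(2), of c t] by (simp add: M_def N_def)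
  qed (use pta det that in simp_all)
  have iff: "sat_dnf (params A) v' (accepted A ts (rank_of A v) (N ^ N)) \<longleftrightarrow>
      (\<exists>c < N ^ N. same_lang A M (rank_of A v) (candidate ts c) \<and> ranks A v' (candidate ts c))"
    unfolding sat_dnf_def accepted_def M_def N_def
    using order_clause_iff[OF ts(3), of _ v'] by auto
  show ?thesis
    unfolding N_def[symmetric] iff
  proof
    assume "\<exists>c < N ^ N. same_lang A M (rank_of A v) (candidate ts c) \<and> ranks A v' (candidate ts c)"
    then show "lang (inst v' A) = lang (inst v A)" using same_lang_iff[OF r s] by blast
  next
    assume L: "lang (inst v' A) = lang (inst v A)"
    \<comment> \<open>The counter value sought is the one whose digits are the ranks of the terms
      under \<open>v'\<close>.\<close>
    have "\<exists>c < N ^ N. \<forall>i < N. digit N c i = nat (rank_of A v' (ts ! i))"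
    proof (rule digits_surj)
      fix i assume "i < N"
      then have "ts ! i \<in> terms A" unfolding ts(3)[symmetric] N_def by (rule nth_mem)
      with rank_of_bounds[OF fin this, of v'] card show "nat (rank_of A v' (ts ! i)) < N" by simp
    qed (use ts in \<open>simp add: N_def\<close>)
    then obtain c where c: "c < N ^ N" "\<forall>i < N. digit N c i = nat (rank_of A v' (ts ! i))" by blast
    have eq: "candidate ts c t = rank_of A v' t" if "t \<in> terms A" for t
    proof -
      have "t \<in> set ts" using that ts(3) by simp
      then obtain i where i: "i < N" "ts ! i = t" unfolding in_set_conv_nth N_def by blast
      with candidate_nth[OF ts(1), of i c] c(2) rank_of_bounds(1)[OF fin that, of v'] show ?thesis
        by (simp add: N_def)
    qed
    have "ranks A v' (candidate ts c)"
      using ranks_rank_of[OF fin, of v'] eq unfolding ranks_def by metis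
    with same_lang_iff[OF r s] L c(1) show "\<exists>c < N ^ N. same_lang A M (rank_of A v) (candidate ts c) \<and> ranks A v' (candidate ts c)"
      by metis
  qed
qed

lemma main_loop:
  assumes T: "tables s ts" and R: "ranked_at s ts 0 R" and Rb: "0 \<le> R zterm" "R zterm < int (length ts)"
    and dig: "\<forall>i < length ts. s ''rk'' (int (length ts) + int i) = 0"
    and tot: "s ''tot'' 0 = int (length ts ^ length ts)" and cnt: "s ''cnt'' 0 = 0" and op: "s ''op'' 0 = 1"
    and vis: "\<forall>i. s ''vis'' i \<le> s ''stamp'' 0"
  shows "runs (For ''n'' ''tot'' (explore ;; Cond (Less (Const 0) (V ''ok'')) emit Skip ;; next_ranks)) s
    (\<lambda>\<tau> s'. \<tau> \<le> X ^ X * (TX + TM + X * 7 + 9) + 2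
      \<and> s' ''cnt'' 0 = int (length (accepted A ts R (length ts ^ length ts)))
      \<and> written s' (concat (map (list_code (constraint_code ps)) (accepted A ts R (length ts ^ length ts)))))"
proof -
  define N where "N = length ts"
  define M where "M = 2 * int N - 1"
  have ts: "distinct ts" "ts \<noteq> []" "length ts \<le> X" using T length_interned by (auto simp: tables_def interned_def)
  have N: "0 < N" "N \<le> X" using ts by (simp_all add: N_def)
  define P where "P c s' \<longleftrightarrow> ranked_at s' ts 0 R \<and> (\<forall>i < N. s' ''rk'' (int N + int i) = int (digit N c i))
    \<and> s' ''cnt'' 0 = int (length (accepted A ts R c))
    \<and> written s' (concat (map (list_code (constraint_code ps)) (accepted A ts R c)))
    \<and> (\<forall>i. s' ''vis'' i \<le> s' ''stamp'' 0)" for c s'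
  have Pc: "P c (t(''n'' := y)) \<longleftrightarrow> P c t" for c t y by (simp add: P_def ranked_at_def written_def)
  show ?thesis
  proof (rule runs_For[where n = "N ^ N" and c = "TX + TM + X * 7 + 7" and I = P], goal_cases)
    case 5
    show ?case unfolding Pc using R dig cnt op vis
      by (simp add: P_def accepted_def written_def digit_def N_def)
  next
    case (6 c s1)
    define S where "S = candidate ts c"
    have tv1: "\<forall>y \<in> table_vars. s1 y = s y" using 6(4) by simp
    have T1: "tables s1 ts" using tables_cong[OF T tv1] .
    have R1: "ranked_at s1 ts 0 R" using 6(2) by (simp add: P_def)
    have S1: "ranked_at s1 ts (int (length ts)) S"
      using 6(2) candidate_nth[OF ts(1), of _ c] by (simp add: P_def ranked_at_def N_def S_def)
    have z: "0 \<le> R zterm" "2 * R zterm < M" "0 \<le> S zterm" "2 * S zterm < M"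
      using Rb candidate_bounds[OF ts(2), of c zterm] by (simp_all add: S_def M_def N_def)
    have M: "M = 2 * int (length ts) - 1" by (simp add: M_def N_def)
    have v1: "\<forall>i. s1 ''vis'' i \<le> s1 ''stamp'' 0" using 6(2) by (simp add: P_def)
    have acc: "accepted A ts R (Suc c) = accepted A ts R c @ (if same_lang A M R S then [order_clause ts S] else [])"
      by (simp add: accepted_def S_def M)
    show ?case
      unfolding runs_Seq[of explore]
    proof (rule runs_call[OF explore[OF T1 R1 S1 z M v1]], goal_cases)
      case (1 t1 s2)
      have tv2: "\<forall>y \<in> table_vars. s2 y = s1 y" using 1(2) by simp
      have T2: "tables s2 ts" using tables_cong[OF T1 tv2] .
      have f2: "s2 ''rk'' = s1 ''rk''" "s2 ''cnt'' = s1 ''cnt''" "s2 ''op'' = s1 ''op''" "s2 ''out'' = s1 ''out''"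
        using 1(2) by simp_all
      have S2: "ranked_at s2 ts (int (length ts)) S" using S1 f2 by (simp add: ranked_at_def)
      have ok: "s2 ''ok'' 0 = (if same_lang A M R S then 1 else 0)" and t1: "t1 \<le> TX"
        and v2: "\<forall>i. s2 ''vis'' i \<le> s2 ''stamp'' 0" using 1(1) by blast+
      have w2: "written s2 (concat (map (list_code (constraint_code ps)) (accepted A ts R c)))"
        using 6(2) f2 by (simp add: P_def written_def)
      have c2: "s2 ''cnt'' 0 = int (length (accepted A ts R c))" using 6(2) f2 by (simp add: P_def)
      have body: "runs (Cond (Less (Const 0) (V ''ok'')) emit Skip) s2 (\<lambda>\<tau> s'. \<tau> \<le> TM + 2
        \<and> s' ''cnt'' 0 = int (length (accepted A ts R (Suc c)))
        \<and> written s' (concat (map (list_code (constraint_code ps)) (accepted A ts R (Suc c)))))"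
      proof (cases "same_lang A M R S")
        case True
        have "runs emit s2 (\<lambda>\<tau> s'. 1 + \<tau> \<le> TM + 2
          \<and> s' ''cnt'' 0 = int (length (accepted A ts R (Suc c)))
          \<and> written s' (concat (map (list_code (constraint_code ps)) (accepted A ts R (Suc c)))))"
          by (rule runs_call[OF emit[OF T2 S2 w2]]) (use True c2 in \<open>simp add: acc\<close>)
        with True ok show ?thesis by simp
      next
        case False
        with ok w2 c2 show ?thesis by (simp add: acc)
      qed
      show ?case
        unfolding runs_Seq
      proof (rule runs_call[OF body], goal_cases)
        case (1 t2 s3)
        have f3: "s3 ''rk'' = s1 ''rk''" "s3 ''vis'' = s2 ''vis''" "s3 ''stamp'' = s2 ''stamp''"
          using 1(2) f2 by simp_all
        have tv3: "\<forall>y \<in> table_vars. s3 y = s2 y" using 1(2) by simp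
        have nt3: "s3 ''nt'' 0 = int N" using tables_cong[OF T2 tv3] by (simp add: tables_def interned_def N_def)
        have rk3: "\<forall>i < N. s3 ''rk'' (int N + int i) = int (digit N c i)" using 6(2) f3 by (simp add: P_def)
        show ?case
        proof (rule runs_call[OF next_ranks[OF nt3 N rk3]], goal_cases)
          case (1 t3 s4)
          have f4: "s4 ''vis'' = s2 ''vis''" "s4 ''stamp'' = s2 ''stamp''" "s4 ''cnt'' = s3 ''cnt''" "s4 ''op'' = s3 ''op''" "s4 ''out'' = s3 ''out''"
            using 1(2) f3 by simp_all
          have "ranked_at s4 ts 0 R" using R1 1(1) f3 by (simp add: ranked_at_def N_def)
          moreover have "\<forall>i < N. s4 ''rk'' (int N + int i) = int (digit N (Suc c) i)" using 1(1) by blast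
          ultimately have "P (Suc c) s4"
            using \<open>t2 \<le> TM + 2 \<and> _\<close> v2 by (simp add: P_def f4 written_def)
          with t1 \<open>t2 \<le> TM + 2 \<and> _\<close> 1(1) show ?case by (simp add: Pc)
        qed
      qed
    qed
  next
    case (7 s' \<tau>)
    have "N ^ N \<le> X ^ N" using N by (intro power_mono) simp_all
    also have "\<dots> \<le> X ^ X" using N by (intro power_increasing) simp_all
    finally have "\<tau> \<le> X ^ X * (TX + TM + X * 7 + 9) + 2" by (intro loop_bound[OF 7(3)]) simp_all
    with 7(1) show ?case by (simp add: P_def N_def)
  qed (use tot in \<open>simp_all add: N_def\<close>)
qed

definition "TT = TQ + (X * (m * 6 + 10) + 2) + TR + (X * 3 + 3) + (X ^ X * (TX + TM + X * 7 + 9) + 2) + 3"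

lemma synth:
  assumes s: "s = load ws" and inp: "inp = s ''in''" and neg: "\<forall>i < 0. inp i = 0"
    and invs: "list_all2 (\<lambda>l. code_guard ps (invar A l)) ls invs"
    and es: "enumerates xs (edges A)" "list_all2 (code_edge ls acs ps) xs us"
    and ws: "seg inp 0 ([int (length ls), int (length acs), int m, position ls (start A)]
      @ concat invs @ (int (length xs) # concat us) @ valuation_code ps v)"
  shows "\<exists>t s' D. exec synth s t s' \<and> t \<le> TT \<and> outputs s' (dnf_code ps D)
    \<and> (\<forall>v'. sat_dnf (params A) v' D \<longleftrightarrow> lang (inst v' A) = lang (inst v A))"
proof -
  have z0: "s x i = 0" if "x \<noteq> ''in''" for x i using that by (simp add: s load_def)
  have s0: "s ''in'' = inp" "\<forall>i. s ''edge'' i = 0" using inp z0 by simp_all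
  have "runs synth s (\<lambda>t s'. t \<le> TT \<and> (\<exists>D. outputs s' (dnf_code ps D)
    \<and> (\<forall>v'. sat_dnf (params A) v' D \<longleftrightarrow> lang (inst v' A) = lang (inst v A))))"
    unfolding synth_def runs_Seq[of parse]
  proof (rule runs_call[OF parse[OF s0 neg invs es ws]], goal_cases)
    case (1 t1 s1)
    then obtain ts where T1: "tables s1 ts" and v1: "seg inp (s1 ''p'' 0) (valuation_code ps v)" by blast
    have q1: "s1 ''vis'' i = 0" "s1 ''stamp'' i = 0" for i using 1(2) z0 by simp_all
    have t1: "t1 \<le> TQ" using 1(1) by blast
    have ts: "distinct ts" "ts \<noteq> []" "set ts = terms A" "ts ! 0 = zterm" using T1 by (auto simp: tables_def interned_def)
    define N where "N = length ts"
    have NX: "N \<le> X" using length_interned[OF tablesD(2)[OF T1]] by (simp add: N_def)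
    show ?case
      unfolding runs_Seq[of evaluate]
    proof (rule runs_call[OF evaluate[OF T1 v1]], goal_cases)
      case (1 t2 s2)
      have tv2: "\<forall>y \<in> table_vars. s2 y = s1 y" using 1(2) by simp
      have T2: "tables s2 ts" using tables_cong[OF T1 tv2] .
      have q2: "s2 ''vis'' i = 0" "s2 ''stamp'' i = 0" for i using 1(2) q1 by simp_all
      have nt2: "s2 ''nt'' 0 = int N" using T2 by (simp add: tables_def interned_def N_def)
      have t2: "t2 \<le> X * (m * 6 + 10) + 2" and ev: "evaluates s2 ts v" using 1(1) by blast+
      have less: "s2 ''val'' (int i) < s2 ''val'' (int j) \<longleftrightarrow> eval_lterm (params A) v (ts ! i) < eval_lterm (params A) v (ts ! j)"
        if "i < N" "j < N" for i j
      proof -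
        from ev obtain d where d: "d > 0" "\<forall>i < length ts. of_int (s2 ''val'' (int i)) = d * eval_lterm (params A) v (ts ! i)"
          by (auto simp: evaluates_def)
        have "s2 ''val'' (int i) < s2 ''val'' (int j) \<longleftrightarrow> rat_of_int (s2 ''val'' (int i)) < of_int (s2 ''val'' (int j))"
          by simp
        also have "\<dots> \<longleftrightarrow> eval_lterm (params A) v (ts ! i) < eval_lterm (params A) v (ts ! j)"
          using d that by (simp add: N_def)
        finally show ?thesis .
      qed
      show ?case
        unfolding runs_Seq[of rank_terms]
      proof (rule runs_call[OF rank_terms[of s2 N, OF nt2 NX]], goal_cases)
        case (1 t3 s3)
        have tv3: "\<forall>y \<in> table_vars. s3 y = s2 y" using 1(2) by simp
        have T3: "tables s3 ts" using tables_cong[OF T2 tv3] .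
        have q3: "s3 ''vis'' i = 0" "s3 ''stamp'' i = 0" for i using 1(2) q2 by simp_all
        have nt3: "s3 ''nt'' 0 = int N" using T3 by (simp add: tables_def interned_def N_def)
        have t3: "t3 \<le> TR" using 1(1) by blast
        have rk3: "s3 ''rk'' (int i) = rank_of A v (ts ! i)" if "i < N" for i
        proof -
          have "{u \<in> terms A. eval_lterm (params A) v u < eval_lterm (params A) v (ts ! i)}
            = (\<lambda>j. ts ! j) ` {j. j < N \<and> s2 ''val'' (int j) < s2 ''val'' (int i)}"
            using less that unfolding ts(3)[symmetric] set_conv_nth N_def by auto
          moreover have "inj_on (\<lambda>j. ts ! j) {j. j < N \<and> s2 ''val'' (int j) < s2 ''val'' (int i)}"
            using ts(1) by (auto simp: inj_on_def N_def nth_eq_iff_index_eq)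
          ultimately have "rank_of A v (ts ! i) = int (card {j. j < N \<and> s2 ''val'' (int j) < s2 ''val'' (int i)})"
            by (simp add: rank_of_def card_image)
          with 1(1) that show ?thesis by simp
        qed
        have dig3: "\<forall>i < N. s3 ''rk'' (int N + int i) = 0" using 1(1) by blast
        show ?case
          unfolding runs_Seq[of count_ranks]
        proof (rule runs_call[OF count_ranks[of s3 N, OF nt3 NX]], goal_cases)
          case (1 t4 s4)
          define s5 where "s5 = s4(''cnt'' := (s4 ''cnt'')(0 := 0), ''op'' := (s4 ''op'')(0 := 1))"
          have tv5: "\<forall>y \<in> table_vars. s5 y = s3 y" using 1(2) by (simp add: s5_def)
          have T5: "tables s5 ts" using tables_cong[OF T3 tv5] .
          have f5: "s5 ''rk'' = s3 ''rk''" "s5 ''vis'' = s3 ''vis''" "s5 ''stamp'' = s3 ''stamp''" "s5 ''cnt'' 0 = 0" "s5 ''op'' 0 = 1"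
            using 1(2) by (simp_all add: s5_def)
          have tot5: "s5 ''tot'' 0 = int (length ts ^ length ts)" using 1(1) by (simp add: s5_def N_def)
          have R5: "ranked_at s5 ts 0 (rank_of A v)" using rk3 by (simp add: ranked_at_def f5 N_def)
          have card: "card (terms A) = length ts" using ts by (metis distinct_card)
          have zt: "zterm \<in> terms A" by (simp add: terms_def)
          have Rb: "0 \<le> rank_of A v zterm" "rank_of A v zterm < int (length ts)"
            using rank_of_bounds[OF finite_terms[OF pta] zt, of v] card by simp_all
          have dig5: "\<forall>i < length ts. s5 ''rk'' (int (length ts) + int i) = 0" using dig3 by (simp add: f5 N_def)
          have vis5: "\<forall>i. s5 ''vis'' i \<le> s5 ''stamp'' 0" by (simp add: f5 q3)
          define D where "D = accepted A ts (rank_of A v) (length ts ^ length ts)"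
          have t4: "t4 \<le> X * 3 + 3" using 1(1) by blast
          show ?case
            apply (simp add: s5_def[symmetric])
          proof (rule runs_call[OF main_loop[OF T5 R5 Rb dig5 tot5 f5(4,5) vis5]], goal_cases)
            case (1 t6 s6)
            have w: "written s6 (concat (map (list_code (constraint_code ps)) D))" "s6 ''cnt'' 0 = int (length D)"
              and t6: "t6 \<le> X ^ X * (TX + TM + X * 7 + 9) + 2"
              using 1(1) by (simp_all add: D_def)
            define s7 where "s7 = s6(''out'' := (s6 ''out'')(0 := int (length D)))"
            have "outputs s7 (dnf_code ps D)"
              unfolding outputs_def
            proof (intro allI impI)
              fix i assume i: "i < length (dnf_code ps D)"
              show "s7 ''out'' (int i) = dnf_code ps D ! i"
                using w(1) i by (cases i) (auto simp: s7_def dnf_code_def list_code_def written_def seg_def add.commute)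
            qed
            moreover have "\<forall>v'. sat_dnf (params A) v' D \<longleftrightarrow> lang (inst v' A) = lang (inst v A)"
              unfolding D_def using accepted_correct[OF ts(1-3)] by blast
            moreover have "t1 + (t2 + (t3 + (t4 + (1 + (1 + (t6 + 1)))))) \<le> TT"
              using t1 t2 t3 t4 t6 unfolding TT_def by linarith
            ultimately show ?case by (auto simp: w(2) s7_def)
          qed
        qed
      qed
    qed
  qed
  then show ?thesis unfolding runs_def by blast
qed

end

section \<open>Running time\<close>

text \<open>The bound 6 is where the inequality sets in for good: 49 against 64, while 36 exceeds 32
  at 5.\<close>

lemma square_le_power2: "6 \<le> n \<Longrightarrow> (n + 1) ^ 2 \<le> 2 ^ n" for n :: nat
proof (induction n rule: nat_induct_at_least)
  case (Suc n)
  have "(Suc n + 1) ^ 2 \<le> 2 * (n + 1) ^ 2"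
  proof -
    have "6 * 6 \<le> n * n" using Suc.hyps by (intro mult_le_mono)
    then show ?thesis by (simp add: power2_eq_square algebra_simps)
  qed
  with Suc.IH show ?case by simp
qed simp

text \<open>From 6 on, \<open>n + 7 \<le> 2 * (n + 1)\<close>, and squares are replaced by
  \<open>2 ^ n\<close>. For the finitely many smaller \<open>n\<close>, base and exponent are at
  most 7 and 13, which gives the generous constant.\<close>

lemma Suc_power_le: "(n + 1) ^ (n + 7) \<le> 7 ^ 13 * 2 ^ (n * (n + 1))" for n :: nat
proof (cases "6 \<le> n")
  case True
  have "(n + 1) ^ (n + 7) \<le> (n + 1) ^ (2 * (n + 1))"
    using True by (intro power_increasing) auto
  also have "\<dots> = ((n + 1) ^ 2) ^ (n + 1)" by (rule power_mult)
  also have "\<dots> \<le> (2 ^ n) ^ (n + 1)" by (rule power_mono[OF square_le_power2[OF True]]) simp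
  also have "\<dots> = 2 ^ (n * (n + 1))" by (rule power_mult[symmetric])
  also have "\<dots> \<le> 7 ^ 13 * 2 ^ (n * (n + 1))" by simp
  finally show ?thesis .
next
  case False
  have "(n + 1) ^ (n + 7) \<le> 7 ^ (n + 7)" using False by (intro power_mono) auto
  also have "\<dots> \<le> (7 :: nat) ^ 13" using False by (intro power_increasing) auto
  also have "\<dots> \<le> 7 ^ 13 * 2 ^ (n * (n + 1))" by simp
  finally show ?thesis .
qed

text \<open>The local constants are the coefficients in the bounds of \<open>TT_bound\<close>:
  \<open>cl\<close> for \<open>TL\<close> against \<open>X\<close>; \<open>cs\<close>,
  \<open>ce\<close>, \<open>cv\<close>, \<open>cp\<close>, \<open>cg\<close> for \<open>TS\<close>,
  \<open>TE\<close>, \<open>TV\<close>, \<open>TP\<close>, \<open>TG\<close> against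
  \<open>X ^ 2\<close>; \<open>cx\<close> and \<open>cq\<close> for \<open>TX\<close> and
  \<open>TQ\<close> against \<open>length ls * X ^ 6\<close>. The factor 16 is \<open>2 ^ 4\<close>
  from \<open>(2 * X) ^ 4\<close>.\<close>

definition time_const :: "nat \<Rightarrow> nat \<Rightarrow> nat" where
  "time_const k m =
    (let cl = 4 * m + 17; cs = 5 * (cl + 22) + 4; ce = 3 * cs + 20; cv = 4 * ce + 40;
         cp = k * (cv + 2) + 20; cx = 2 * cs + 40 + 16 * (cp + 1);
         cg = 5 * (cl + 8) + 4; cq = cg + 3 + k * (cg + 10) + 20
     in cq + (6 * m + 12) + 28 + 6 + cx + (4 * m + 31) + 7 + 9 + 2 + 3)"

context coded
begin

text \<open>The exponent \<open>X + 6\<close> splits into \<open>X\<close> for the candidates, 4 for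
  the interval ends in a node and 2 for processing a node, which scans guards of length
  \<open>O(X)\<close> with a linear search per constraint. All other costs are of lower order and
  are raised to this power.\<close>

lemma TT_bound: "TT \<le> time_const (length acs) m * (length ls * X ^ (X + 6))"
proof -
  define k where "k = length acs"
  define L where "L = length ls"
  define cl where "cl = 4 * m + 17"
  define cs where "cs = 5 * (cl + 22) + 4"
  define ce where "ce = 3 * cs + 20"
  define cv where "cv = 4 * ce + 40"
  define cp where "cp = k * (cv + 2) + 20"
  define cx where "cx = 2 * cs + 40 + 16 * (cp + 1)"
  define cg where "cg = 5 * (cl + 8) + 4"
  define cq where "cq = cg + 3 + k * (cg + 10) + 20"
  have X: "1 \<le> X" by (simp add: X_def)
  have "start A \<in> set ls" using pta ls by (simp add: extended_1c_pta_def)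
  then have L: "1 \<le> L" unfolding L_def by (cases ls) auto
  have up: "c * X ^ i \<le> c * X ^ j" if "i \<le> j" for c i j :: nat
    using that X by (intro mult_left_mono power_increasing) auto
  have c2: "c \<le> c * X ^ 2" for c using up[of 0 2 c] by simp
  have c1: "c \<le> c * X" for c using X by simp
  have x2: "c * X \<le> c * X ^ 2" for c using up[of 1 2 c] by simp
  have TL: "TL \<le> cl * X" using c1[of 3] by (simp add: TL_def cl_def algebra_simps)
  have TS: "TS \<le> cs * X ^ 2"
  proof -
    have "TL + 22 \<le> (cl + 22) * X" using TL c1[of 22] unfolding add_mult_distrib by linarith
    then have "5 * X * (TL + 22) \<le> 5 * X * ((cl + 22) * X)" by (rule mult_left_mono) simp
    also have "\<dots> = 5 * (cl + 22) * X ^ 2" by (simp only: power2_eq_square ac_simps)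
    finally show ?thesis unfolding TS_def cs_def add_mult_distrib using c2[of 4] by linarith
  qed
  have TG: "TG \<le> cg * X ^ 2"
  proof -
    have "TL + 8 \<le> (cl + 8) * X" using TL c1[of 8] unfolding add_mult_distrib by linarith
    then have "5 * X * (TL + 8) \<le> 5 * X * ((cl + 8) * X)" by (rule mult_left_mono) simp
    also have "\<dots> = 5 * (cl + 8) * X ^ 2" by (simp only: power2_eq_square ac_simps)
    finally show ?thesis unfolding TG_def cg_def add_mult_distrib using c2[of 4] by linarith
  qed
  have TE: "TE \<le> ce * X ^ 2"
  proof -
    have "ce * X ^ 2 = 3 * (cs * X ^ 2) + 20 * X ^ 2" by (simp only: ce_def add_mult_distrib mult.assoc)
    then show ?thesis unfolding TE_def using TS c2[of 20] by linarith
  qed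
  have TV: "TV \<le> cv * X ^ 2"
  proof -
    have "cv * X ^ 2 = 4 * (ce * X ^ 2) + 40 * X ^ 2" by (simp only: cv_def add_mult_distrib mult.assoc)
    then show ?thesis unfolding TV_def using TE c2[of 40] by linarith
  qed
  have TP: "TP \<le> cp * X ^ 2"
  proof -
    have "TV + 2 \<le> (cv + 2) * X ^ 2" using TV c2[of 2] unfolding add_mult_distrib by linarith
    then have "k * (TV + 2) \<le> k * ((cv + 2) * X ^ 2)" by (rule mult_left_mono) simp
    moreover have "cp * X ^ 2 = k * ((cv + 2) * X ^ 2) + 20 * X ^ 2" by (simp only: cp_def add_mult_distrib mult.assoc)
    ultimately show ?thesis unfolding TP_def k_def[symmetric] using c2[of 20] by linarith
  qed
  \<comment> \<open>The order of magnitude of one exploration; every cost outside the main loop is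
    also bounded by a multiple of \<open>B\<close>.\<close>
  define B where "B = L * X ^ 6"
  have B: "c * X ^ 2 \<le> c * B" for c
  proof -
    have "X ^ 2 \<le> 1 * X ^ 6" using up[of 2 6 1] by simp
    also have "\<dots> \<le> B" unfolding B_def using L by (rule mult_right_mono) simp
    finally show ?thesis by simp
  qed
  have TX: "TX \<le> cx * B"
  proof -
    have "TP + 1 \<le> (cp + 1) * X ^ 2" using TP c2[of 1] unfolding add_mult_distrib by linarith
    then have "L * (2 * X) ^ 4 * (TP + 1) \<le> L * (2 * X) ^ 4 * ((cp + 1) * X ^ 2)" by (rule mult_left_mono) simp
    also have "\<dots> = 16 * (cp + 1) * B" by (simp add: B_def power_mult_distrib power_eq_if algebra_simps)
    finally have 1: "L * (2 * X) ^ 4 * (TP + 1) \<le> 16 * (cp + 1) * B" .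
    have "cx * B = 2 * (cs * B) + 40 * B + 16 * (cp + 1) * B" by (simp only: cx_def add_mult_distrib mult.assoc)
    then show ?thesis unfolding TX_def L_def[symmetric] using 1 TS B[of cs] B[of 40] c2[of 40] by linarith
  qed
  have TQ: "TQ \<le> cq * B"
  proof -
    have b: "L * (c * X ^ 2) \<le> c * B" for c
      using up[of 2 6 "L * c"] by (simp add: B_def ac_simps)
    have "TG + 3 \<le> (cg + 3) * X ^ 2" using TG c2[of 3] unfolding add_mult_distrib by linarith
    then have "L * (TG + 3) \<le> L * ((cg + 3) * X ^ 2)" by (rule mult_left_mono) simp
    then have 1: "L * (TG + 3) \<le> (cg + 3) * B" using b[of "cg + 3"] by linarith
    have "TG + 10 \<le> (cg + 10) * X ^ 2" using TG c2[of 10] unfolding add_mult_distrib by linarith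
    then have "L * k * (TG + 10) \<le> L * k * ((cg + 10) * X ^ 2)" by (rule mult_left_mono) simp
    also have "\<dots> = L * ((k * (cg + 10)) * X ^ 2)" by (simp only: ac_simps)
    finally have 2: "L * k * (TG + 10) \<le> k * (cg + 10) * B" using b[of "k * (cg + 10)"] by linarith
    have "cq * B = (cg + 3) * B + k * (cg + 10) * B + 20 * B" by (simp only: cq_def add_mult_distrib)
    then show ?thesis unfolding TQ_def L_def[symmetric] k_def[symmetric] using 1 2 c2[of 20] B[of 20] by linarith
  qed
  have TM: "TM \<le> (4 * m + 31) * B"
  proof -
    have "TM = (4 * m + 17) * X ^ 2 + 4 * X + 10" by (simp add: TM_def power2_eq_square algebra_simps)
    also have "\<dots> \<le> (4 * m + 31) * X ^ 2" using x2[of 4] c2[of 10] by (simp add: algebra_simps)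
    finally show ?thesis using B[of "4 * m + 31"] by linarith
  qed
  have TR: "TR \<le> 28 * B"
  proof -
    have "TR = 6 * X ^ 2 + 12 * X + 10" by (simp add: TR_def power2_eq_square algebra_simps)
    then show ?thesis using x2[of 12] c2[of 10] B[of 28] by linarith
  qed
  have e: "X * (m * 6 + 10) + 2 \<le> (6 * m + 12) * B"
  proof -
    have "X * (m * 6 + 10) + 2 = (6 * m + 10) * X + 2" by (simp add: algebra_simps)
    also have "\<dots> \<le> (6 * m + 12) * X ^ 2" using x2[of "6 * m + 10"] c2[of 2] by (simp add: algebra_simps)
    finally show ?thesis using B[of "6 * m + 12"] by linarith
  qed
  define Z where "Z = X ^ X * B"
  have Z: "c * B \<le> c * Z" for c
  proof -
    have "1 * B \<le> X ^ X * B" using X by (intro mult_right_mono) auto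
    then show ?thesis by (simp add: Z_def)
  qed
  have one: "c \<le> c * B" for c using c2[of c] B[of c] by linarith
  have x: "c * X \<le> c * B" for c using x2[of c] B[of c] by linarith
  have "X ^ X * (TX + TM + X * 7 + 9) \<le> X ^ X * ((cx + (4 * m + 31) + 7 + 9) * B)"
  proof (rule mult_left_mono)
    show "TX + TM + X * 7 + 9 \<le> (cx + (4 * m + 31) + 7 + 9) * B"
      using TX TM x[of 7] one[of 9] unfolding add_mult_distrib by linarith
  qed simp
  also have "\<dots> = (cx + (4 * m + 31) + 7 + 9) * Z" by (simp only: Z_def ac_simps)
  finally have main: "X ^ X * (TX + TM + X * 7 + 9) \<le> (cx + (4 * m + 31) + 7 + 9) * Z" .
  have "TT \<le> cq * Z + (6 * m + 12) * Z + 28 * Z + 6 * Z + ((cx + (4 * m + 31) + 7 + 9) * Z + 2 * Z) + 3 * Z"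
    unfolding TT_def
    using order_trans[OF TQ Z] order_trans[OF e Z] order_trans[OF TR Z] main
      order_trans[OF one[of 2] Z] order_trans[OF one[of 3] Z] order_trans[OF x[of 3] Z] by linarith
  also have "\<dots> = (cq + (6 * m + 12) + 28 + 6 + cx + (4 * m + 31) + 7 + 9 + 2 + 3) * Z"
    by (simp only: add_mult_distrib)
  also have "cq + (6 * m + 12) + 28 + 6 + cx + (4 * m + 31) + 7 + 9 + 2 + 3 = time_const (length acs) m"
    by (simp only: time_const_def Let_def cq_def cx_def cg_def cp_def cv_def ce_def cs_def cl_def k_def)
  also have "Z = length ls * X ^ (X + 6)"
    by (simp add: Z_def B_def L_def power_add ac_simps)
  finally show ?thesis .
qed

end

lemma load_seg: "seg (load ws ''in'') 0 ws"
  by (simp add: seg_def load_def)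

text \<open>The constant depends on \<open>k\<close> and \<open>m\<close> because each node is tried
  with \<open>k\<close> actions and reading a term touches \<open>m + 1\<close> cells; its value is
  \<open>time_const k m * 7 ^ 13\<close>.\<close>

theorem theorem5p7:
  shows "\<exists>synth :: prog. \<forall>k m :: nat. \<exists>C :: nat.
    \<forall>(A :: ('l, 'a, 'p) pta) v ps ws.
      extended_1c_pta A \<and> deterministic A \<and> v \<in> valuations A
      \<and> card (acts A) = k \<and> card (params A) = m \<and> code_input ps A v ws \<longrightarrow>
      (\<exists>t s D. exec synth (load ws) t s
         \<and> t \<le> C * (card (locs A) * 2 ^ (card (LT A) * (card (LT A) + 1)))
         \<and> outputs s (dnf_code ps D)
         \<and> {v' \<in> valuations A. lang (inst v' A) = lang (inst v A)}
             = {v' \<in> valuations A. sat_dnf (params A) v' D})"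
proof (intro exI[of _ synth] allI, rule exI, intro allI impI)
  fix k m and A :: "('l, 'a, 'p) pta" and v ps ws
  assume *: "extended_1c_pta A \<and> deterministic A \<and> v \<in> valuations A
      \<and> card (acts A) = k \<and> card (params A) = m \<and> code_input ps A v ws"
  then obtain ls acs invs es where
    en: "enumerates ls (locs A)" "enumerates acs (acts A)" "enumerates ps (params A)" and
    invs: "list_all2 (\<lambda>l. code_guard ps (invar A l)) ls invs" and
    es: "code_set (code_edge ls acs ps) (edges A) es" and
    ws: "ws = [int (length ls), int (length acs), int (length ps), position ls (start A)]
             @ concat invs @ es @ valuation_code ps v"
    unfolding code_input_def by blast
  from es obtain xs us where xs: "enumerates xs (edges A)" "list_all2 (code_edge ls acs ps) xs us"
    and es: "es = int (length xs) # concat us" unfolding code_set_def by blast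
  interpret coded A ps ls acs "load ws ''in''"
    using * en by unfold_locales (auto simp: enumerates_def)
  have len: "length ls = card (locs A)" "length acs = k" "length ps = m"
    using * ls acs ps by (metis distinct_card)+
  have neg: "\<forall>i < 0. load ws ''in'' i = 0" by (simp add: load_def)
  have "ws = [int (length ls), int (length acs), int (length ps), position ls (start A)]
      @ concat invs @ (int (length xs) # concat us) @ valuation_code ps v"
    using ws unfolding es .
  from subst[where P = "seg (load ws ''in'') 0", OF this load_seg] obtain t s D where
    r: "exec synth (load ws) t s" "t \<le> TT" "outputs s (dnf_code ps D)"
      "\<forall>v'. sat_dnf (params A) v' D \<longleftrightarrow> lang (inst v' A) = lang (inst v A)"
    using synth[OF refl refl neg invs xs, of v] by blast
  have "TT \<le> time_const k m * (card (locs A) * (card (LT A) + 1) ^ (card (LT A) + 7))"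
    using TT_bound by (simp add: len X_def add.commute)
  also have "\<dots> \<le> time_const k m * (card (locs A) * (7 ^ 13 * 2 ^ (card (LT A) * (card (LT A) + 1))))"
    by (intro mult_left_mono Suc_power_le) simp_all
  also have "\<dots> = (time_const k m * 7 ^ 13) * (card (locs A) * 2 ^ (card (LT A) * (card (LT A) + 1)))"
    by (simp only: ac_simps)
  finally show "\<exists>t s D. exec synth (load ws) t s
         \<and> t \<le> (time_const k m * 7 ^ 13) * (card (locs A) * 2 ^ (card (LT A) * (card (LT A) + 1)))
         \<and> outputs s (dnf_code ps D)
         \<and> {v' \<in> valuations A. lang (inst v' A) = lang (inst v A)}
             = {v' \<in> valuations A. sat_dnf (params A) v' D}"
    using r by (intro exI[of _ t] exI[of _ s] exI[of _ D]) auto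
qed

end
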